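(* Let $A\in\mathbb{R}^{n\times n}$, $B\in\mathbb{R}^{n\times m}$, $C\in\mathbb{R}^{s\times n}$, $D\in\mathbb{R}^{s\times m}$, $\Sigma=\Sigma(A,B,C,D)$, and let $\mathcal{Y}\subseteq\mathbb{R}^s$ be a convex set with $0\in\mathcal{Y}$ such that $\mathcal{Y}\cap\operatorname{im}\begin{bmatrix}C & D\end{bmatrix}$ has nonempty interior in $\mathbb{R}^s$. Suppose that $\mathcal{K}(\Sigma)\cap\operatorname{int}(\mathcal{Y})\neq\emptyset$ and that $\mathcal{Y}$ is hyperbolic. Then the following conditions are equivalent: (1) $X(F^\circ)=\{0\}$. (2) Both of the following hold: (a) $F_{\mathrm{con}}$ is reachable; (b) $(F_{\mathrm{rec}})^{-1}$ is strict and weakly asymptotically stable. (3) All of the following hold: (a) $\Sigma$ is controllable (i.e. the pair $(A,B)$ is controllable); (b) for all $\lambda\in[0,+\infty)$, $u\in\mathcal{Y}^+$ and $q\in\mathbb{R}^n$, $$\begin{bmatrix}A^T-\lambda I_n\\ B^T\end{bmatrix}q+\begin{bmatrix}C^T\\ D^T\end{bmatrix}u=0\ \Rightarrow\ q=0;$$ (c) $\mathcal{V}_g^*([0^+\mathcal{Y}]^\perp,\Sigma^T)=\{0\}$; (d) for all $\lambda\in[0,1]$, $u\in-\mathcal{Y}^{\mathrm{b}}$ and $q\in\mathbb{R}^n$, $$\begin{bmatrix}A^T-\lambda I_n\\ B^T\end{bmatrix}q+\begin{bmatrix}C^T\\ D^T\end{bmatrix}u=0\ \Rightarrow\ q=0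.$$
   Context: $\Sigma=\Sigma(A,B,C,D)$ denotes the discrete-time linear system $x_{k+1}=Ax_k+Bu_k$, $y_k=Cx_k+Du_k$ with state in $\mathbb{R}^n$, input in $\mathbb{R}^m$, output in $\mathbb{R}^s$. Its dual is $\Sigma^T=\Sigma(A^T,C^T,B^T,D^T)$. Subspaces. The strongly reachable subspace $\mathcal{T}^*(\Sigma)$ is the set of $x\in\mathbb{R}^n$ for which there are $u_0,\dots,u_{n-1}$ and $x_0=0,x_1,\dots,x_n=x$ with $x_{k+1}=Ax_k+Bu_k$ and $Cx_k+Du_k=0$ for $0\le k\le n-1$. Put $\mathcal{K}(\Sigma)=\operatorname{im}D+C\mathcal{T}^*(\Sigma)\subseteq\mathbb{R}^s$. For a subspace $\mathcal{U}\subseteq\mathbb{R}^s$ (the input space of $\Sigma^T$ is $\mathbb{R}^s$), $\mathcal{V}_g^*(\mathcal{U},\Sigma^T)$ is the set of $q\in\mathbb{R}^n$ for which there exist a bounded sequence $\{q_i\}_{i\ge0}\subset\mathbb{R}^n$ with $q_0=q$ and a sequence $\{v_i\}_{i\ge0}\subset\mathcal{U}$ with $q_{i+1}=A^Tq_i+C^Tv_i$ and $0=B^Tq_i+D^Tv_i$ for all $i\ge0$. Convex sets. For a nonempty convex set $S\subseteq\mathbb{R}^h$: $\operatorname{cone}(S)$ is the smallest convex cone containing $S$ and the origin; the recession cone is $0^+S=\{y: x+\mu y\in S\ \text{for all } x\in S,\ \mu\ge0\}$; the polar set is $S^\circ=\{q:\langle q,x\rangle\le1\ \forall x\in S\}$;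 the negative polar cone is $S^-=\{q:\langle q,x\rangle\le0\ \forall x\in S\}$ and the positive polar cone is $S^+=-S^-$; the barrier cone is $S^{\mathrm{b}}=\{q:\sup_{x\in S}\langle q,x\rangle<+\infty\}$. $S$ is hyperbolic if $S\subseteq\mu\mathbb{B}+0^+S$ for some $\mu\ge0$, where $\mathbb{B}$ is the closed Euclidean unit ball. $[0^+\mathcal{Y}]^\perp$ is the orthogonal complement of $0^+\mathcal{Y}$. Set-valued mappings. For $H:\mathbb{R}^r\rightrightarrows\mathbb{R}^r$, $\operatorname{gr}(H)=\{(x,y):y\in H(x)\}$, $\operatorname{dom}H=\{x:H(x)\ne\emptyset\}$, $H^{-1}$ is the mapping with $y\in H^{-1}(x)\iff x\in H(y)$, $H$ is strict if $\operatorname{dom}H=\mathbb{R}^r$. $X(H)$ is the set of $x_0$ from which there is an infinite sequence with $x_{k+1}\in H(x_k)$ for all $k\ge0$; $R(H)=\bigcup_{\ell\ge1}H^\ell(0)$. $H$ is reachable if $X(H)\subseteq R(H)$. $H$ is weakly asymptotically stable if for each $x\in\operatorname{dom}H$ there is an infinite sequence $\{x_k\}_{k\ge0}$ with $x_0=x$, $x_{k+1}\in H(x_k)$ and $\lim_{k\to\infty}x_k=0$. The dual $H^\circ$ is defined by $\operatorname{gr}(H^\circ)=\begin{bmatrix}0&I_r\\-I_r&0\end{bmatrix}\operatorname{gr}(H)^\circ$. Mappings of the constrained system. $F,F_{\mathrm{con}},F_{\mathrm{rec}}:\mathbb{R}^n\rightrightarrows\mathbb{R}^n$ are defined by $F(x)=\{Ax+Bu: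 u\in\mathbb{R}^m,\ Cx+Du\in\mathcal{Y}\}$, and $F_{\mathrm{con}}$, $F_{\mathrm{rec}}$ by the same formula with $\mathcal{Y}$ replaced by $\operatorname{cone}(\mathcal{Y})$ and $0^+\mathcal{Y}$, respectively. *)

theory Defs
  imports "HOL-Analysis.Analysis"
begin

section \<open>Convex sets\<close>

text \<open>
  The conical hull of \<open>S\<close> is the library's \<open>convex_cone hull (insert 0 S)\<close>, and the orthogonal
  complement is the library's \<open>orthogonal_comp\<close>.
\<close>

definition recession_cone :: "'a::real_vector set \<Rightarrow> 'a set" where
  "recession_cone S = {y. \<forall>x\<in>S. \<forall>\<mu>\<ge>0. x + \<mu> *\<^sub>R y \<in> S}"

definition polar_set :: "'a::real_inner set \<Rightarrow> 'a set" where
  "polar_set S = {q. \<forall>x\<in>S. q \<bullet> x \<le> 1}"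

definition neg_polar_cone :: "'a::real_inner set \<Rightarrow> 'a set" where
  "neg_polar_cone S = {q. \<forall>x\<in>S. q \<bullet> x \<le> 0}"

definition pos_polar_cone :: "'a::real_inner set \<Rightarrow> 'a set" where
  "pos_polar_cone S = uminus ` neg_polar_cone S"

definition barrier_cone :: "'a::real_inner set \<Rightarrow> 'a set" where
  "barrier_cone S = {q. bdd_above ((\<lambda>x. q \<bullet> x) ` S)}"

definition hyperbolic_set :: "'a::real_normed_vector set \<Rightarrow> bool" where
  "hyperbolic_set S \<longleftrightarrow>
     (\<exists>\<mu>\<ge>0. S \<subseteq> {\<mu> *\<^sub>R b + y | b y. b \<in> cball 0 1 \<and> y \<in> recession_cone S})"


section \<open>Set-valued mappings\<close>

definition sv_graph :: "('a \<Rightarrow> 'b set) \<Rightarrow> ('a \<times> 'b) set" where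
  "sv_graph H = {(x, y). y \<in> H x}"

definition sv_dom :: "('a \<Rightarrow> 'b set) \<Rightarrow> 'a set" where
  "sv_dom H = {x. H x \<noteq> {}}"

definition sv_inverse :: "('a \<Rightarrow> 'b set) \<Rightarrow> 'b \<Rightarrow> 'a set" where
  "sv_inverse H = (\<lambda>x. {y. x \<in> H y})"

definition sv_strict :: "('a \<Rightarrow> 'b set) \<Rightarrow> bool" where
  "sv_strict H \<longleftrightarrow> sv_dom H = UNIV"

primrec sv_power :: "nat \<Rightarrow> ('a \<Rightarrow> 'a set) \<Rightarrow> 'a \<Rightarrow> 'a set" where
  "sv_power 0 H x = {x}"
| "sv_power (Suc l) H x = (\<Union>y\<in>sv_power l H x. H y)"

definition feasible_states :: "('a \<Rightarrow> 'a set) \<Rightarrow> 'a set" where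
  "feasible_states H = {x0. \<exists>x. x 0 = x0 \<and> (\<forall>k::nat. x (Suc k) \<in> H (x k))}"

definition reachable_states :: "('a::zero \<Rightarrow> 'a set) \<Rightarrow> 'a set" where
  "reachable_states H = (\<Union>l\<in>{1..}. sv_power l H 0)"

definition sv_reachable :: "('a::zero \<Rightarrow> 'a set) \<Rightarrow> bool" where
  "sv_reachable H \<longleftrightarrow> feasible_states H \<subseteq> reachable_states H"

definition weakly_asymptotically_stable :: "('a::real_normed_vector \<Rightarrow> 'a set) \<Rightarrow> bool" where
  "weakly_asymptotically_stable H \<longleftrightarrow>
     (\<forall>x0\<in>sv_dom H. \<exists>x. x 0 = x0 \<and> (\<forall>k::nat. x (Suc k) \<in> H (x k)) \<and> x \<longlonglongrightarrow> 0)"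

text \<open>
  The graph of the dual is the image of the polar of the graph under the block matrix with rows
  \<open>(0, I)\<close> and \<open>(-I, 0)\<close>, that is, under \<open>(p, q) \<mapsto> (q, -p)\<close>. The polar is taken in the product
  space, whose library inner product is the sum of the componentwise ones.
\<close>

definition sv_dual :: "('a::real_inner \<Rightarrow> 'a set) \<Rightarrow> 'a \<Rightarrow> 'a set" where
  "sv_dual H = (\<lambda>x. {y. (x, y) \<in> (\<lambda>(p, q). (q, - p)) ` polar_set (sv_graph H)})"


section \<open>Linear systems\<close>

definition constrained_map ::
  "real^'n^'n \<Rightarrow> real^'m^'n \<Rightarrow> real^'n^'s \<Rightarrow> real^'m^'s \<Rightarrow> (real^'s) set \<Rightarrow> real^'n \<Rightarrow> (real^'n) set"
  where "constrained_map A B C D Y x = {A *v x + B *v u | u. C *v x + D *v u \<in> Y}"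

definition controllable :: "real^'n^'n \<Rightarrow> real^'m^'n \<Rightarrow> bool" where
  "controllable A B \<longleftrightarrow>
     (\<forall>x0 xf. \<exists>(l::nat) u x. x 0 = x0 \<and> x l = xf \<and> (\<forall>k<l. x (Suc k) = A *v x k + B *v u k))"

definition strongly_reachable ::
  "real^'n^'n \<Rightarrow> real^'m^'n \<Rightarrow> real^'n^'s \<Rightarrow> real^'m^'s \<Rightarrow> (real^'n) set" where
  "strongly_reachable A B C D =
     {xf. \<exists>u x. x 0 = 0 \<and> x CARD('n) = xf \<and>
            (\<forall>k<CARD('n). x (Suc k) = A *v x k + B *v u k \<and> C *v x k + D *v u k = 0)}"

definition output_subspace ::
  "real^'n^'n \<Rightarrow> real^'m^'n \<Rightarrow> real^'n^'s \<Rightarrow> real^'m^'s \<Rightarrow> (real^'s) set" where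
  "output_subspace A B C D = {D *v u + C *v x | u x. x \<in> strongly_reachable A B C D}"

text \<open>
  The set below is defined for an arbitrary system \<open>\<Sigma>(A, B, C, D)\<close>; the dual system is obtained by
  passing \<open>A\<^sup>T, C\<^sup>T, B\<^sup>T, D\<^sup>T\<close> in this order. Only the state sequence is required to be bounded.
\<close>

definition bounded_output_nulling ::
  "(real^'m) set \<Rightarrow> real^'n^'n \<Rightarrow> real^'m^'n \<Rightarrow> real^'n^'s \<Rightarrow> real^'m^'s \<Rightarrow> (real^'n) set" where
  "bounded_output_nulling U A B C D =
     {q0. \<exists>(q :: nat \<Rightarrow> real^'n) v. q 0 = q0 \<and> bounded (range q) \<and> (\<forall>i. v i \<in> U) \<and>
            (\<forall>i. q (Suc i) = A *v q i + B *v v i \<and> 0 = C *v q i + D *v v i)}"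

end

theory Submission
  imports Defs "HOL-Library.Diagonal_Subsequence"
begin

text \<open>
  All conditions are compared with the statement that the dual process
  \<open>q' = A\<^sup>T q + C\<^sup>T v\<close>, \<open>0 = B\<^sup>T q + D\<^sup>T v\<close>, \<open>v \<in> - Y\<^sup>\<circ>\<close>, has no infinite trajectory from a nonzero
  state, which is condition (1). Because \<open>\<K>(\<Sigma>)\<close> meets the interior of \<open>Y\<close>, the norm of a dual
  input is controlled by that of the dual state; so an unbounded dual trajectory can be normalized
  and converges along a subsequence to a nonzero trajectory with inputs in \<open>Y\<^sup>+\<close>, while a bounded
  one has its inputs in the closed cone \<open>- Y\<^sup>b\<close>. Both kinds are thus trajectories of closed convex
  cone processes, and it suffices to know that such a process has a nonzero bounded trajectory only
  if it has an eigenvector with eigenvalue in \<open>[0, 1]\<close> or a nonzero bounded trajectory in the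
  lineality space of its graph. This is shown by summing a trajectory over long stretches whose end
  points nearly agree, so no fixed point theorem is needed.

  For the primal condition (2), pairing a dual trajectory with a primal one gives one implication.
  For the other, separation shows that under (1) every state is reached from the origin with outputs
  \<open>y\<^sub>k \<in> s\<^sub>k Y\<close> of arbitrarily small total weight \<open>\<Sum> s\<^sub>k\<close>; by hyperbolicity, such a path follows the
  recession system up to small errors, which are removed by an iteration.
\<close>

section \<open>Bounded trajectories of closed convex cone processes\<close>

text \<open>Two obstacles shape the summation argument. Sums may cancel; inside a convex cone this
  forces the summands towards the lineality space, which is why (3) lists (a) and (c) beside the
  eigenvalue conditions. And a bounded trajectory may tend to zero, where end points agree only
  because both are small; it is therefore weighted by powers of some \<delta> \<ge> 1, and the
  eigenvalue found is a limit of reciprocals 1 / \<delta>, hence in [0, 1]. A limit of normalized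
  unbounded trajectories grows at most like R^j for some R \<ge> 1; dividing by R^j makes it
  bounded, and an eigenvalue t of the rescaled process is an eigenvalue R t of the original one,
  which accounts for the range [0, \<infinity>) in (3b). Its inputs lie in Y^+, a pointed cone
  because Y has interior points, so the lineality space of that graph consists of zero-input steps,
  and controllability excludes such trajectories.\<close>

lemma pointwise_convergent_subsequence:
  fixes r :: "nat \<Rightarrow> nat \<Rightarrow> 'a::heine_borel"
  assumes "\<And>j. bounded (range (\<lambda>k. r k j))"
  obtains s l where "strict_mono (s :: nat \<Rightarrow> nat)" "\<And>j. (\<lambda>k. r (s k) j) \<longlonglongrightarrow> l j"
proof -
  interpret subseqs "\<lambda>n s. convergent (\<lambda>k. r (s k) n)"
  proof
    fix n and s :: "nat \<Rightarrow> nat"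
    have "bounded (range (\<lambda>k. r (s k) n))"
      by (rule bounded_subset[OF assms[of n]]) auto
    from bounded_imp_convergent_subsequence[OF this]
    obtain l t where "strict_mono (t :: nat \<Rightarrow> nat)" "((\<lambda>k. r (s k) n) \<circ> t) \<longlonglongrightarrow> l"
      by blast
    then show "\<exists>r'. strict_mono r' \<and> convergent (\<lambda>k. r ((s \<circ> r') k) n)"
      by (auto simp: convergent_def o_def)
  qed
  have "convergent (\<lambda>k. r (diagseq k) j)" for j
  proof -
    have "convergent (\<lambda>k. r ((diagseq \<circ> ((+) (Suc j))) k) j)"
    proof (rule diagseq_holds)
      fix t s :: "nat \<Rightarrow> nat" and n
      assume "strict_mono t" "convergent (\<lambda>k. r (s k) n)"
      then show "convergent (\<lambda>k. r ((s \<circ> t) k) n)"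
        using convergent_subseq_convergent[of "\<lambda>k. r (s k) n" t] unfolding o_def by blast
    qed
    then have "convergent (\<lambda>k. r (diagseq (k + Suc j)) j)"
      by (simp add: o_def add.commute)
    then show ?thesis
      using convergent_ignore_initial_segment[of "\<lambda>k. r (diagseq k) j" "Suc j"] by simp
  qed
  then have "\<exists>l. (\<lambda>k. r (diagseq k) j) \<longlonglongrightarrow> l" for j
    by (simp add: convergent_def)
  then obtain l where "\<And>j. (\<lambda>k. r (diagseq k) j) \<longlonglongrightarrow> l j"
    by metis
  then show thesis
    by (rule that[OF subseq_diagseq])
qed

lemma strict_mono_tendsto:
  assumes "strict_mono (s :: nat \<Rightarrow> nat)" "f \<longlonglongrightarrow> l"
  shows "(\<lambda>k. f (s k)) \<longlonglongrightarrow> l"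
  using LIMSEQ_subseq_LIMSEQ[OF assms(2,1)] by (simp add: o_def)

lemma not_tendsto_0_subsequence:
  fixes f :: "nat \<Rightarrow> 'a::real_normed_vector"
  assumes "\<not> f \<longlonglongrightarrow> 0"
  obtains \<eta> s where "\<eta> > 0" "strict_mono (s :: nat \<Rightarrow> nat)" "\<And>k. \<eta> \<le> norm (f (s k))"
proof -
  obtain \<eta> where \<eta>: "\<eta> > 0" "\<exists>\<^sub>F k in sequentially. \<eta> \<le> norm (f k)"
    using assms unfolding tendsto_iff frequently_def not_le by auto
  then have "infinite {k. \<eta> \<le> norm (f k)}"
    by (simp add: frequently_cofinite flip: cofinite_eq_sequentially)
  from infinite_enumerate[OF this] \<eta>(1) show thesis
    using that by auto
qed

lemma convex_cone_sum:
  assumes "convex_cone S" "\<And>i. i \<in> I \<Longrightarrow> x i \<in> S"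
  shows "sum x I \<in> S"
  using assms(2)
  by (induction I rule: infinite_finite_induct)
     (auto simp: convex_cone_contains_0[OF assms(1)] intro: convex_cone_add[OF assms(1)])

text \<open>Any point of the relative interior of the dual cone will do.\<close>

lemma closed_convex_cone_functional:
  fixes \<Gamma> :: "'a::euclidean_space set"
  assumes "closed \<Gamma>" "convex_cone \<Gamma>"
  obtains \<phi> where "\<And>z. z \<in> \<Gamma> \<Longrightarrow> 0 \<le> \<phi> \<bullet> z" "\<And>z. z \<in> \<Gamma> \<Longrightarrow> \<phi> \<bullet> z = 0 \<Longrightarrow> - z \<in> \<Gamma>"
proof -
  define G where "G = {\<phi>. \<forall>z\<in>\<Gamma>. 0 \<le> \<phi> \<bullet> z}"
  have "convex G"
    unfolding convex_def G_def by (auto simp: inner_add_left)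
  moreover have "0 \<in> G"
    by (simp add: G_def)
  ultimately obtain \<phi> where \<phi>: "\<phi> \<in> rel_interior G"
    using rel_interior_eq_empty by blast
  then have "\<phi> \<in> G"
    using rel_interior_subset by blast
  moreover have "- z \<in> \<Gamma>" if z: "z \<in> \<Gamma>" "\<phi> \<bullet> z = 0" for z
  proof (rule ccontr)
    assume "- z \<notin> \<Gamma>"
    then obtain a b where ab: "a \<bullet> (- z) < b" "\<And>x. x \<in> \<Gamma> \<Longrightarrow> b < a \<bullet> x"
      using separating_hyperplane_closed_point[of \<Gamma> "- z"] assms
      by (auto simp: convex_cone_def)
    have "b < 0"
      using ab(2)[OF convex_cone_contains_0[OF assms(2)]] by simp
    have "a \<in> G"
      unfolding G_def
    proof (intro CollectI ballI, rule ccontr)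
      fix x assume x: "x \<in> \<Gamma>" "\<not> 0 \<le> a \<bullet> x"
      then have "(b / (a \<bullet> x)) *\<^sub>R x \<in> \<Gamma>"
        using convex_cone_scaleR[OF assms(2)] \<open>b < 0\<close> by (simp add: divide_nonpos_neg)
      from ab(2)[OF this] x(2) show False
        by simp
    qed
    \<comment> \<open>Relative interiority: the segment from \<open>a\<close> to
      \<open>\<phi>\<close> can be prolonged beyond \<open>\<phi>\<close> inside \<open>G\<close>.
      At \<open>z\<close> only the part with \<open>a\<close> counts, and its coefficient
      \<open>1 - e\<close> is negative.\<close>
    then obtain e where e: "e > 1" "(1 - e) *\<^sub>R a + e *\<^sub>R \<phi> \<in> G"
      using \<phi> convex_rel_interior_iff[OF \<open>convex G\<close>] \<open>0 \<in> G\<close> by blast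
    then have "0 \<le> (1 - e) * (a \<bullet> z)"
      using z by (auto simp: G_def inner_add_left)
    moreover have "a \<bullet> z > 0"
      using ab(1) \<open>b < 0\<close> by simp
    ultimately show False
      using e(1) by (simp add: zero_le_mult_iff)
  qed
  ultimately show thesis
    using that by (auto simp: G_def)
qed

section \<open>Windows of a trajectory with nearly equal end points\<close>

locale expanding_cone_process =
  fixes \<Gamma> :: "('a::euclidean_space \<times> 'a) set"
  assumes closed: "closed \<Gamma>" and cone: "convex_cone \<Gamma>"
    and no_linear: "\<And>q. bounded (range q) \<Longrightarrow> (\<And>j::nat. (q j, q (Suc j)) \<in> \<Gamma>) \<Longrightarrow>
          (\<And>j. - (q j, q (Suc j)) \<in> \<Gamma>) \<Longrightarrow> q 0 = 0"
    and no_eigen: "\<And>q t. 0 \<le> t \<Longrightarrow> t \<le> 1 \<Longrightarrow> (q, t *\<^sub>R q) \<in> \<Gamma> \<Longrightarrow> q = 0"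
begin

text \<open>Here \<open>e k\<close> is the defect of an approximate eigenvector. Where
  \<open>S\<close> stays away from 0, dividing by its norm leaves a vanishing defect, and a limit of
  the normalized sums would be a unit eigenvector with eigenvalue in [0, 1].\<close>

lemma windows_sum_tendsto_0:
  fixes S e :: "nat \<Rightarrow> 'a" and \<rho> :: "nat \<Rightarrow> real"
  assumes mem: "\<And>k. (S k, \<rho> k *\<^sub>R (S k + e k)) \<in> \<Gamma>" and \<rho>: "\<And>k. \<rho> k \<in> {0..1}"
    and e: "e \<longlonglongrightarrow> 0"
  shows "S \<longlonglongrightarrow> 0"
proof (rule ccontr)
  assume "\<not> S \<longlonglongrightarrow> 0"
  then obtain \<eta> s where \<eta>: "\<eta> > 0" and s: "strict_mono (s :: nat \<Rightarrow> nat)" "\<And>k. \<eta> \<le> norm (S (s k))"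
    using not_tendsto_0_subsequence by blast
  define u where "u k = S (s k) /\<^sub>R norm (S (s k))" for k
  have nz: "norm (S (s k)) > 0" for k
    using s(2)[of k] \<eta> by linarith
  have "compact (sphere (0::'a) 1 \<times> {0..1::real})"
    by (intro compact_Times) auto
  moreover have "\<forall>k. (u k, \<rho> (s k)) \<in> sphere 0 1 \<times> {0..1}"
    using \<rho> nz by (auto simp: u_def less_imp_neq)
  ultimately obtain l r where l: "l \<in> sphere (0::'a) 1 \<times> {0..1::real}" and
      r: "strict_mono (r :: nat \<Rightarrow> nat)" "((\<lambda>k. (u k, \<rho> (s k))) \<circ> r) \<longlonglongrightarrow> l"
    unfolding compact_def by meson
  obtain l1 l2 where l12: "l = (l1, l2)"
    by (cases l)
  have u: "(\<lambda>k. u (r k)) \<longlonglongrightarrow> l1" and \<rho>lim: "(\<lambda>k. \<rho> (s (r k))) \<longlonglongrightarrow> l2"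
    using tendsto_fst[OF r(2)] tendsto_snd[OF r(2)] by (simp_all add: o_def l12)
  have "(\<lambda>k. e (s k) /\<^sub>R norm (S (s k))) \<longlonglongrightarrow> 0"
  proof (rule Lim_null_comparison)
    show "(\<lambda>k. norm (e (s k)) / \<eta>) \<longlonglongrightarrow> 0"
      using tendsto_divide[OF tendsto_norm_zero[OF strict_mono_tendsto[OF s(1) e]] tendsto_const[of \<eta>]]
        \<eta> by simp
    have "norm (e (s k)) / norm (S (s k)) \<le> norm (e (s k)) / \<eta>" for k
      using s(2)[of k] \<eta> by (intro divide_left_mono mult_pos_pos) (auto simp: nz)
    then show "\<forall>\<^sub>F k in sequentially. norm (e (s k) /\<^sub>R norm (S (s k))) \<le> norm (e (s k)) / \<eta>"
      by (simp add: divide_inverse mult.commute)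
  qed
  from strict_mono_tendsto[OF r(1) this]
  have e': "(\<lambda>k. e (s (r k)) /\<^sub>R norm (S (s (r k)))) \<longlonglongrightarrow> 0" .
  have "(u (r k), \<rho> (s (r k)) *\<^sub>R (u (r k) + e (s (r k)) /\<^sub>R norm (S (s (r k))))) \<in> \<Gamma>" for k
    using convex_cone_scaleR[OF cone _ mem, of "inverse (norm (S (s (r k))))" "s (r k)"]
    by (simp add: u_def scaleR_add_right mult.commute)
  moreover have "(\<lambda>k. (u (r k), \<rho> (s (r k)) *\<^sub>R (u (r k) + e (s (r k)) /\<^sub>R norm (S (s (r k))))))
      \<longlonglongrightarrow> (l1, l2 *\<^sub>R (l1 + 0))"
    by (intro tendsto_intros u \<rho>lim e')
  ultimately have "(l1, l2 *\<^sub>R l1) \<in> \<Gamma>"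
    using closed_sequentially[OF closed] by (metis (no_types, lifting) add_0_right)
  then have "l1 = 0"
    using no_eigen l l12 by auto
  with l l12 show False
    by simp
qed

text \<open>\<open>t\<close> marks a state of norm at least 1 that is followed by at least 1 /
  \<epsilon> more steps: as \<epsilon> tends to 0, the stretches after \<open>t\<close> have an
  infinite limit trajectory that does not start at 0. \<open>\<rho>\<close> is the reciprocal of a
  weight.\<close>

definition almost_closed_window ::
    "real \<Rightarrow> real \<Rightarrow> (nat \<Rightarrow> 'a) \<Rightarrow> nat \<Rightarrow> nat \<Rightarrow> real \<Rightarrow> bool" where
  "almost_closed_window c \<epsilon> p m t \<rho> \<longleftrightarrow> (\<forall>j. (p j, \<rho> *\<^sub>R p (Suc j)) \<in> \<Gamma>) \<and> 0 \<le> \<rho> \<and> \<rho> \<le> 1 \<and>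
     (\<forall>j\<le>m. norm (p j) \<le> c) \<and> 1 \<le> norm (p t) \<and> norm (p m - p 0) \<le> \<epsilon> \<and>
     real t + 1 / \<epsilon> \<le> real m"

text \<open>
  Summing a trajectory over a window whose end points nearly agree almost produces an eigenvector.
  If the sums tend to zero instead, then the functional of the lemma
  \<open>closed_convex_cone_functional\<close> vanishes asymptotically on every step of the window, so a limit
  trajectory lies in the lineality space of the graph.
\<close>

lemma no_almost_closed_windows: "\<exists>\<epsilon>>0. \<forall>p m t \<rho>. \<not> almost_closed_window c \<epsilon> p m t \<rho>"
proof (rule ccontr)
  assume "\<not> ?thesis"
  then have "\<exists>p m t \<rho>. almost_closed_window c (1 / real (Suc k)) p m t \<rho>" for k
    by (auto simp del: of_nat_Suc)
  then obtain p m t \<rho> where bad: "\<And>k. almost_closed_window c (1 / real (Suc k)) (p k) (m k) (t k) (\<rho> k)"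
    by metis
  have step: "(p k j, \<rho> k *\<^sub>R p k (Suc j)) \<in> \<Gamma>" and \<rho>0: "0 \<le> \<rho> k" and \<rho>1: "\<rho> k \<le> 1"
    and bnd: "j \<le> m k \<Longrightarrow> norm (p k j) \<le> c" and pt: "1 \<le> norm (p k (t k))"
    and ends: "norm (p k (m k) - p k 0) \<le> 1 / real (Suc k)"
    and len: "t k + Suc k \<le> m k" for k j
    using bad[of k] by (simp_all add: almost_closed_window_def flip: of_nat_Suc of_nat_add)
  define S where "S k = (\<Sum>j<m k. p k j)" for k
  define e where "e k = p k (m k) - p k 0" for k
  define z where "z k = (S k, \<rho> k *\<^sub>R (S k + e k))" for k
  have z_sum: "z k = (\<Sum>j<m k. (p k j, \<rho> k *\<^sub>R p k (Suc j)))" for k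
  proof -
    have "(\<Sum>j<m k. p k (Suc j)) = S k + e k"
      using sum_lessThan_telescope[of "p k" "m k"]
      by (simp add: S_def e_def sum_subtractf algebra_simps)
    then show ?thesis
      by (simp add: z_def S_def sum_prod scaleR_sum_right[symmetric])
  qed
  have z: "z k \<in> \<Gamma>" for k
    unfolding z_sum by (intro convex_cone_sum[OF cone] step)
  have "e \<longlonglongrightarrow> 0"
  proof (rule Lim_null_comparison)
    show "(\<lambda>k. 1 / real (Suc k)) \<longlonglongrightarrow> 0"
      using LIMSEQ_inverse_real_of_nat by (simp add: inverse_eq_divide)
    show "\<forall>\<^sub>F k in sequentially. norm (e k) \<le> 1 / real (Suc k)"
      using ends by (simp add: e_def)
  qed
  then have S: "S \<longlonglongrightarrow> 0"
    using windows_sum_tendsto_0[of S \<rho> e] z \<rho>0 \<rho>1 by (simp add: z_def)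
  have "z \<longlonglongrightarrow> (0, 0)"
    unfolding z_def
  proof (rule tendsto_Pair[OF S], rule Lim_null_comparison)
    show "(\<lambda>k. norm (S k + e k)) \<longlonglongrightarrow> 0"
      using tendsto_norm_zero[OF tendsto_add_zero[OF S \<open>e \<longlonglongrightarrow> 0\<close>]] .
    show "\<forall>\<^sub>F k in sequentially. norm (\<rho> k *\<^sub>R (S k + e k)) \<le> norm (S k + e k)"
      using \<rho>0 \<rho>1 by (auto simp: mult_left_le_one_le)
  qed
  obtain \<phi> where \<phi>: "\<And>z. z \<in> \<Gamma> \<Longrightarrow> 0 \<le> \<phi> \<bullet> z" "\<And>z. z \<in> \<Gamma> \<Longrightarrow> \<phi> \<bullet> z = 0 \<Longrightarrow> - z \<in> \<Gamma>"
    using closed_convex_cone_functional[OF closed cone] by blast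
  have \<phi>z: "(\<lambda>k. \<phi> \<bullet> z k) \<longlonglongrightarrow> 0"
    using tendsto_inner[OF tendsto_const[of \<phi>] \<open>z \<longlonglongrightarrow> (0, 0)\<close>] by (simp flip: zero_prod_def)
  \<comment> \<open>\<open>\<phi>\<close> is nonnegative on every step, so each single value is at
    most the value \<open>\<phi> \<bullet> z k\<close> of the sum, which tends to 0.\<close>
  have \<phi>_le: "\<phi> \<bullet> (p k j, \<rho> k *\<^sub>R p k (Suc j)) \<le> \<phi> \<bullet> z k" if "j < m k" for k j
    unfolding z_sum inner_sum_right
    by (rule member_le_sum) (use that \<phi>(1) step in auto)

  \<comment> \<open>The factor \<open>\<rho> k ^ j\<close> removes \<open>\<rho>\<close> from the
    step relation. The value 0 after the window keeps the bound \<open>c\<close> for every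
    \<open>j\<close>, so that a diagonal subsequence exists.\<close>
  define r where "r k j = (if t k + j \<le> m k then \<rho> k ^ j *\<^sub>R p k (t k + j) else 0)" for k j
  have "0 \<le> c"
    using bnd[of 0 0] norm_ge_zero order_trans by blast
  have r_le: "norm (r k j) \<le> c" for k j
  proof (cases "t k + j \<le> m k")
    case True
    then have "\<rho> k ^ j * norm (p k (t k + j)) \<le> 1 * c"
      using bnd \<rho>0 \<rho>1 by (intro mult_mono power_le_one) auto
    then show ?thesis
      using True \<rho>0 by (simp add: r_def)
  qed (use \<open>0 \<le> c\<close> in \<open>simp add: r_def\<close>)
  then have "bounded (range (\<lambda>k. r k j))" for j
    by (auto simp: bounded_iff)
  then obtain s l where s: "strict_mono (s :: nat \<Rightarrow> nat)" and l: "\<And>j. (\<lambda>k. r (s k) j) \<longlonglongrightarrow> l j"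
    using pointwise_convergent_subsequence[of r] by blast
  have ev: "\<forall>\<^sub>F k in sequentially. (r (s k) j, r (s k) (Suc j)) \<in> \<Gamma> \<and>
      \<phi> \<bullet> (r (s k) j, r (s k) (Suc j)) \<le> \<phi> \<bullet> z (s k)" for j
    unfolding eventually_sequentially
  proof (intro exI allI impI)
    fix k assume "j \<le> k"
    then have lt: "t (s k) + j < m (s k)"
      using len[of "s k"] seq_suble[OF s, of k] by linarith
    let ?w = "(p (s k) (t (s k) + j), \<rho> (s k) *\<^sub>R p (s k) (Suc (t (s k) + j)))"
    have w: "(r (s k) j, r (s k) (Suc j)) = \<rho> (s k) ^ j *\<^sub>R ?w"
      using lt by (simp add: r_def mult.commute)
    have "\<rho> (s k) ^ j * (\<phi> \<bullet> ?w) \<le> 1 * (\<phi> \<bullet> z (s k))"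
      using \<phi>(1)[OF step] \<phi>_le[OF lt] \<rho>0 \<rho>1 by (intro mult_mono power_le_one) auto
    then show "(r (s k) j, r (s k) (Suc j)) \<in> \<Gamma> \<and>
        \<phi> \<bullet> (r (s k) j, r (s k) (Suc j)) \<le> \<phi> \<bullet> z (s k)"
      unfolding w inner_scaleR_right
      using convex_cone_scaleR[OF cone zero_le_power[OF \<rho>0] step] by simp
  qed
  have lim: "(\<lambda>k. (r (s k) j, r (s k) (Suc j))) \<longlonglongrightarrow> (l j, l (Suc j))" for j
    by (intro tendsto_Pair l)
  have mem: "(l j, l (Suc j)) \<in> \<Gamma>" for j
    by (rule Lim_in_closed_set[OF closed eventually_mono[OF ev] _ lim]) auto
  moreover have "- (l j, l (Suc j)) \<in> \<Gamma>" for j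
  proof (rule \<phi>(2)[OF mem])
    have "\<phi> \<bullet> (l j, l (Suc j)) \<le> 0"
      by (rule tendsto_le[OF _ strict_mono_tendsto[OF s \<phi>z] tendsto_inner[OF tendsto_const lim]
            eventually_mono[OF ev]]) auto
    then show "\<phi> \<bullet> (l j, l (Suc j)) = 0"
      using \<phi>(1)[OF mem[of j]] by linarith
  qed
  moreover have "norm (l j) \<le> c" for j
    by (rule Lim_norm_ubound[OF _ l[of j]]) (auto simp: r_le)
  then have "bounded (range l)"
    by (auto simp: bounded_iff)
  ultimately have "l 0 = 0"
    using no_linear[of l] by blast
  moreover have "1 \<le> norm (l 0)"
  proof (rule tendsto_lowerbound[OF tendsto_norm[OF l[of 0]]])
    have "t k \<le> m k" for k
      using len[of k] by linarith
    then show "\<forall>\<^sub>F k in sequentially. 1 \<le> norm (r (s k) 0)"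
      using pt by (simp add: r_def)
  qed simp
  ultimately show False
    by simp
qed


section \<open>Trajectories weighted by powers of \<delta>\<close>

lemma weighted_trajectory:
  assumes traj: "\<And>j. (q j, q (Suc j)) \<in> \<Gamma>" and "\<delta> > 0"
  shows "(\<delta> ^ j *\<^sub>R q j, (1 / \<delta>) *\<^sub>R (\<delta> ^ Suc j *\<^sub>R q (Suc j))) \<in> \<Gamma>"
  using convex_cone_scaleR[OF cone _ traj, of "\<delta> ^ j" j] \<open>\<delta> > 0\<close> by simp

text \<open>\<open>s\<close> is the unit of length. Division by \<open>s\<close> and a shift by
  \<open>a\<close> produce an \<open>almost_closed_window\<close> with \<rho> = 1 / \<delta>, and
  \<delta> \<ge> 1 keeps \<rho> in [0, 1].\<close>

definition almost_closed_weighted_window ::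
    "real \<Rightarrow> real \<Rightarrow> (nat \<Rightarrow> 'a) \<Rightarrow> real \<Rightarrow> real \<Rightarrow> nat \<Rightarrow> nat \<Rightarrow> nat \<Rightarrow> bool" where
  "almost_closed_weighted_window c \<epsilon> q \<delta> s a b t \<longleftrightarrow> (\<forall>j. (q j, q (Suc j)) \<in> \<Gamma>) \<and> 1 \<le> \<delta> \<and> 0 < s \<and>
     a \<le> t \<and> (\<forall>j\<in>{a..b}. \<delta> ^ j * norm (q j) \<le> c * s) \<and> s \<le> \<delta> ^ t * norm (q t) \<and>
     norm (\<delta> ^ b *\<^sub>R q b - \<delta> ^ a *\<^sub>R q a) \<le> \<epsilon> * s \<and> real t + 1 / \<epsilon> \<le> real b"

text \<open>One \<epsilon> serves all trajectories and all weights; this uniformity later allows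
  passing to a limit of weights.\<close>

lemma no_almost_closed_weighted_windows:
  "\<exists>\<epsilon>>0. \<forall>q \<delta> s a b t. \<not> almost_closed_weighted_window c \<epsilon> q \<delta> s a b t"
proof -
  obtain \<epsilon> where \<epsilon>: "\<epsilon> > 0" and nwin: "\<And>p m t \<rho>. \<not> almost_closed_window c \<epsilon> p m t \<rho>"
    using no_almost_closed_windows by blast
  have "\<not> almost_closed_weighted_window c \<epsilon> q \<delta> s a b t" for q \<delta> s a b t
  proof
    assume "almost_closed_weighted_window c \<epsilon> q \<delta> s a b t"
    then have traj: "\<And>j. (q j, q (Suc j)) \<in> \<Gamma>" and \<delta>: "1 \<le> \<delta>" and s: "0 < s" and "a \<le> t"
      and bnd: "\<And>j. a \<le> j \<Longrightarrow> j \<le> b \<Longrightarrow> \<delta> ^ j * norm (q j) \<le> c * s"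
      and qt: "s \<le> \<delta> ^ t * norm (q t)"
      and ends: "norm (\<delta> ^ b *\<^sub>R q b - \<delta> ^ a *\<^sub>R q a) \<le> \<epsilon> * s"
      and len: "real t + 1 / \<epsilon> \<le> real b"
      by (auto simp: almost_closed_weighted_window_def)
    define p where "p j = (1 / s) *\<^sub>R (\<delta> ^ (a + j) *\<^sub>R q (a + j))" for j
    have "0 < 1 / \<epsilon>"
      using \<epsilon> by simp
    then have tb: "t \<le> b"
      using len by linarith
    have norm_p: "norm (p j) = \<delta> ^ (a + j) * norm (q (a + j)) / s" for j
      using \<delta> s by (simp add: p_def)
    have "(p j, (1 / \<delta>) *\<^sub>R p (Suc j)) \<in> \<Gamma>" for j
    proof -
      have "(1 / s) *\<^sub>R (\<delta> ^ (a + j) *\<^sub>R q (a + j),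
          (1 / \<delta>) *\<^sub>R (\<delta> ^ Suc (a + j) *\<^sub>R q (Suc (a + j)))) \<in> \<Gamma>"
        using \<delta> s by (intro convex_cone_scaleR[OF cone] weighted_trajectory traj) auto
      then show ?thesis
        by (simp add: p_def mult_ac)
    qed
    moreover have "norm (p j) \<le> c" if "j \<le> b - a" for j
      using bnd[of "a + j"] s tb \<open>a \<le> t\<close> that unfolding norm_p by (simp add: pos_divide_le_eq)
    moreover have "1 \<le> norm (p (t - a))"
      using qt s \<open>a \<le> t\<close> unfolding norm_p by simp
    moreover have "p (b - a) - p 0 = (1 / s) *\<^sub>R (\<delta> ^ b *\<^sub>R q b - \<delta> ^ a *\<^sub>R q a)"
      using tb \<open>a \<le> t\<close> by (simp add: p_def scaleR_diff_right)
    then have "norm (p (b - a) - p 0) \<le> \<epsilon>"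
      using ends s by (simp add: pos_divide_le_eq)
    ultimately have "almost_closed_window c \<epsilon> p (b - a) (t - a) (1 / \<delta>)"
      using \<delta> len tb \<open>a \<le> t\<close> by (simp add: almost_closed_window_def of_nat_diff)
    then show False
      using nwin by blast
  qed
  with \<epsilon> show ?thesis
    by blast
qed

text \<open>A bounded sequence that does not tend to 0 comes, after arbitrarily long times,
  arbitrarily close to earlier states of norm at least \<eta>; the stretch in between is a forbidden
  window with \<open>t = a\<close>.\<close>

lemma weighted_trajectory_tendsto_0:
  assumes traj: "\<And>j. (q j, q (Suc j)) \<in> \<Gamma>" and "1 \<le> \<delta>"
    and bnd: "bounded (range (\<lambda>j. \<delta> ^ j *\<^sub>R q j))"
  shows "(\<lambda>j. \<delta> ^ j *\<^sub>R q j) \<longlonglongrightarrow> 0"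
proof (rule ccontr)
  let ?p = "\<lambda>j. \<delta> ^ j *\<^sub>R q j"
  assume "\<not> ?p \<longlonglongrightarrow> 0"
  then obtain \<eta> s where \<eta>: "\<eta> > 0" and s: "strict_mono (s :: nat \<Rightarrow> nat)" "\<And>k. \<eta> \<le> norm (?p (s k))"
    using not_tendsto_0_subsequence by blast
  have "bounded (range (\<lambda>k. ?p (s k)))"
    by (rule bounded_subset[OF bnd]) auto
  then obtain l r where r: "strict_mono (r :: nat \<Rightarrow> nat)" "((\<lambda>k. ?p (s k)) \<circ> r) \<longlonglongrightarrow> l"
    using bounded_imp_convergent_subsequence by blast
  obtain M where M: "\<And>j. norm (?p j) \<le> M"
    using bnd by (auto simp: bounded_iff)
  obtain \<epsilon> where \<epsilon>: "\<epsilon> > 0" and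
    nwin: "\<And>q \<delta> s a b t. \<not> almost_closed_weighted_window (M / \<eta>) \<epsilon> q \<delta> s a b t"
    using no_almost_closed_weighted_windows by blast
  have "Cauchy (\<lambda>k. ?p (s (r k)))"
    using r(2) by (intro LIMSEQ_imp_Cauchy) (simp add: o_def)
  then obtain k0 where k0: "\<And>k k'. k0 \<le> k \<Longrightarrow> k0 \<le> k' \<Longrightarrow> norm (?p (s (r k)) - ?p (s (r k'))) < \<epsilon> * \<eta>"
    using CauchyD[of "\<lambda>k. ?p (s (r k))" "\<epsilon> * \<eta>"] \<epsilon> \<eta> by (metis mult_pos_pos)
  define a where "a = s (r k0)"
  obtain n :: nat where n: "real a + 1 / \<epsilon> \<le> real n"
    using real_arch_simple by blast
  define b where "b = s (r (max k0 n))"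
  have "n \<le> b"
    unfolding b_def using seq_suble[OF s(1)] seq_suble[OF r(1)] by (meson max.cobounded2 order_trans)
  have "norm (?p b - ?p a) \<le> \<epsilon> * \<eta>"
    using k0[of "max k0 n" k0] by (simp add: a_def b_def)
  moreover have "\<delta> ^ j * norm (q j) \<le> M / \<eta> * \<eta>" for j
    using M[of j] \<eta> \<open>1 \<le> \<delta>\<close> by simp
  moreover have "\<eta> \<le> \<delta> ^ a * norm (q a)"
    using s(2)[of "r k0"] \<open>1 \<le> \<delta>\<close> by (simp add: a_def)
  ultimately have "almost_closed_weighted_window (M / \<eta>) \<epsilon> q \<delta> \<eta> a b a"
    using traj \<open>1 \<le> \<delta>\<close> \<eta> n \<open>n \<le> b\<close> by (simp add: almost_closed_weighted_window_def)
  with nwin show False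
    by blast
qed

text \<open>If some later norm exceeded 2 / \<epsilon> times the norm at \<open>a\<close>, take the
  largest later norm as unit of length: the state at \<open>a\<close> and a far state are then both
  shorter than \<epsilon> / 2, so the window between them is almost closed.\<close>

lemma weighted_trajectory_quasi_decreasing:
  "\<exists>M>0. \<forall>q \<delta> a i. (\<forall>j. (q j, q (Suc j)) \<in> \<Gamma>) \<longrightarrow> 1 \<le> \<delta> \<longrightarrow> (\<lambda>j. \<delta> ^ j *\<^sub>R q j) \<longlonglongrightarrow> 0 \<longrightarrow>
      a \<le> i \<longrightarrow> \<delta> ^ i * norm (q i) \<le> M * (\<delta> ^ a * norm (q a))"
proof -
  obtain \<epsilon> where \<epsilon>: "\<epsilon> > 0" and
    nwin: "\<And>q \<delta> s a b t. \<not> almost_closed_weighted_window 1 \<epsilon> q \<delta> s a b t"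
    using no_almost_closed_weighted_windows by blast
  have "\<delta> ^ i * norm (q i) \<le> 2 / \<epsilon> * (\<delta> ^ a * norm (q a))"
    if traj: "\<And>j. (q j, q (Suc j)) \<in> \<Gamma>" and \<delta>: "1 \<le> \<delta>" and "a \<le> i"
      and lim: "(\<lambda>j. \<delta> ^ j *\<^sub>R q j) \<longlonglongrightarrow> 0" for q \<delta> a i
  proof -
    define g where "g j = \<delta> ^ j * norm (q j)" for j
    have g_norm: "g j = norm (\<delta> ^ j *\<^sub>R q j)" for j
      using \<delta> by (simp add: g_def)
    have g0: "g \<longlonglongrightarrow> 0"
      using tendsto_norm_zero[OF lim] by (simp only: g_norm[symmetric])
    show ?thesis
    proof (rule ccontr)
      assume "\<not> ?thesis"
      then have gi: "g a < \<epsilon> / 2 * g i"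
        using \<epsilon> by (simp add: g_def field_simps)
      moreover have "0 \<le> g a"
        by (simp add: g_norm)
      ultimately have "0 < g i"
        using \<epsilon> by (metis half_gt_zero le_less_trans zero_less_mult_pos)
      then obtain N where N: "\<And>j. N \<le> j \<Longrightarrow> g j < g i"
        using order_tendstoD(2)[OF g0] by (auto simp: eventually_sequentially)
      \<comment> \<open>Beyond \<open>N\<close> the values stay below \<open>g i\<close>, so the
        maximum over this finite range is the maximum over all \<open>j \<ge> a\<close>.\<close>
      have fin: "finite (g ` {a..max i N})" "g ` {a..max i N} \<noteq> {}"
        using \<open>a \<le> i\<close> by auto
      obtain t where t: "t \<in> {a..max i N}" "Max (g ` {a..max i N}) = g t"
        using Max_in[OF fin] by (rule imageE)
      have gt: "g j \<le> g t" if "a \<le> j" for j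
      proof (cases "j \<le> max i N")
        case True
        then show ?thesis
          using Max_ge[OF fin(1), of "g j"] that unfolding t(2) by auto
      next
        case False
        then have "g j < g i"
          using N by auto
        also have "g i \<le> g t"
          using Max_ge[OF fin(1), of "g i"] \<open>a \<le> i\<close> unfolding t(2) by auto
        finally show ?thesis
          by simp
      qed
      have "0 < g t"
        using gt[OF \<open>a \<le> i\<close>] \<open>0 < g i\<close> by simp
      then obtain N' where N': "\<And>j. N' \<le> j \<Longrightarrow> g j < \<epsilon> / 2 * g t"
        using order_tendstoD(2)[OF g0, of "\<epsilon> / 2 * g t"] \<epsilon> by (auto simp: eventually_sequentially)
      obtain n :: nat where n: "real t + 1 / \<epsilon> \<le> real n"
        using real_arch_simple by blast
      define b where "b = max n N'"
      have "g a < \<epsilon> / 2 * g t"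
        using gi gt[OF \<open>a \<le> i\<close>] \<epsilon> by (smt (verit) half_gt_zero mult_left_mono)
      moreover have "g b < \<epsilon> / 2 * g t"
        by (rule N') (simp add: b_def)
      moreover have "norm (\<delta> ^ b *\<^sub>R q b - \<delta> ^ a *\<^sub>R q a) \<le> g b + g a"
        unfolding g_norm by (rule norm_triangle_ineq4)
      ultimately have "norm (\<delta> ^ b *\<^sub>R q b - \<delta> ^ a *\<^sub>R q a) \<le> \<epsilon> * g t"
        by simp
      moreover have "real t + 1 / \<epsilon> \<le> real b"
        using n by (simp add: b_def)
      ultimately have "almost_closed_weighted_window 1 \<epsilon> q \<delta> (g t) a b t"
        using traj \<delta> \<open>0 < g t\<close> gt t(1) by (simp add: almost_closed_weighted_window_def g_def)
      with nwin show False
        by blast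
    qed
  qed
  moreover have "2 / \<epsilon> > 0"
    using \<epsilon> by simp
  ultimately show ?thesis
    by blast
qed

text \<open>Losing a factor 2 in every \<open>m\<close> steps is exponential decay, so the weight
  \<open>\<eta>\<close> with \<open>\<eta> ^ m = 2\<close> would keep the sequence bounded.\<close>

lemma slow_decay:
  fixes g :: "nat \<Rightarrow> real"
  assumes nonneg: "\<And>j. 0 \<le> g j" and unb: "\<And>\<eta>. \<eta> > 1 \<Longrightarrow> \<not> bdd_above (range (\<lambda>j. \<eta> ^ j * g j))"
  shows "\<exists>j. g j \<le> 2 * g (j + m)"
proof (rule ccontr)
  assume "\<not> ?thesis"
  then have lt: "2 * g (j + m) < g j" for j
    by (auto simp: not_le)
  have "m > 0"
  proof (rule ccontr)
    assume "\<not> m > 0"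
    then have "2 * g 0 < g 0"
      using lt[of 0] by simp
    with nonneg[of 0] show False
      by linarith
  qed
  define \<eta> where "\<eta> = root m 2"
  have \<eta>: "\<eta> > 1" "\<eta> ^ m = 2"
    using \<open>m > 0\<close> by (auto simp: \<eta>_def)
  define K where "K = Max ((\<lambda>j. \<eta> ^ j * g j) ` {..<m})"
  have "\<eta> ^ j * g j \<le> K" for j
  proof (induction j rule: less_induct)
    case (less j)
    show ?case
    proof (cases "j < m")
      case True
      then show ?thesis
        unfolding K_def by (intro Max_ge) auto
    next
      case False
      then obtain i where i: "j = i + m"
        by (metis add.commute le_iff_add not_less)
      have "\<eta> ^ j * g j = \<eta> ^ i * (2 * g (i + m))"
        by (simp add: i power_add \<eta>(2))
      also have "\<dots> \<le> \<eta> ^ i * g i"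
        using lt[of i] \<eta>(1) by (intro mult_left_mono) auto
      also have "\<dots> \<le> K"
        using less i \<open>m > 0\<close> by simp
      finally show ?thesis .
    qed
  qed
  then have "bdd_above (range (\<lambda>j. \<eta> ^ j * g j))"
    by (auto simp: bdd_above_def)
  with unb[OF \<eta>(1)] show False
    by blast
qed

text \<open>
  Let \<open>\<delta>\<^sub>0\<close> be the exact rate of decay of a nonzero bounded trajectory. Normalized stretches of the
  trajectory weighted by \<open>\<delta>\<^sub>0\<close> then converge to a weighted trajectory that stays away from zero and
  infinity.
\<close>

theorem bounded_trajectory_eq_0:
  assumes traj: "\<And>j. (q j, q (Suc j)) \<in> \<Gamma>" and "bounded (range q)"
  shows "q 0 = 0"
proof (rule ccontr)
  assume "q 0 \<noteq> 0"
  have nz: "q j \<noteq> 0" for j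
  proof (induction j)
    case (Suc j)
    then show ?case
      using no_eigen[of 0 "q j"] traj[of j] by auto
  qed (use \<open>q 0 \<noteq> 0\<close> in simp)
  \<comment> \<open>The weights under which the trajectory still tends to 0; a bounded weighted
    trajectory already qualifies. The supremum \<open>d\<close> is the rate called
    \<open>\<delta>\<^sub>0\<close> above.\<close>
  define I where "I = {\<delta>. 1 \<le> \<delta> \<and> (\<lambda>j. \<delta> ^ j *\<^sub>R q j) \<longlonglongrightarrow> 0}"
  have I_bounded: "\<delta> \<in> I" if "1 \<le> \<delta>" "bounded (range (\<lambda>j. \<delta> ^ j *\<^sub>R q j))" for \<delta>
    using weighted_trajectory_tendsto_0[OF traj that] that by (simp add: I_def)
  obtain M where "M > 0" and
    M: "\<And>q \<delta> a i. (\<And>j. (q j, q (Suc j)) \<in> \<Gamma>) \<Longrightarrow> 1 \<le> \<delta> \<Longrightarrow> (\<lambda>j. \<delta> ^ j *\<^sub>R q j) \<longlonglongrightarrow> 0 \<Longrightarrow>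
      a \<le> i \<Longrightarrow> \<delta> ^ i * norm (q i) \<le> M * (\<delta> ^ a * norm (q a))"
    using weighted_trajectory_quasi_decreasing by blast
  have M_I: "\<delta> ^ i * norm (q i) \<le> M * (\<delta> ^ a * norm (q a))" if "\<delta> \<in> I" "a \<le> i" for \<delta> a i
    using M[of q \<delta> a i] traj that by (simp add: I_def)
  have "1 \<in> I"
    using I_bounded[of 1] \<open>bounded (range q)\<close> by simp
  \<comment> \<open>\<open>q 1\<close> is nonzero because 0 is not an eigenvalue, so the first step
    bounds every such weight.\<close>
  have bdd: "bdd_above I"
  proof (rule bdd_aboveI)
    fix \<delta> assume "\<delta> \<in> I"
    then show "\<delta> \<le> M * norm (q 0) / norm (q 1)"
      using M_I[of \<delta> 0 1] nz[of 1] by (simp add: pos_le_divide_eq)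
  qed
  define d where "d = Sup I"
  have "1 \<le> d"
    unfolding d_def by (rule cSup_upper[OF \<open>1 \<in> I\<close> bdd])
  have "d \<in> closure I"
    unfolding d_def using \<open>1 \<in> I\<close> bdd by (intro closure_contains_Sup) auto
  define g where "g j = d ^ j * norm (q j)" for j
  have g_pos: "0 < g j" for j
    using nz \<open>1 \<le> d\<close> by (simp add: g_def)
  \<comment> \<open>\<open>d\<close> itself need not belong to \<open>I\<close>, but for fixed
    \<open>a\<close> and \<open>i\<close> the inequality is a closed condition on the weight, and
    \<open>M\<close> does not depend on the weight.\<close>
  have g_M: "g i \<le> M * g a" if "a \<le> i" for a i
  proof -
    have "closed {\<delta>. \<delta> ^ i * norm (q i) \<le> M * (\<delta> ^ a * norm (q a))}"
      by (intro closed_Collect_le continuous_intros)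
    moreover have "I \<subseteq> {\<delta>. \<delta> ^ i * norm (q i) \<le> M * (\<delta> ^ a * norm (q a))}"
      using M_I that by blast
    ultimately show ?thesis
      using \<open>d \<in> closure I\<close> closure_minimal unfolding g_def by blast
  qed
  \<comment> \<open>A weight \<open>\<eta> * d\<close> with bounded result would belong to
    \<open>I\<close> and exceed its supremum. Hence \<open>slow_decay\<close> supplies times
    \<open>n k\<close> after which \<open>k\<close> steps lose at most a factor 2.\<close>
  have "\<not> bdd_above (range (\<lambda>j. \<eta> ^ j * g j))" if "\<eta> > 1" for \<eta>
  proof
    assume "bdd_above (range (\<lambda>j. \<eta> ^ j * g j))"
    then obtain K where "\<And>j. \<eta> ^ j * g j \<le> K"
      by (auto simp: bdd_above_def)
    then have "norm ((\<eta> * d) ^ j *\<^sub>R q j) \<le> K" for j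
      using \<open>1 \<le> d\<close> that by (simp add: g_def power_mult_distrib abs_mult mult.assoc)
    then have "bounded (range (\<lambda>j. (\<eta> * d) ^ j *\<^sub>R q j))"
      by (auto simp: bounded_iff)
    moreover have "d < \<eta> * d"
      using that \<open>1 \<le> d\<close> by simp
    then have "1 \<le> \<eta> * d"
      using \<open>1 \<le> d\<close> by linarith
    ultimately have "\<eta> * d \<in> I"
      by (intro I_bounded)
    then show False
      using cSup_upper[OF _ bdd] \<open>d < \<eta> * d\<close> by (simp add: d_def not_le[symmetric])
  qed
  then have "\<exists>j. g j \<le> 2 * g (j + k)" for k
    using slow_decay[of g k] g_pos by (simp add: less_imp_le)
  then obtain n where n: "\<And>k. g (n k) \<le> 2 * g (n k + k)"
    by metis
  define r where "r k j = (1 / g (n k)) *\<^sub>R (d ^ (n k + j) *\<^sub>R q (n k + j))" for k j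
  have norm_r: "norm (r k j) = g (n k + j) / g (n k)" for k j
    using \<open>1 \<le> d\<close> g_pos[of "n k"] by (simp add: r_def g_def)
  have r_le: "norm (r k j) \<le> M" for k j
    using g_M[of "n k" "n k + j"] g_pos[of "n k"] by (simp add: norm_r pos_divide_le_eq)
  have r_ge: "1 / (2 * M) \<le> norm (r k j)" if "j \<le> k" for k j
  proof -
    have "g (n k) \<le> 2 * (M * g (n k + j))"
      using n[of k] g_M[of "n k + j" "n k + k"] that by simp
    then show ?thesis
      using g_pos[of "n k"] \<open>M > 0\<close> by (simp add: norm_r field_simps)
  qed
  have "bounded (range (\<lambda>k. r k j))" for j
    using r_le by (auto simp: bounded_iff)
  then obtain s l where s: "strict_mono (s :: nat \<Rightarrow> nat)" and l: "\<And>j. (\<lambda>k. r (s k) j) \<longlonglongrightarrow> l j"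
    using pointwise_convergent_subsequence[of r] by blast
  have l_step: "(l j, (1 / d) *\<^sub>R l (Suc j)) \<in> \<Gamma>" for j
  proof (rule Lim_in_closed_set[OF closed])
    show "(\<lambda>k. (r (s k) j, (1 / d) *\<^sub>R r (s k) (Suc j))) \<longlonglongrightarrow> (l j, (1 / d) *\<^sub>R l (Suc j))"
      by (intro tendsto_intros l)
    have "(r k j, (1 / d) *\<^sub>R r k (Suc j)) \<in> \<Gamma>" for k
    proof -
      have "(1 / g (n k)) *\<^sub>R (d ^ (n k + j) *\<^sub>R q (n k + j),
          (1 / d) *\<^sub>R (d ^ Suc (n k + j) *\<^sub>R q (Suc (n k + j)))) \<in> \<Gamma>"
        using \<open>1 \<le> d\<close> g_pos[of "n k"]
        by (intro convex_cone_scaleR[OF cone] weighted_trajectory traj) auto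
      then show ?thesis
        by (simp add: r_def mult_ac)
    qed
    then show "\<forall>\<^sub>F k in sequentially. (r (s k) j, (1 / d) *\<^sub>R r (s k) (Suc j)) \<in> \<Gamma>"
      by simp
  qed simp
  have l_le: "norm (l j) \<le> M" for j
    by (rule Lim_norm_ubound[OF _ l[of j]]) (auto simp: r_le)
  have l_ge: "1 / (2 * M) \<le> norm (l j)" for j
  proof (rule tendsto_lowerbound[OF tendsto_norm[OF l[of j]]])
    show "\<forall>\<^sub>F k in sequentially. 1 / (2 * M) \<le> norm (r (s k) j)"
      unfolding eventually_sequentially using seq_suble[OF s] r_ge by (meson order_trans)
  qed simp
  \<comment> \<open>Undoing the weight gives a trajectory of the graph whose
    \<open>d\<close>-weighted version is \<open>l\<close>. As \<open>l\<close> is bounded it would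
    have to tend to 0, against \<open>l_ge\<close>.\<close>
  define p where "p j = (1 / d) ^ j *\<^sub>R l j" for j
  have p_l: "d ^ j *\<^sub>R p j = l j" for j
    using \<open>1 \<le> d\<close> by (simp add: p_def power_one_over)
  have "(p j, p (Suc j)) \<in> \<Gamma>" for j
    using convex_cone_scaleR[OF cone _ l_step, of "(1 / d) ^ j" j] \<open>1 \<le> d\<close>
    by (simp add: p_def mult_ac)
  moreover have "bounded (range (\<lambda>j. d ^ j *\<^sub>R p j))"
    using l_le by (auto simp: p_l bounded_iff)
  ultimately have "(\<lambda>j. d ^ j *\<^sub>R p j) \<longlonglongrightarrow> 0"
    using weighted_trajectory_tendsto_0 \<open>1 \<le> d\<close> by blast
  then have "(\<lambda>j. norm (l j)) \<longlonglongrightarrow> 0"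
    using tendsto_norm_zero by (simp add: p_l)
  then have "1 / (2 * M) \<le> 0"
    by (rule tendsto_lowerbound) (use l_ge in auto)
  with \<open>M > 0\<close> show False
    by (simp add: divide_le_0_iff)
qed

end

section \<open>Trajectories of the dual process\<close>

lemma recession_cone_convex_cone: "convex_cone (recession_cone S)"
  unfolding convex_cone_iff
proof (intro conjI ballI allI impI)
  show "0 \<in> recession_cone S"
    by (simp add: recession_cone_def)
next
  fix x y assume "x \<in> recession_cone S" "y \<in> recession_cone S"
  then show "x + y \<in> recession_cone S"
    by (simp add: recession_cone_def scaleR_add_right flip: add.assoc)
next
  fix x and c :: real assume "x \<in> recession_cone S" "0 \<le> c"
  then show "c *\<^sub>R x \<in> recession_cone S"
    by (simp add: recession_cone_def)
qed

text \<open>\<open>f\<close> and \<open>g\<close> stand for [A B] and [C D]. \<open>surj_g\<close>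
  comes from the interior points of Y \<inter> im [C D], and \<open>interior_output\<close> unfolds
  that \<K>(\<Sigma>) meets the interior of Y.\<close>

locale constrained_system =
  fixes f :: "'x::euclidean_space \<times> 'u::euclidean_space \<Rightarrow> 'x"
    and g :: "'x \<times> 'u \<Rightarrow> 'y::euclidean_space"
    and Y :: "'y set"
  assumes linear_f: "linear f" and linear_g: "linear g" and surj_g: "surj g"
    and convex_Y: "convex Y" and zero_Y: "0 \<in> Y" and hyperbolic_Y: "hyperbolic_set Y"
    and interior_output: "\<exists>n \<xi> \<eta>. \<xi> 0 = 0 \<and>
      (\<forall>k<n. \<xi> (Suc k) = f (\<xi> k, \<eta> k) \<and> g (\<xi> k, \<eta> k) = 0) \<and> g (\<xi> n, \<eta> n) \<in> interior Y"
begin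

definition primal :: "'y set \<Rightarrow> 'x \<Rightarrow> 'x set" where
  "primal K x = {f (x, u) | u. g (x, u) \<in> K}"

text \<open>
  This says \<open>q' = A\<^sup>T q + C\<^sup>T v\<close> and \<open>0 = B\<^sup>T q + D\<^sup>T v\<close> without mentioning adjoints.
\<close>

definition dual_step :: "'x \<Rightarrow> 'y \<Rightarrow> 'x \<Rightarrow> bool" where
  "dual_step q v q' \<longleftrightarrow> (\<forall>x u. q' \<bullet> x = q \<bullet> f (x, u) + v \<bullet> g (x, u))"

definition dual_graph :: "'y set \<Rightarrow> ('x \<times> 'x) set" where
  "dual_graph U = {(q, q'). \<exists>v\<in>U. dual_step q v q'}"

definition dual_trajectory :: "'y set \<Rightarrow> (nat \<Rightarrow> 'x) \<Rightarrow> bool" where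
  "dual_trajectory U q \<longleftrightarrow> (\<forall>j. (q j, q (Suc j)) \<in> dual_graph U)"

text \<open>
  \<open>W 1\<close> is \<open>- Y\<^sup>\<circ>\<close>, \<open>W 0\<close> is \<open>Y\<^sup>+\<close> and, since \<open>Y\<close> is hyperbolic, \<open>N\<close> is \<open>- Y\<^sup>b\<close>.
\<close>

definition W :: "real \<Rightarrow> 'y set" where
  "W s = {v. \<forall>y\<in>Y. - s \<le> v \<bullet> y}"

definition N :: "'y set" where
  "N = {v. \<forall>y\<in>recession_cone Y. 0 \<le> v \<bullet> y}"

section \<open>Algebra and closedness of the dual step relation\<close>

lemma dual_stepD: "dual_step q v q' \<Longrightarrow> q' \<bullet> x = q \<bullet> f (x, u) + v \<bullet> g (x, u)"
  by (simp add: dual_step_def)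

lemma dual_step_add: "dual_step q v q' \<Longrightarrow> dual_step p w p' \<Longrightarrow> dual_step (q + p) (v + w) (q' + p')"
  unfolding dual_step_def inner_add_left by (metis add.assoc add.left_commute)

lemma dual_step_scaleR: "dual_step q v q' \<Longrightarrow> dual_step (c *\<^sub>R q) (c *\<^sub>R v) (c *\<^sub>R q')"
  unfolding dual_step_def inner_scaleR_left by (metis distrib_left)

lemma dual_step_0 [simp]: "dual_step 0 0 0"
  by (simp add: dual_step_def)

definition output_lift :: "'y \<Rightarrow> 'x \<times> 'u" where
  "output_lift = (SOME h. linear h \<and> g \<circ> h = id)"

lemma linear_output_lift: "linear output_lift" and g_output_lift [simp]: "g (output_lift y) = y"
proof -
  have "linear output_lift \<and> g \<circ> output_lift = id"
    unfolding output_lift_def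
    by (rule someI_ex[OF linear_surjective_right_inverse[OF linear_g surj_g]])
  then show "linear output_lift" "g (output_lift y) = y"
    by (auto simp: fun_eq_iff)
qed

text \<open>Tested at a lift of the basis vector \<open>b\<close>, whose output is \<open>b\<close>,
  the dual equation isolates the coordinate of the input along \<open>b\<close>. Thus two
  consecutive dual states determine the input linearly.\<close>

definition dual_input :: "'x \<Rightarrow> 'x \<Rightarrow> 'y" where
  "dual_input q q' =
     (\<Sum>b\<in>Basis. (q' \<bullet> fst (output_lift b) - q \<bullet> f (output_lift b)) *\<^sub>R b)"

lemma dual_step_input: "dual_step q v q' \<Longrightarrow> v = dual_input q q'"
proof -
  assume step: "dual_step q v q'"
  have "v \<bullet> b = q' \<bullet> fst (output_lift b) - q \<bullet> f (output_lift b)" for b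
    using dual_stepD[OF step, of "fst (output_lift b)" "snd (output_lift b)"] by simp
  then have "dual_input q q' = (\<Sum>b\<in>Basis. (v \<bullet> b) *\<^sub>R b)"
    by (simp add: dual_input_def)
  then show ?thesis
    by (simp add: euclidean_representation)
qed

lemma tendsto_dual_input:
  assumes "(q \<longlongrightarrow> a) F" "(q' \<longlongrightarrow> b) F"
  shows "((\<lambda>k. dual_input (q k) (q' k)) \<longlongrightarrow> dual_input a b) F"
  unfolding dual_input_def by (intro tendsto_intros assms)

lemma dual_step_limit:
  assumes "\<And>k. dual_step (q k) (v k) (q' k)" "q \<longlonglongrightarrow> a" "q' \<longlonglongrightarrow> b"
  shows "v \<longlonglongrightarrow> dual_input a b" "dual_step a (dual_input a b) b"
proof -
  have "v = (\<lambda>k. dual_input (q k) (q' k))"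
    using dual_step_input assms(1) by blast
  then show v: "v \<longlonglongrightarrow> dual_input a b"
    using tendsto_dual_input[OF assms(2,3)] by simp
  show "dual_step a (dual_input a b) b"
    unfolding dual_step_def
  proof (intro allI)
    fix x u
    have "(\<lambda>k. q k \<bullet> f (x, u) + v k \<bullet> g (x, u)) \<longlonglongrightarrow> a \<bullet> f (x, u) + dual_input a b \<bullet> g (x, u)"
      by (intro tendsto_intros assms v)
    then have "(\<lambda>k. q' k \<bullet> x) \<longlonglongrightarrow> a \<bullet> f (x, u) + dual_input a b \<bullet> g (x, u)"
      by (simp only: dual_stepD[OF assms(1), of _ x u])
    moreover have "(\<lambda>k. q' k \<bullet> x) \<longlonglongrightarrow> b \<bullet> x"
      by (intro tendsto_intros assms)
    ultimately show "b \<bullet> x = a \<bullet> f (x, u) + dual_input a b \<bullet> g (x, u)"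
      using LIMSEQ_unique by blast
  qed
qed

text \<open>Projecting out the input preserves closedness because convergence of the two states
  forces convergence of the input.\<close>

lemma closed_dual_graph:
  assumes "closed U"
  shows "closed (dual_graph U)"
  unfolding closed_sequential_limits
proof (intro allI impI)
  fix p l assume "(\<forall>k. p k \<in> dual_graph U) \<and> p \<longlonglongrightarrow> l"
  then have p: "\<And>k. p k \<in> dual_graph U" and lim: "p \<longlonglongrightarrow> l"
    by auto
  have "\<exists>v. v \<in> U \<and> dual_step (fst (p k)) v (snd (p k))" for k
    using p[of k] by (cases "p k") (auto simp: dual_graph_def)
  then obtain v where v: "\<And>k. v k \<in> U" "\<And>k. dual_step (fst (p k)) (v k) (snd (p k))"
    by metis
  note limit = dual_step_limit[OF v(2) tendsto_fst[OF lim] tendsto_snd[OF lim]]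
  have "dual_input (fst l) (snd l) \<in> U"
    by (rule closed_sequentially[OF assms v(1) limit(1)])
  with limit(2) show "l \<in> dual_graph U"
    by (cases l) (auto simp: dual_graph_def)
qed

lemma convex_cone_dual_graph:
  assumes "convex_cone U"
  shows "convex_cone (dual_graph U)"
  unfolding convex_cone_iff
proof (intro conjI ballI allI impI)
  show "0 \<in> dual_graph U"
    using convex_cone_contains_0[OF assms] by (auto simp: dual_graph_def zero_prod_def intro!: bexI[of _ 0])
next
  fix x y assume "x \<in> dual_graph U" "y \<in> dual_graph U"
  then show "x + y \<in> dual_graph U"
    using convex_cone_add[OF assms] dual_step_add by (fastforce simp: dual_graph_def)
next
  fix x and c :: real assume "x \<in> dual_graph U" "0 \<le> c"
  then show "c *\<^sub>R x \<in> dual_graph U"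
    using convex_cone_scaleR[OF assms] dual_step_scaleR by (fastforce simp: dual_graph_def)
qed

text \<open>By uniqueness of the input, a step and its negative have opposite inputs, so the
  lineality space of the graph comes from that of \<open>U\<close>.\<close>

lemma dual_graph_lineality:
  assumes "(q, q') \<in> dual_graph U" "- (q, q') \<in> dual_graph U"
  shows "(q, q') \<in> dual_graph (U \<inter> uminus ` U)"
proof -
  obtain v w where v: "v \<in> U" "dual_step q v q'" and w: "w \<in> U" "dual_step (- q) w (- q')"
    using assms by (auto simp: dual_graph_def)
  have "dual_step q (- w) q'"
    using dual_step_scaleR[OF w(2), of "-1"] by simp
  then have "v = - w"
    using v(2) dual_step_input by metis
  then show ?thesis
    using v w(1) by (auto simp: dual_graph_def)
qed

lemma dual_graph_mono: "U \<subseteq> U' \<Longrightarrow> dual_graph U \<subseteq> dual_graph U'"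
  by (auto simp: dual_graph_def)

lemma dual_trajectory_mono: "dual_trajectory U q \<Longrightarrow> U \<subseteq> U' \<Longrightarrow> dual_trajectory U' q"
  unfolding dual_trajectory_def using dual_graph_mono by blast

section \<open>Input sets and hyperbolicity\<close>

lemma closed_W: "closed (W s)"
proof -
  have "W s = (\<Inter>y\<in>Y. {v. - s \<le> v \<bullet> y})"
    by (auto simp: W_def)
  then show ?thesis
    by (simp add: closed_INT closed_Collect_le continuous_on_inner)
qed

lemma convex_cone_W: "convex_cone (W 0)"
  unfolding convex_cone_iff by (auto simp: W_def inner_add_left)

lemma closed_N: "closed N"
proof -
  have "N = (\<Inter>y\<in>recession_cone Y. {v. 0 \<le> v \<bullet> y})"
    by (auto simp: N_def)
  then show ?thesis
    by (simp add: closed_INT closed_Collect_le continuous_on_inner)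
qed

lemma convex_cone_N: "convex_cone N"
  unfolding convex_cone_iff by (auto simp: N_def inner_add_left)

text \<open>The level \<open>s\<close> scales with the input. Dividing an unbounded trajectory by
  its growing norms therefore drives the level from 1 to 0.\<close>

lemma scaleR_W: "v \<in> W s \<Longrightarrow> 0 \<le> c \<Longrightarrow> c *\<^sub>R v \<in> W (c * s)"
  unfolding W_def using mult_left_mono[of "- s" _ c] by fastforce

lemma scaleR_dual_graph_W:
  assumes "(q, q') \<in> dual_graph (W s)" "0 \<le> c"
  shows "(c *\<^sub>R q, c *\<^sub>R q') \<in> dual_graph (W (c * s))"
  using assms scaleR_W dual_step_scaleR by (fastforce simp: dual_graph_def)

lemma W_mono: "s \<le> s' \<Longrightarrow> W s \<subseteq> W s'"
  by (force simp: W_def)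

lemma W_subset_N: "W 1 \<subseteq> N"
proof
  fix v assume v: "v \<in> W 1"
  show "v \<in> N"
    unfolding N_def
  proof (intro CollectI ballI, rule ccontr)
    fix y assume y: "y \<in> recession_cone Y" and "\<not> 0 \<le> v \<bullet> y"
    then have neg: "v \<bullet> y < 0"
      by simp
    define c where "c = 2 / - (v \<bullet> y)"
    have c: "0 \<le> c" "c * (v \<bullet> y) = - 2"
      using neg by (simp_all add: c_def)
    have "0 + c *\<^sub>R y \<in> Y"
      using y zero_Y c(1) unfolding recession_cone_def by blast
    then have "- 1 \<le> v \<bullet> (0 + c *\<^sub>R y)"
      using v unfolding W_def by blast
    with c(2) show False
      by simp
  qed
qed

lemma output_decomposition:
  obtains \<mu> where "\<mu> \<ge> 0" "\<And>y. y \<in> Y \<Longrightarrow> \<exists>b. norm b \<le> \<mu> \<and> y - b \<in> recession_cone Y"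
proof -
  obtain \<mu> where \<mu>: "\<mu> \<ge> 0"
    "Y \<subseteq> {\<mu> *\<^sub>R b + y | b y. b \<in> cball 0 1 \<and> y \<in> recession_cone Y}"
    using hyperbolic_Y by (auto simp: hyperbolic_set_def)
  have "\<exists>b. norm b \<le> \<mu> \<and> y - b \<in> recession_cone Y" if "y \<in> Y" for y
  proof -
    have "y \<in> {\<mu> *\<^sub>R b + y | b y. b \<in> cball 0 1 \<and> y \<in> recession_cone Y}"
      using \<mu>(2) that by blast
    then obtain b y' where "y = \<mu> *\<^sub>R b + y'" "norm b \<le> 1" "y' \<in> recession_cone Y"
      by auto
    then show ?thesis
      using \<mu>(1) by (intro exI[of _ "\<mu> *\<^sub>R b"]) (auto simp: mult_left_le)
  qed
  with \<mu>(1) show thesis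
    using that by blast
qed

text \<open>By hyperbolicity, \<open>Y\<close> is its recession cone up to bounded summands: an
  element of \<open>N\<close> can be negative only on the bounded summand, by at most \<mu> times
  its norm.\<close>

lemma N_W_bound:
  obtains \<mu> where "\<mu> \<ge> 0" "\<And>v. v \<in> N \<Longrightarrow> v \<in> W (\<mu> * norm v)"
proof -
  obtain \<mu> where \<mu>: "\<mu> \<ge> 0" "\<And>y. y \<in> Y \<Longrightarrow> \<exists>b. norm b \<le> \<mu> \<and> y - b \<in> recession_cone Y"
    using output_decomposition by blast
  have "- (\<mu> * norm v) \<le> v \<bullet> y" if v: "v \<in> N" and y: "y \<in> Y" for v y
  proof -
    obtain b where b: "norm b \<le> \<mu>" "y - b \<in> recession_cone Y"
      using \<mu>(2)[OF y] by blast
    have "\<bar>v \<bullet> b\<bar> \<le> norm v * norm b"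
      by (rule Cauchy_Schwarz_ineq2)
    also have "\<dots> \<le> norm v * \<mu>"
      by (rule mult_left_mono[OF b(1)]) simp
    finally have "- (\<mu> * norm v) \<le> v \<bullet> b"
      by (simp add: mult.commute)
    moreover have "0 \<le> v \<bullet> (y - b)"
      using v b(2) by (simp add: N_def)
    ultimately show ?thesis
      by (simp add: inner_diff_right)
  qed
  with \<mu>(1) show thesis
    using that by (auto simp: W_def)
qed

lemma dual_graph_W1I:
  assumes "(q, q') \<in> dual_graph N"
  obtains c where "c > 0" "(c *\<^sub>R q, c *\<^sub>R q') \<in> dual_graph (W 1)"
proof -
  obtain v where v: "v \<in> N" "dual_step q v q'"
    using assms by (auto simp: dual_graph_def)
  obtain \<mu> where \<mu>: "\<mu> \<ge> 0" "\<And>v. v \<in> N \<Longrightarrow> v \<in> W (\<mu> * norm v)"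
    using N_W_bound by blast
  define c where "c = 1 / (\<mu> * norm v + 1)"
  have c: "c > 0" "c * (\<mu> * norm v) \<le> 1"
    using \<mu>(1) by (auto simp: c_def add_nonneg_pos)
  have "(q, q') \<in> dual_graph (W (\<mu> * norm v))"
    using v \<mu>(2) by (auto simp: dual_graph_def)
  then have "(c *\<^sub>R q, c *\<^sub>R q') \<in> dual_graph (W 1)"
    using scaleR_dual_graph_W[of q q' _ c] c dual_graph_mono[OF W_mono[OF c(2)]] by auto
  with c(1) show thesis
    by (rule that)
qed

section \<open>Growth of dual trajectories and limits of unbounded ones\<close>

lemma zero_output_chain_orthogonal:
  assumes "dual_trajectory U q" "\<xi> 0 = 0"
    "\<And>k. k < n \<Longrightarrow> \<xi> (Suc k) = f (\<xi> k, \<eta> k) \<and> g (\<xi> k, \<eta> k) = 0" "i \<le> n"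
  shows "q j \<bullet> \<xi> i = 0"
  using assms(4)
proof (induction i arbitrary: j)
  case (Suc i)
  \<comment> \<open>Zero output shifts the pairing along the chain:
    \<open>q (Suc j) \<bullet> \<xi> i = q j \<bullet> \<xi> (Suc i)\<close>. Hence the induction
    runs for all \<open>j\<close> at once.\<close>
  obtain v where "dual_step (q j) v (q (Suc j))"
    using assms(1) by (auto simp: dual_trajectory_def dual_graph_def)
  from dual_stepD[OF this, of "\<xi> i" "\<eta> i"] show ?case
    using assms(3)[of i] Suc by simp
qed (simp add: assms(2))

text \<open>
  The interior output point \<open>y\<^sub>0\<close> is attained on a zero-output chain, which makes \<open>v \<bullet> y\<^sub>0\<close> a linear
  function of the current dual state; this controls the norm of the dual input \<open>v\<close>.
\<close>

lemma dual_growth: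
  obtains R where "R \<ge> 1" "\<And>s q j. 0 \<le> s \<Longrightarrow> dual_trajectory (W s) q \<Longrightarrow>
      norm (q (Suc j)) \<le> R * (norm (q j) + s)"
proof -
  obtain n \<xi> \<eta> where chain: "\<xi> 0 = 0"
      "\<And>k. k < n \<Longrightarrow> \<xi> (Suc k) = f (\<xi> k, \<eta> k) \<and> g (\<xi> k, \<eta> k) = 0"
    and y0: "g (\<xi> n, \<eta> n) \<in> interior Y"
    using interior_output by metis
  define z0 where "z0 = f (\<xi> n, \<eta> n)"
  obtain \<epsilon> where \<epsilon>: "\<epsilon> > 0" "cball (g (\<xi> n, \<eta> n)) \<epsilon> \<subseteq> Y"
    using y0 by (auto simp: mem_interior_cball)
  obtain Kf where Kf: "Kf > 0" "\<And>z. norm (f z) \<le> Kf * norm z"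
    using linear_bounded_pos[OF linear_f] by blast
  obtain Kg where Kg: "Kg > 0" "\<And>z. norm (g z) \<le> Kg * norm z"
    using linear_bounded_pos[OF linear_g] by blast
  define R where "R = 1 + Kf + Kg / \<epsilon> + Kg * norm z0 / \<epsilon>"
  have "norm (q (Suc j)) \<le> R * (norm (q j) + s)" if s: "0 \<le> s" and q: "dual_trajectory (W s) q" for s q j
  proof -
    obtain v where v: "v \<in> W s" and step: "dual_step (q j) v (q (Suc j))"
      using q by (auto simp: dual_trajectory_def dual_graph_def)
    have "q (Suc j) \<bullet> \<xi> n = 0"
      by (rule zero_output_chain_orthogonal[OF q chain]) auto
    then have vy: "v \<bullet> g (\<xi> n, \<eta> n) = - (q j \<bullet> z0)"
      using dual_stepD[OF step, of "\<xi> n" "\<eta> n"] by (simp add: z0_def)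
    \<comment> \<open>The point of the ball that lies farthest against \<open>v\<close>; for
      \<open>v = 0\<close> the quotient is 0 and the point is the centre.\<close>
    have "g (\<xi> n, \<eta> n) - (\<epsilon> / norm v) *\<^sub>R v \<in> Y"
      using \<epsilon> by (intro set_mp[OF \<epsilon>(2)]) (auto simp: dist_norm)
    then have "- s \<le> v \<bullet> g (\<xi> n, \<eta> n) - \<epsilon> / norm v * (v \<bullet> v)"
      using v by (auto simp: W_def inner_diff_right)
    also have "\<epsilon> / norm v * (v \<bullet> v) = \<epsilon> * norm v"
      by (simp add: dot_square_norm power2_eq_square)
    finally have "\<epsilon> * norm v \<le> s - q j \<bullet> z0"
      using vy by simp
    also have "\<dots> \<le> s + norm (q j) * norm z0"
      using Cauchy_Schwarz_ineq2[of "q j" z0] by linarith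
    finally have nv: "norm v \<le> s / \<epsilon> + norm (q j) * norm z0 / \<epsilon>"
      using \<epsilon>(1) by (simp add: field_simps)
    \<comment> \<open>Testing the step at its own successor with zero control bounds the successor
      by the old state and the input.\<close>
    have "norm (q (Suc j)) * norm (q (Suc j)) = q j \<bullet> f (q (Suc j), 0) + v \<bullet> g (q (Suc j), 0)"
      using dual_stepD[OF step, of "q (Suc j)" 0] by (simp add: dot_square_norm power2_eq_square)
    also have "\<dots> \<le> norm (q j) * norm (f (q (Suc j), 0)) + norm v * norm (g (q (Suc j), 0))"
      by (intro add_mono norm_cauchy_schwarz)
    also have "\<dots> \<le> norm (q j) * (Kf * norm (q (Suc j))) + norm v * (Kg * norm (q (Suc j)))"
      using Kf(2)[of "(q (Suc j), 0)"] Kg(2)[of "(q (Suc j), 0)"] by (intro add_mono mult_left_mono) auto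
    also have "\<dots> = (norm (q j) * Kf + norm v * Kg) * norm (q (Suc j))"
      by (simp add: algebra_simps)
    finally have "norm (q (Suc j)) \<le> norm (q j) * Kf + norm v * Kg"
      using Kf(1) Kg(1) by (cases "q (Suc j) = 0") auto
    also have "\<dots> \<le> norm (q j) * Kf + (s / \<epsilon> + norm (q j) * norm z0 / \<epsilon>) * Kg"
      using nv Kg(1) by (intro add_left_mono mult_right_mono) auto
    also have "\<dots> = (Kf + Kg * norm z0 / \<epsilon>) * norm (q j) + (Kg / \<epsilon>) * s"
      using \<epsilon>(1) by (simp add: field_simps)
    also have "\<dots> \<le> R * norm (q j) + R * s"
      unfolding R_def using Kf(1) Kg(1) \<epsilon>(1) s by (intro add_mono mult_right_mono) auto
    finally show ?thesis
      by (simp add: distrib_left)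
  qed
  moreover have "R \<ge> 1"
    unfolding R_def using Kf(1) Kg(1) \<epsilon>(1) by (simp add: add_nonneg_nonneg)
  ultimately show thesis
    using that by blast
qed

text \<open>The trajectory is restarted at times where its norm is at least k + 1 and divided by
  that norm, so the level \<open>s k\<close> tends to 0. \<open>dual_growth\<close> bounds each
  fixed time uniformly in \<open>k\<close>, which yields both the convergent subsequence and the
  geometric bound on its limit.\<close>

lemma unbounded_dual_trajectory:
  assumes q: "dual_trajectory (W 1) q" and "\<not> bounded (range q)"
  obtains p R where "norm (p 0) = 1" "dual_trajectory (W 0) p" "R \<ge> 1" "\<And>j. norm (p j) \<le> R ^ j"
proof -
  have "\<exists>m. real (Suc k) \<le> norm (q m)" for k
    using assms(2) unfolding bounded_iff by (metis linear rangeE)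
  then obtain m where m: "\<And>k. real (Suc k) \<le> norm (q (m k))"
    by metis
  define s where "s k = 1 / norm (q (m k))" for k
  have pos: "norm (q (m k)) > 0" for k
    using m[of k] by (metis less_le_trans of_nat_0_less_iff zero_less_Suc)
  have s: "0 < s k" "s k \<le> 1 / real (Suc k)" for k
    unfolding s_def using pos[of k] m[of k] by (simp, intro divide_left_mono mult_pos_pos) auto
  define r where "r k j = s k *\<^sub>R q (m k + j)" for k j
  have r_step: "(r k j, r k (Suc j)) \<in> dual_graph (W (s k))" for k j
    using scaleR_dual_graph_W[of "q (m k + j)" "q (Suc (m k + j))" 1 "s k"] q s(1)[of k]
    by (simp add: r_def dual_trajectory_def)
  obtain R where R: "R \<ge> 1" "\<And>s q j. 0 \<le> s \<Longrightarrow> dual_trajectory (W s) q \<Longrightarrow>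
      norm (q (Suc j)) \<le> R * (norm (q j) + s)"
    using dual_growth by metis
  have r_le: "norm (r k j) \<le> (2 * R) ^ j" for k j
  proof (induction j)
    case 0
    show ?case
      using pos[of k] by (simp add: r_def s_def)
  next
    case (Suc j)
    have "norm (r k (Suc j)) \<le> R * (norm (r k j) + s k)"
      using R(2)[of "s k" "r k"] s(1)[of k] r_step by (simp add: dual_trajectory_def)
    also have "\<dots> \<le> R * ((2 * R) ^ j + (2 * R) ^ j)"
    proof -
      have "s k \<le> 1"
        using s(2)[of k] by (rule order_trans) simp
      also have "1 \<le> (2 * R) ^ j"
        using R(1) by (intro one_le_power) simp
      finally show ?thesis
        using Suc R(1) by (intro mult_left_mono add_mono) auto
    qed
    finally show ?case
      by (simp add: mult_ac)
  qed
  then have "bounded (range (\<lambda>k. r k j))" for j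
    by (auto simp: bounded_iff)
  then obtain t l where t: "strict_mono (t :: nat \<Rightarrow> nat)" and l: "\<And>j. (\<lambda>k. r (t k) j) \<longlonglongrightarrow> l j"
    using pointwise_convergent_subsequence[of r] by blast
  have "s \<longlonglongrightarrow> 0"
  proof (rule Lim_null_comparison)
    show "(\<lambda>k. 1 / real (Suc k)) \<longlonglongrightarrow> 0"
      using LIMSEQ_inverse_real_of_nat by (simp add: inverse_eq_divide)
    show "\<forall>\<^sub>F k in sequentially. norm (s k) \<le> 1 / real (Suc k)"
      using s by (simp add: less_imp_le)
  qed
  have "(l j, l (Suc j)) \<in> dual_graph (W 0)" for j
  proof -
    obtain v where v: "\<And>k. v k \<in> W (s (t k))" "\<And>k. dual_step (r (t k) j) (v k) (r (t k) (Suc j))"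
      using r_step[of "t _" j] unfolding dual_graph_def by simp metis
    note limit = dual_step_limit[OF v(2) l l]
    have "0 \<le> dual_input (l j) (l (Suc j)) \<bullet> y" if "y \<in> Y" for y
    proof (rule tendsto_le[OF _ tendsto_inner[OF limit(1) tendsto_const]])
      show "(\<lambda>k. - s (t k)) \<longlonglongrightarrow> 0"
        using tendsto_minus[OF strict_mono_tendsto[OF t \<open>s \<longlonglongrightarrow> 0\<close>]] by simp
      show "\<forall>\<^sub>F k in sequentially. - s (t k) \<le> v k \<bullet> y"
        using v(1) that by (simp add: W_def)
    qed simp
    then show ?thesis
      using limit(2) by (auto simp: dual_graph_def W_def)
  qed
  then have "dual_trajectory (W 0) l"
    by (simp add: dual_trajectory_def)
  moreover have "norm (l j) \<le> (2 * R) ^ j" for j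
    using Lim_norm_ubound[OF sequentially_bot l[of j] always_eventually] r_le by blast
  moreover have "norm (l 0) = 1"
  proof -
    have "norm (r k 0) = 1" for k
      using pos[of k] by (simp add: r_def s_def)
    then show ?thesis
      using tendsto_norm[OF l[of 0]] LIMSEQ_unique[OF _ tendsto_const] by fastforce
  qed
  ultimately show thesis
    using that[of l "2 * R"] R(1) by auto
qed

text \<open>A vector orthogonal to \<open>Y\<close> vanishes, since \<open>Y\<close> contains a
  ball.\<close>

lemma W0_pointed: "W 0 \<inter> uminus ` W 0 = {0}"
proof -
  obtain y \<epsilon> where \<epsilon>: "\<epsilon> > 0" "cball y \<epsilon> \<subseteq> Y"
    using interior_output by (metis mem_interior_cball)
  have "v = 0" if v: "v \<in> W 0" "- v \<in> W 0" for v
  proof (rule ccontr)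
    assume "v \<noteq> 0"
    have Y0: "v \<bullet> y' = 0" if "y' \<in> Y" for y'
      using v that by (force simp: W_def)
    have "y \<in> Y" "y + (\<epsilon> / norm v) *\<^sub>R v \<in> Y"
      using \<epsilon> \<open>v \<noteq> 0\<close> by (auto simp: dist_norm intro!: set_mp[OF \<epsilon>(2)])
    from this[THEN Y0] have "\<epsilon> / norm v * (v \<bullet> v) = 0"
      by (simp add: inner_add_right)
    with \<open>v \<noteq> 0\<close> \<epsilon>(1) show False
      by simp
  qed
  moreover have "0 \<in> W 0"
    by (simp add: W_def)
  ultimately show ?thesis
    by (force simp: image_iff)
qed

text \<open>\<open>linear_N\<close> and \<open>eigen_N\<close> exclude a bounded trajectory,
  \<open>linear_zero\<close> and \<open>eigen_W\<close> the limit of an unbounded one.\<close>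

theorem dual_trajectory_eq_0I:
  assumes linear_zero: "\<And>q. dual_trajectory {0} q \<Longrightarrow> q 0 = 0"
    and eigen_W: "\<And>q t. 0 \<le> t \<Longrightarrow> (q, t *\<^sub>R q) \<in> dual_graph (W 0) \<Longrightarrow> q = 0"
    and linear_N: "\<And>q. bounded (range q) \<Longrightarrow>
      dual_trajectory (orthogonal_comp (recession_cone Y)) q \<Longrightarrow> q 0 = 0"
    and eigen_N: "\<And>q t. 0 \<le> t \<Longrightarrow> t \<le> 1 \<Longrightarrow> (q, t *\<^sub>R q) \<in> dual_graph N \<Longrightarrow> q = 0"
    and q: "dual_trajectory (W 1) q"
  shows "q 0 = 0"
proof (cases "bounded (range q)")
  case True
  have N_lin: "N \<inter> uminus ` N \<subseteq> orthogonal_comp (recession_cone Y)"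
    by (force simp: N_def orthogonal_comp_def orthogonal_def inner_commute)
  interpret expanding_cone_process "dual_graph N"
  proof
    show "closed (dual_graph N)" "convex_cone (dual_graph N)"
      by (intro closed_dual_graph closed_N) (intro convex_cone_dual_graph convex_cone_N)
    fix q :: "nat \<Rightarrow> 'x"
    assume "bounded (range q)" "\<And>j. (q j, q (Suc j)) \<in> dual_graph N"
      "\<And>j. - (q j, q (Suc j)) \<in> dual_graph N"
    then show "q 0 = 0"
      using dual_graph_lineality dual_graph_mono[OF N_lin] by (intro linear_N) (auto simp: dual_trajectory_def)
  qed (use eigen_N in auto)
  show ?thesis
    using bounded_trajectory_eq_0[of q] True q dual_graph_mono[OF W_subset_N]
    by (auto simp: dual_trajectory_def)
next
  case False
  then obtain p R where p: "norm (p 0) = 1" "dual_trajectory (W 0) p" and R: "R \<ge> 1"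
    and p_le: "\<And>j. norm (p j) \<le> R ^ j"
    using unbounded_dual_trajectory[OF q] by metis
  define \<Gamma> where "\<Gamma> = {z. (fst z, R *\<^sub>R snd z) \<in> dual_graph (W 0)}"
  interpret expanding_cone_process \<Gamma>
  proof
    have "\<Gamma> = (\<lambda>z. (fst z, R *\<^sub>R snd z)) -` dual_graph (W 0)"
      by (auto simp: \<Gamma>_def)
    then show "closed \<Gamma>"
      by (simp only:) (intro closed_vimage closed_dual_graph closed_W continuous_intros)
    note cone = convex_cone_dual_graph[OF convex_cone_W]
    show "convex_cone \<Gamma>"
      unfolding convex_cone_iff
    proof (intro conjI ballI allI impI)
      show "0 \<in> \<Gamma>"
        using convex_cone_contains_0[OF cone] by (simp add: \<Gamma>_def zero_prod_def)
    next
      fix x y assume "x \<in> \<Gamma>" "y \<in> \<Gamma>"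
      then show "x + y \<in> \<Gamma>"
        using convex_cone_add[OF cone] by (fastforce simp: \<Gamma>_def scaleR_add_right)
    next
      fix x and c :: real assume "x \<in> \<Gamma>" "0 \<le> c"
      then show "c *\<^sub>R x \<in> \<Gamma>"
        using convex_cone_scaleR[OF cone, of c "(fst x, R *\<^sub>R snd x)"] by (simp add: \<Gamma>_def mult.commute)
    qed
  next
    fix h :: "nat \<Rightarrow> 'x"
    assume h: "\<And>j. (h j, h (Suc j)) \<in> \<Gamma>" "\<And>j. - (h j, h (Suc j)) \<in> \<Gamma>"
    have "(h j, R *\<^sub>R h (Suc j)) \<in> dual_graph {0}" for j
      using dual_graph_lineality[of "h j" "R *\<^sub>R h (Suc j)" "W 0"] h[of j] W0_pointed by (simp add: \<Gamma>_def)
    then have "dual_step (h j) 0 (R *\<^sub>R h (Suc j))" for j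
      by (simp add: dual_graph_def)
    from dual_step_scaleR[OF this] have "dual_step (R ^ j *\<^sub>R h j) 0 (R ^ Suc j *\<^sub>R h (Suc j))" for j
      by (simp add: mult.commute[of R])
    then have "dual_trajectory {0} (\<lambda>j. R ^ j *\<^sub>R h j)"
      by (simp add: dual_trajectory_def dual_graph_def)
    from linear_zero[OF this] show "h 0 = 0"
      by simp
  next
    fix h and t :: real
    assume "0 \<le> t" "(h, t *\<^sub>R h) \<in> \<Gamma>"
    then show "h = 0"
      using eigen_W[of "R * t" h] R by (simp add: \<Gamma>_def)
  qed
  define h where "h j = (1 / R ^ j) *\<^sub>R p j" for j
  have "(h j, h (Suc j)) \<in> \<Gamma>" for j
    using scaleR_dual_graph_W[of "p j" "p (Suc j)" 0 "1 / R ^ j"] p(2) R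
    by (simp add: \<Gamma>_def h_def dual_trajectory_def)
  moreover have "norm (h j) \<le> 1" for j
    using p_le[of j] R by (simp add: h_def)
  then have "bounded (range h)"
    by (auto simp: bounded_iff)
  ultimately have "h 0 = 0"
    by (rule bounded_trajectory_eq_0)
  with p(1) show ?thesis
    by (simp add: h_def)
qed


section \<open>Pairing of dual with primal trajectories\<close>

lemma f_add: "f (x + x', u + u') = f (x, u) + f (x', u')"
  and g_add: "g (x + x', u + u') = g (x, u) + g (x', u')"
  using linear_add[OF linear_f, of "(x, u)" "(x', u')"] linear_add[OF linear_g, of "(x, u)" "(x', u')"]
  by simp_all

lemma f_0 [simp]: "f (0, 0) = 0" and g_0 [simp]: "g (0, 0) = 0"
  using linear_0[OF linear_f] linear_0[OF linear_g] by (simp_all add: zero_prod_def)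

lemma zero_recession: "0 \<in> recession_cone Y"
  by (rule convex_cone_contains_0[OF recession_cone_convex_cone])

text \<open>\<open>x\<close> runs backwards through the recession system, so the pairing does not
  decrease in \<open>k\<close>; boundedness of \<open>q\<close> and convergence of \<open>x\<close>
  send it to 0.\<close>

lemma bounded_dual_trajectory_pairing:
  assumes q: "dual_trajectory N q" "bounded (range q)"
    and x: "\<And>k. x k \<in> primal (recession_cone Y) (x (Suc k))" "x \<longlonglongrightarrow> 0"
  shows "q 0 \<bullet> x 0 \<le> 0"
proof -
  have "q k \<bullet> x k \<le> q (Suc k) \<bullet> x (Suc k)" for k
  proof -
    obtain v where v: "v \<in> N" "dual_step (q k) v (q (Suc k))"
      using q(1) by (auto simp: dual_trajectory_def dual_graph_def)
    obtain u where u: "x k = f (x (Suc k), u)" "g (x (Suc k), u) \<in> recession_cone Y"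
      using x(1)[of k] by (auto simp: primal_def)
    show ?thesis
      using dual_stepD[OF v(2), of "x (Suc k)" u] u v(1) by (simp add: N_def)
  qed
  then have mono: "q 0 \<bullet> x 0 \<le> q k \<bullet> x k" for k
    by (induction k) (auto intro: order_trans)
  obtain M where M: "\<And>k. norm (q k) \<le> M"
    using q(2) by (auto simp: bounded_iff)
  have "(\<lambda>k. q k \<bullet> x k) \<longlonglongrightarrow> 0"
  proof (rule Lim_null_comparison)
    have "norm (q k \<bullet> x k) \<le> M * norm (x k)" for k
      using Cauchy_Schwarz_ineq2[of "q k" "x k"] mult_right_mono[OF M[of k], of "norm (x k)"] by simp
    then show "\<forall>\<^sub>F k in sequentially. norm (q k \<bullet> x k) \<le> M * norm (x k)"
      by simp
    show "(\<lambda>k. M * norm (x k)) \<longlonglongrightarrow> 0"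
      using tendsto_mult[OF tendsto_const tendsto_norm_zero[OF x(2)]] by simp
  qed
  then show ?thesis
    by (rule tendsto_lowerbound) (use mono in auto)
qed

abbreviation output_cone :: "'y set" where
  "output_cone \<equiv> convex_cone hull (insert 0 Y)"

lemma scaleR_output_cone: "y \<in> Y \<Longrightarrow> 0 \<le> c \<Longrightarrow> c *\<^sub>R y \<in> output_cone"
  by (meson convex_cone_hull_mul hull_inc insertI2)

lemma W0_output_cone:
  assumes "v \<in> W 0" "y \<in> output_cone"
  shows "0 \<le> v \<bullet> y"
proof -
  have "output_cone \<subseteq> {y. v \<bullet> y \<ge> 0}"
    by (rule hull_minimal) (use assms(1) convex_cone_halfspace_ge[of v] in \<open>auto simp: W_def\<close>)
  with assms(2) show ?thesis
    by blast
qed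

text \<open>Going back one primal step goes forward one dual step without lowering the pairing, and
  the primal path ends up at 0; hence the induction is over all \<open>j\<close>.\<close>

lemma reachable_pairing:
  assumes p: "dual_trajectory (W 0) p" and "x \<in> sv_power l (primal output_cone) 0"
  shows "p j \<bullet> x \<le> 0"
  using assms(2)
proof (induction l arbitrary: x j)
  case (Suc l)
  then obtain x' where x': "x' \<in> sv_power l (primal output_cone) 0" "x \<in> primal output_cone x'"
    by auto
  then obtain u where u: "x = f (x', u)" "g (x', u) \<in> output_cone"
    by (auto simp: primal_def)
  obtain v where v: "v \<in> W 0" "dual_step (p j) v (p (Suc j))"
    using p by (auto simp: dual_trajectory_def dual_graph_def)
  have "p j \<bullet> x = p (Suc j) \<bullet> x' - v \<bullet> g (x', u)"
    using dual_stepD[OF v(2), of x' u] u(1) by simp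
  also have "\<dots> \<le> 0"
    using Suc.IH[OF x'(1), of "Suc j"] W0_output_cone[OF v(1) u(2)] by simp
  finally show ?case .
qed simp

lemma interior_absorbs_output_cone:
  assumes "y0 \<in> interior Y"
  obtains c where "w + c *\<^sub>R y0 \<in> output_cone"
proof -
  obtain \<epsilon> where \<epsilon>: "\<epsilon> > 0" "cball y0 \<epsilon> \<subseteq> Y"
    using assms by (auto simp: mem_interior_cball)
  \<comment> \<open>Large enough that \<open>w / c\<close> has norm at most
    \<open>\<epsilon>\<close>; the summand 1 keeps \<open>c\<close> positive when
    \<open>w = 0\<close>.\<close>
  define c where "c = norm w / \<epsilon> + 1"
  have c: "c > 0" "norm w \<le> \<epsilon> * c"
    using \<epsilon>(1) by (auto simp: c_def field_simps add_pos_nonneg)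
  have "y0 + (1 / c) *\<^sub>R w \<in> Y"
    using c by (intro set_mp[OF \<epsilon>(2)]) (auto simp: dist_norm field_simps)
  from scaleR_output_cone[OF this, of c] have "w + c *\<^sub>R y0 \<in> output_cone"
    using c(1) by (simp add: scaleR_add_right add.commute)
  then show thesis
    by (rule that)
qed

text \<open>
  Superposing delayed copies of the zero-output chain, with the coefficients \<open>c t\<close> chosen one after
  the other, pushes the output into the cone at every time and changes the initial state only by a
  vector orthogonal to the dual trajectory.
\<close>

lemma feasible_state_same_pairing:
  assumes p: "dual_trajectory U p"
  obtains x' where "x' \<in> feasible_states (primal output_cone)" "p 0 \<bullet> x' = p 0 \<bullet> x"
proof -
  obtain n \<xi> \<eta> where chain: "\<xi> 0 = 0"
      "\<And>k. k < n \<Longrightarrow> \<xi> (Suc k) = f (\<xi> k, \<eta> k) \<and> g (\<xi> k, \<eta> k) = 0"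
    and y0: "g (\<xi> n, \<eta> n) \<in> interior Y"
    using interior_output by metis
  \<comment> \<open>Input 0 after time \<open>n\<close> lets a copy of the chain run on forever; its
    outputs after that time are arbitrary and are compensated by later copies.\<close>
  define \<eta>' where "\<eta>' k = (if k \<le> n then \<eta> k else 0)" for k
  define \<zeta> where "\<zeta> = rec_nat 0 (\<lambda>k x. f (x, \<eta>' k))"
  have \<zeta>: "\<zeta> 0 = 0" "\<zeta> (Suc k) = f (\<zeta> k, \<eta>' k)" for k
    by (simp_all add: \<zeta>_def)
  have \<zeta>\<xi>: "\<zeta> k = \<xi> k" if "k \<le> n" for k
    using that by (induction k) (auto simp: \<zeta> chain \<eta>'_def)
  define out where "out k = g (\<zeta> k, \<eta>' k)" for k
  have out: "out n = g (\<xi> n, \<eta> n)" "\<And>k. k < n \<Longrightarrow> out k = 0"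
    using chain(2) by (auto simp: out_def \<zeta>\<xi> \<eta>'_def)
  define \<alpha> where "\<alpha> = rec_nat x (\<lambda>k x. f (x, 0))"
  have \<alpha>: "\<alpha> 0 = x" "\<alpha> (Suc k) = f (\<alpha> k, 0)" for k
    by (simp_all add: \<alpha>_def)
  have "\<exists>c :: nat \<Rightarrow> real. \<forall>t. (g (\<alpha> t, 0) + (\<Sum>k<t. c k *\<^sub>R out (n + t - k))) + c t *\<^sub>R out n
      \<in> output_cone"
  proof (rule dependent_wf_choice[of "{(k, t). k < t}"])
    show "wf {(k, t :: nat). k < t}"
      by (rule wf)
  next
    fix c c' :: "nat \<Rightarrow> real" and t :: nat and r :: real
    assume "\<And>z. (z, t) \<in> {(k, t). k < t} \<Longrightarrow> c z = c' z"
    then have "(\<Sum>k<t. c k *\<^sub>R out (n + t - k)) = (\<Sum>k<t. c' k *\<^sub>R out (n + t - k))"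
      by (intro sum.cong) auto
    then show "(g (\<alpha> t, 0) + (\<Sum>k<t. c k *\<^sub>R out (n + t - k)) + r *\<^sub>R out n \<in> output_cone) =
        (g (\<alpha> t, 0) + (\<Sum>k<t. c' k *\<^sub>R out (n + t - k)) + r *\<^sub>R out n \<in> output_cone)"
      by simp
  next
    fix t and c :: "nat \<Rightarrow> real"
    show "\<exists>r. g (\<alpha> t, 0) + (\<Sum>k<t. c k *\<^sub>R out (n + t - k)) + r *\<^sub>R out n \<in> output_cone"
      using interior_absorbs_output_cone[of "out n" "g (\<alpha> t, 0) + (\<Sum>k<t. c k *\<^sub>R out (n + t - k))"] y0
      unfolding out(1) by metis
  qed
  then obtain c :: "nat \<Rightarrow> real" where
    c: "\<And>t. (g (\<alpha> t, 0) + (\<Sum>k<t. c k *\<^sub>R out (n + t - k))) + c t *\<^sub>R out n \<in> output_cone"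
    by blast
  \<comment> \<open>Copy \<open>k\<close> has age \<open>n + t - k\<close> at time \<open>t\<close>,
    so its output \<open>out n\<close> falls at time \<open>k\<close>, where \<open>c k\<close> is
    chosen. Copies with \<open>k < n\<close> start before time 0; they change the initial state, by
    chain states of age at most \<open>n\<close>.\<close>
  define s where "s t = \<alpha> t + (\<Sum>k\<le>n + t. c k *\<^sub>R \<zeta> (n + t - k))" for t
  define inp where "inp t = (\<Sum>k\<le>n + t. c k *\<^sub>R \<eta>' (n + t - k))" for t
  have s_inp: "(s t, inp t) = (\<alpha> t, 0) + (\<Sum>k\<le>n + t. c k *\<^sub>R (\<zeta> (n + t - k), \<eta>' (n + t - k)))" for t
    by (simp add: s_def inp_def sum_prod)
  have "s (Suc t) \<in> primal output_cone (s t)" for t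
  proof -
    have "f (s t, inp t) = \<alpha> (Suc t) + (\<Sum>k\<le>n + t. c k *\<^sub>R \<zeta> (Suc (n + t - k)))"
      unfolding s_inp linear_add[OF linear_f] linear_sum[OF linear_f] linear_scale[OF linear_f]
      by (simp add: \<alpha> \<zeta>)
    also have "(\<Sum>k\<le>n + t. c k *\<^sub>R \<zeta> (Suc (n + t - k))) = (\<Sum>k\<le>n + t. c k *\<^sub>R \<zeta> (n + Suc t - k))"
      by (intro sum.cong) (auto simp: Suc_diff_le)
    also have "\<alpha> (Suc t) + \<dots> = s (Suc t)"
      by (simp add: s_def \<zeta>)
    finally have "s (Suc t) = f (s t, inp t)" ..
    moreover have "g (s t, inp t) = g (\<alpha> t, 0) + (\<Sum>k\<le>n + t. c k *\<^sub>R out (n + t - k))"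
      unfolding s_inp linear_add[OF linear_g] linear_sum[OF linear_g] linear_scale[OF linear_g]
      by (simp add: out_def)
    \<comment> \<open>Copies with \<open>k > t\<close> are younger than \<open>n\<close> and still
      have output 0.\<close>
    moreover have "(\<Sum>k\<le>n + t. c k *\<^sub>R out (n + t - k)) = (\<Sum>k\<le>t. c k *\<^sub>R out (n + t - k))"
      by (intro sum.mono_neutral_right) (auto simp: out(2))
    moreover have "(\<Sum>k\<le>t. c k *\<^sub>R out (n + t - k)) = (\<Sum>k<t. c k *\<^sub>R out (n + t - k)) + c t *\<^sub>R out n"
      by (simp add: lessThan_Suc_atMost[symmetric])
    ultimately show ?thesis
      using c[of t] by (auto simp: primal_def add.assoc)
  qed
  then have "s 0 \<in> feasible_states (primal output_cone)"
    by (auto simp: feasible_states_def)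
  moreover have "p 0 \<bullet> \<zeta> k = 0" if "k \<le> n" for k
    unfolding \<zeta>\<xi>[OF that] by (rule zero_output_chain_orthogonal[OF p chain that])
  then have "p 0 \<bullet> s 0 = p 0 \<bullet> x"
    by (simp add: s_def \<alpha> inner_add_right inner_sum_right)
  ultimately show thesis
    by (rule that)
qed

text \<open>A bounded \<open>q\<close> is paired with a backward recession trajectory started at
  \<open>q 0\<close> itself. For an unbounded one the limit \<open>p\<close> is paired with a
  feasible, hence reachable, state \<open>x\<close> such that
  \<open>p 0 \<bullet> x = 1\<close>.\<close>

theorem reachable_stable_imp_dual_trajectory_eq_0:
  assumes reach: "sv_reachable (primal output_cone)"
    and strict: "sv_strict (sv_inverse (primal (recession_cone Y)))"
    and stable: "weakly_asymptotically_stable (sv_inverse (primal (recession_cone Y)))"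
    and q: "dual_trajectory (W 1) q"
  shows "q 0 = 0"
proof (cases "bounded (range q)")
  case True
  have "q 0 \<in> sv_dom (sv_inverse (primal (recession_cone Y)))"
    using strict by (simp add: sv_strict_def)
  then obtain x where x: "x 0 = q 0" "\<And>k. x (Suc k) \<in> sv_inverse (primal (recession_cone Y)) (x k)"
    "x \<longlonglongrightarrow> 0"
    using stable by (auto simp: weakly_asymptotically_stable_def)
  have "x k \<in> primal (recession_cone Y) (x (Suc k))" for k
    using x(2)[of k] by (simp add: sv_inverse_def)
  then have "q 0 \<bullet> x 0 \<le> 0"
    using bounded_dual_trajectory_pairing[of q x] dual_trajectory_mono[OF q W_subset_N] True x(3) by blast
  then show ?thesis
    using x(1) by (metis inner_gt_zero_iff not_le)
next
  case False
  then obtain p R where p: "norm (p 0) = 1" "dual_trajectory (W 0) p"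
    using unbounded_dual_trajectory[OF q] by metis
  obtain x where x: "x \<in> feasible_states (primal output_cone)" "p 0 \<bullet> x = p 0 \<bullet> p 0"
    using feasible_state_same_pairing[OF p(2), of "p 0"] by metis
  then have "x \<in> reachable_states (primal output_cone)"
    using reach by (auto simp: sv_reachable_def)
  then have "p 0 \<bullet> x \<le> 0"
    using reachable_pairing[OF p(2)] by (auto simp: reachable_states_def)
  with x(2) p(1) show ?thesis
    by (simp add: dot_square_norm)
qed

end

section \<open>Paths with small total output\<close>

lemma linear_functional_representation:
  fixes h :: "'a::euclidean_space \<Rightarrow> real"
  assumes "linear h"
  obtains w where "\<And>x. h x = w \<bullet> x"
proof
  show "h x = adjoint h 1 \<bullet> x" for x
    using adjoint_works[OF assms, of x 1] by (simp add: inner_commute)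
qed

text \<open>The separation is weak, as \<open>S\<close> need not be closed. A functional bounded
  below on a cone is nonnegative there, and the downward ray fixes the sign of
  \<open>\<kappa>\<close>. The degenerate case \<open>\<kappa> = 0\<close> is left to the
  application.\<close>

lemma separating_cone_functional:
  fixes S :: "('a::euclidean_space \<times> real) set"
  assumes S: "convex_cone S" and down: "\<And>r. 0 \<le> r \<Longrightarrow> (0, - r) \<in> S" and "(0, 1) \<notin> S"
  shows "\<exists>w \<kappa>. 0 \<le> \<kappa> \<and> (w, \<kappa>) \<noteq> 0 \<and> (\<forall>(b, t)\<in>S. \<kappa> * t \<le> w \<bullet> b)"
proof -
  have "convex ((+) (0, - 1) ` S)"
    using S by (simp add: convex_cone_def convex_translation)
  moreover have "0 \<notin> (+) (0, - 1) ` S"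
    using assms(3) by (auto simp: zero_prod_def)
  ultimately have "\<exists>a. a \<noteq> 0 \<and> (\<forall>p\<in>(+) (0, - 1) ` S. 0 \<le> a \<bullet> p)"
    by (rule separating_hyperplane_set_0)
  then obtain a where a: "a \<noteq> 0" "\<And>p. p \<in> S \<Longrightarrow> 0 \<le> a \<bullet> ((0, - 1) + p)"
    by auto
  obtain w \<kappa>' where w: "a = (w, \<kappa>')"
    by (cases a)
  have le: "\<kappa>' \<le> a \<bullet> p" if "p \<in> S" for p
    using a(2)[OF that] by (cases p) (simp add: w algebra_simps)
  have nonneg: "0 \<le> a \<bullet> p" if "p \<in> S" for p
  proof (rule ccontr)
    assume neg: "\<not> 0 \<le> a \<bullet> p"
    define c where "c = (\<bar>\<kappa>'\<bar> + 1) / - (a \<bullet> p)"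
    have "0 \<le> c" "c * (a \<bullet> p) = - (\<bar>\<kappa>'\<bar> + 1)"
      using neg by (auto simp: c_def divide_nonneg_neg)
    moreover have "\<kappa>' \<le> a \<bullet> (c *\<^sub>R p)"
      using \<open>0 \<le> c\<close> that by (intro le convex_cone_scaleR[OF S])
    ultimately show False
      by simp
  qed
  have "0 \<le> - \<kappa>'"
    using nonneg[OF down[of 1]] by (simp add: w)
  moreover have "(w, - \<kappa>') \<noteq> 0"
    using a(1) by (simp add: w zero_prod_def)
  moreover have "- \<kappa>' * t \<le> w \<bullet> b" if "(b, t) \<in> S" for b t
    using nonneg[OF that] by (simp add: w)
  ultimately show ?thesis
    by blast
qed

lemma scaleR_combination_in_convex:
  assumes "convex S" "x \<in> S" "y \<in> S" "0 \<le> a" "0 \<le> b"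
  obtains z where "z \<in> S" "a *\<^sub>R x + b *\<^sub>R y = (a + b) *\<^sub>R z"
proof (cases "a + b = 0")
  case True
  with assms(4,5) have "a = 0" "b = 0"
    by linarith+
  with assms(2) show thesis
    by (intro that[of x]) auto
next
  case False
  then have "(a / (a + b)) *\<^sub>R x + (b / (a + b)) *\<^sub>R y \<in> S"
    using assms by (intro convexD) (auto simp: add_divide_distrib[symmetric])
  then show thesis
    using False by (intro that[of "(a / (a + b)) *\<^sub>R x + (b / (a + b)) *\<^sub>R y"]) (auto simp: scaleR_add_right)
qed

text \<open>\<open>d e i\<close> is the error made at age \<open>i\<close> by the scheme that
  answers the demand \<open>e\<close>; the errors falling due at the same time add up to the next
  demand.\<close>

fun demand :: "('a::real_vector \<Rightarrow> nat \<Rightarrow> 'a) \<Rightarrow> 'a \<Rightarrow> nat \<Rightarrow> 'a" where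
  "demand d x 0 = x"
| "demand d x (Suc t) = (\<Sum>i\<le>t. d (demand d x (t - i)) i)"

text \<open>A demand causes new demands of at most half its norm in total. So the sum s of the norms
  up to any time satisfies s \<le> |x| + s / 2, and the norms are summable.\<close>

lemma demand_tendsto_0:
  fixes d :: "'a::euclidean_space \<Rightarrow> nat \<Rightarrow> 'a"
  assumes d: "\<And>e T. (\<Sum>i<T. norm (d e i)) \<le> norm e / 2"
  shows "demand d x \<longlonglongrightarrow> 0"
proof -
  define e where "e = demand d x"
  have bound: "(\<Sum>t<T. norm (e t)) \<le> 2 * norm x" for T
  proof (cases T)
    case (Suc T')
    have "(\<Sum>t<T'. norm (e (Suc t))) \<le> (\<Sum>t<T'. \<Sum>i\<le>t. norm (d (e (t - i)) i))"
      unfolding e_def by (intro sum_mono) (simp add: sum_norm_le)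
    also have "\<dots> = (\<Sum>(i, j)\<in>{(i, j). i + j < T'}. norm (d (e j) i))"
      by (rule sum.triangle_reindex[symmetric])
    \<comment> \<open>Passing from the triangle to the square adds nonnegative terms only and makes
      the two indices independent.\<close>
    also have "\<dots> \<le> (\<Sum>(i, j)\<in>{..<T'} \<times> {..<T'}. norm (d (e j) i))"
      by (intro sum_mono2) auto
    also have "\<dots> = (\<Sum>j<T'. \<Sum>i<T'. norm (d (e j) i))"
      by (subst sum.swap) (simp add: sum.cartesian_product)
    also have "\<dots> \<le> (\<Sum>j<T'. norm (e j) / 2)"
      by (intro sum_mono d)
    also have "\<dots> \<le> (\<Sum>j<T. norm (e j) / 2)"
      using Suc by (intro sum_mono2) auto
    also have "\<dots> = (\<Sum>j<T. norm (e j)) / 2"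
      by (simp add: sum_divide_distrib)
    finally have "(\<Sum>t<T. norm (e t)) \<le> norm (e 0) + (\<Sum>j<T. norm (e j)) / 2"
      unfolding Suc sum.lessThan_Suc_shift by simp
    then show ?thesis
      by (simp add: e_def)
  qed simp
  have "summable (\<lambda>t. norm (e t))"
    by (rule summableI_nonneg_bounded[OF _ bound]) simp
  from summable_LIMSEQ_zero[OF this] show ?thesis
    unfolding e_def by (rule tendsto_norm_zero_cancel)
qed

context constrained_system
begin

section \<open>The dual map as a dual process\<close>

lemma factor_through_output:
  assumes "linear h" "\<And>z. g z = 0 \<Longrightarrow> h z = (0 :: real)"
  obtains v where "\<And>z. h z = v \<bullet> g z"
proof -
  have "linear (\<lambda>y. h (output_lift y))"
    using linear_compose[OF linear_output_lift assms(1)] by (simp add: o_def)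
  then obtain v where v: "\<And>y. h (output_lift y) = v \<bullet> y"
    using linear_functional_representation by blast
  have "h z = v \<bullet> g z" for z
  proof -
    have "g (z - output_lift (g z)) = 0"
      by (simp add: linear_diff[OF linear_g])
    then have "h (z - output_lift (g z)) = 0"
      by (rule assms(2))
    then show ?thesis
      by (simp add: linear_diff[OF assms(1)] v)
  qed
  then show thesis
    by (rule that)
qed

lemma dual_stepI:
  assumes "\<And>z. q' \<bullet> fst z - q \<bullet> f z = v \<bullet> g z"
  shows "dual_step q v q'"
  unfolding dual_step_def
proof (intro allI)
  fix x u show "q' \<bullet> x = q \<bullet> f (x, u) + v \<bullet> g (x, u)"
    using assms[of "(x, u)"] by simp
qed

lemma linear_dual_form: "linear (\<lambda>z. q' \<bullet> fst z - q \<bullet> f z)"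
  by (rule linearI) (simp_all add: linear_add[OF linear_f] linear_scale[OF linear_f]
      inner_add_right right_diff_distrib)

lemma linear_bounded_above_imp_0:
  assumes "linear h" "\<And>t :: real. h (t *\<^sub>R z) \<le> (B :: real)"
  shows "h z = 0"
proof (rule ccontr)
  assume "h z \<noteq> 0"
  then have "h (((B + 1) / h z) *\<^sub>R z) = B + 1"
    by (simp add: linear_scale[OF assms(1)])
  with assms(2)[of "(B + 1) / h z"] show False
    by simp
qed

text \<open>A functional bounded below on all pairs with output in \<open>Y\<close> vanishes on the
  kernel of \<open>g\<close>, because 0 \<in> Y, and so factors through \<open>g\<close>; the factor
  is the dual input. Since \<open>g\<close> is onto, the bound on pairs is a bound on all of
  \<open>Y\<close>.\<close>

lemma sv_dual_primal: "sv_dual (primal Y) q = {q'. (q, q') \<in> dual_graph (W 1)}"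
proof (intro set_eqI iffI; unfold mem_Collect_eq)
  fix q' assume "q' \<in> sv_dual (primal Y) q"
  then have polar: "- q' \<bullet> x + q \<bullet> f (x, u) \<le> 1" if "g (x, u) \<in> Y" for x u
    using that by (fastforce simp: sv_dual_def polar_set_def sv_graph_def primal_def)
  define h where "h z = q' \<bullet> fst z - q \<bullet> f z" for z
  have h: "linear h"
    unfolding h_def by (rule linear_dual_form)
  have hY: "- 1 \<le> h z" if "g z \<in> Y" for z
    using polar[of "fst z" "snd z"] that by (simp add: h_def)
  have "h z = 0" if "g z = 0" for z
  proof (rule linear_bounded_above_imp_0[OF h])
    fix t :: real
    have "g (- (t *\<^sub>R z)) = 0"
      using that by (simp add: linear_neg[OF linear_g] linear_scale[OF linear_g])
    then show "h (t *\<^sub>R z) \<le> 1"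
      using hY[of "- (t *\<^sub>R z)"] zero_Y by (simp add: linear_neg[OF h])
  qed
  then obtain v where v: "\<And>z. h z = v \<bullet> g z"
    using factor_through_output[OF h] by blast
  have "v \<in> W 1"
    using hY[of "output_lift _"] v[of "output_lift _"] by (simp add: W_def)
  moreover have "dual_step q v q'"
    using v by (intro dual_stepI) (simp add: h_def)
  ultimately show "(q, q') \<in> dual_graph (W 1)"
    by (auto simp: dual_graph_def)
next
  fix q' assume "(q, q') \<in> dual_graph (W 1)"
  then obtain v where v: "v \<in> W 1" "dual_step q v q'"
    by (auto simp: dual_graph_def)
  have "- q' \<bullet> x + q \<bullet> f (x, u) \<le> 1" if "g (x, u) \<in> Y" for x u
    using dual_stepD[OF v(2), of x u] v(1) that by (force simp: W_def)
  then have "(- q', q) \<in> polar_set (sv_graph (primal Y))"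
    by (fastforce simp: polar_set_def sv_graph_def primal_def)
  then show "q' \<in> sv_dual (primal Y) q"
    unfolding sv_dual_def by (auto intro!: rev_image_eqI)
qed

lemma feasible_states_dual:
  "feasible_states (sv_dual (primal Y)) = {0} \<longleftrightarrow> (\<forall>q. dual_trajectory (W 1) q \<longrightarrow> q 0 = 0)"
proof -
  have eq: "x \<in> feasible_states (sv_dual (primal Y)) \<longleftrightarrow> (\<exists>q. q 0 = x \<and> dual_trajectory (W 1) q)" for x
    by (simp add: feasible_states_def sv_dual_primal dual_trajectory_def)
  have "0 \<in> W 1"
    by (simp add: W_def)
  then have "dual_trajectory (W 1) (\<lambda>_. 0)"
    unfolding dual_trajectory_def dual_graph_def using dual_step_0 by blast
  then have "0 \<in> feasible_states (sv_dual (primal Y))"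
    unfolding eq by (intro exI[of _ "\<lambda>_. 0"]) simp
  then have "feasible_states (sv_dual (primal Y)) = {0} \<longleftrightarrow>
      (\<forall>x. x \<in> feasible_states (sv_dual (primal Y)) \<longrightarrow> x = 0)"
    by auto
  also have "\<dots> \<longleftrightarrow> (\<forall>q. dual_trajectory (W 1) q \<longrightarrow> q 0 = 0)"
    unfolding eq by auto
  finally show ?thesis .
qed

text \<open>
  States that are reached from the origin by outputs \<open>y\<^sub>k \<in> s\<^sub>k Y\<close>, paired with upper bounds for the
  total \<open>\<Sum> s\<^sub>k\<close>. The polar of the set of states with bound 1 is viable for the dual process.
\<close>

definition scaled_outputs :: "('y \<times> real) set" where
  "scaled_outputs = {(s *\<^sub>R y, s) | s y. 0 \<le> s \<and> y \<in> Y}"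

primrec budget :: "nat \<Rightarrow> ('x \<times> real) set" where
  "budget 0 = {(0, \<sigma>) | \<sigma>. 0 \<le> \<sigma>}"
| "budget (Suc l) =
     {(f z, \<sigma> + \<tau>) | z \<sigma> \<tau>. (fst z, \<sigma>) \<in> budget l \<and> (g z, \<tau>) \<in> scaled_outputs}"

section \<open>Convexity and monotonicity of the budgets\<close>

lemma convex_cone_scaled_outputs: "convex_cone scaled_outputs"
  unfolding convex_cone_iff
proof (intro conjI ballI allI impI)
  show "0 \<in> scaled_outputs"
    using zero_Y by (force simp: scaled_outputs_def zero_prod_def)
next
  fix p p' assume "p \<in> scaled_outputs" "p' \<in> scaled_outputs"
  then obtain s y s' y' where p: "p = (s *\<^sub>R y, s)" "0 \<le> s" "y \<in> Y" "p' = (s' *\<^sub>R y', s')" "0 \<le> s'" "y' \<in> Y"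
    by (auto simp: scaled_outputs_def)
  obtain w where "w \<in> Y" "s *\<^sub>R y + s' *\<^sub>R y' = (s + s') *\<^sub>R w"
    using scaleR_combination_in_convex[OF convex_Y p(3,6,2,5)] by metis
  with p show "p + p' \<in> scaled_outputs"
    by (force simp: scaled_outputs_def)
next
  fix p and c :: real assume "p \<in> scaled_outputs" "0 \<le> c"
  then show "c *\<^sub>R p \<in> scaled_outputs"
    by (fastforce simp: scaled_outputs_def)
qed

lemma convex_cone_budget: "convex_cone (budget l)"
proof (induction l)
  case 0
  show ?case
    unfolding convex_cone_iff by (auto simp: zero_prod_def)
next
  case (Suc l)
  note so = convex_cone_scaled_outputs
  show ?case
    unfolding convex_cone_iff
  proof (intro conjI ballI allI impI)
    show "0 \<in> budget (Suc l)"
      using convex_cone_contains_0[OF Suc] convex_cone_contains_0[OF so]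
      by (auto simp: zero_prod_def intro!: exI[of _ "0 :: 'x"] exI[of _ "0 :: 'u"] exI[of _ "0 :: real"])
  next
    fix p p' assume "p \<in> budget (Suc l)" "p' \<in> budget (Suc l)"
    then obtain z \<sigma> \<tau> z' \<sigma>' \<tau>' where p: "p = (f z, \<sigma> + \<tau>)" "(fst z, \<sigma>) \<in> budget l" "(g z, \<tau>) \<in> scaled_outputs"
      and p': "p' = (f z', \<sigma>' + \<tau>')" "(fst z', \<sigma>') \<in> budget l" "(g z', \<tau>') \<in> scaled_outputs"
      unfolding budget.simps by blast
    have "p + p' = (f (z + z'), (\<sigma> + \<sigma>') + (\<tau> + \<tau>'))"
      by (simp add: p p' linear_add[OF linear_f])
    moreover have "(fst (z + z'), \<sigma> + \<sigma>') \<in> budget l"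
      using convex_cone_add[OF Suc p(2) p'(2)] by simp
    moreover have "(g (z + z'), \<tau> + \<tau>') \<in> scaled_outputs"
      using convex_cone_add[OF so p(3) p'(3)] by (simp add: linear_add[OF linear_g])
    ultimately show "p + p' \<in> budget (Suc l)"
      unfolding budget.simps by blast
  next
    fix p and c :: real assume "p \<in> budget (Suc l)" "0 \<le> c"
    then obtain z \<sigma> \<tau> where p: "p = (f z, \<sigma> + \<tau>)" "(fst z, \<sigma>) \<in> budget l" "(g z, \<tau>) \<in> scaled_outputs"
      unfolding budget.simps by blast
    have "c *\<^sub>R p = (f (c *\<^sub>R z), c * \<sigma> + c * \<tau>)"
      by (simp add: p linear_scale[OF linear_f] distrib_left)
    moreover have "(fst (c *\<^sub>R z), c * \<sigma>) \<in> budget l"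
      using convex_cone_scaleR[OF Suc \<open>0 \<le> c\<close> p(2)] by simp
    moreover have "(g (c *\<^sub>R z), c * \<tau>) \<in> scaled_outputs"
      using convex_cone_scaleR[OF so \<open>0 \<le> c\<close> p(3)] by (simp add: linear_scale[OF linear_g])
    ultimately show "c *\<^sub>R p \<in> budget (Suc l)"
      unfolding budget.simps by blast
  qed
qed

lemma budgetI:
  "(x, \<sigma>) \<in> budget l \<Longrightarrow> (g (x, u), \<tau>) \<in> scaled_outputs \<Longrightarrow> (f (x, u), \<sigma> + \<tau>) \<in> budget (Suc l)"
  by force

lemma budget_Suc_mono: "budget l \<subseteq> budget (Suc l)"
proof (induction l)
  case 0
  have "(f (0, 0), \<sigma> + 0) \<in> budget (Suc 0)" if "0 \<le> \<sigma>" for \<sigma>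
    using that convex_cone_contains_0[OF convex_cone_scaled_outputs]
    by (intro budgetI) (auto simp: zero_prod_def)
  then show ?case
    by auto
next
  case (Suc l)
  then show ?case
    unfolding budget.simps(2)[of "Suc l"] budget.simps(2)[of l] by blast
qed

lemma budget_mono: "l \<le> l' \<Longrightarrow> budget l \<subseteq> budget l'"
  by (rule lift_Suc_mono_le[of budget]) (rule budget_Suc_mono)

definition affordable :: "('x \<times> real) set" where
  "affordable = (\<Union>l. budget l)"

lemma convex_cone_affordable: "convex_cone affordable"
  unfolding convex_cone_iff
proof (intro conjI ballI allI impI)
  show "0 \<in> affordable"
    using convex_cone_contains_0[OF convex_cone_budget] by (auto simp: affordable_def)
next
  fix p p' assume "p \<in> affordable" "p' \<in> affordable"
  then obtain l l' where "p \<in> budget l" "p' \<in> budget l'"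
    by (auto simp: affordable_def)
  then have "p \<in> budget (max l l')" "p' \<in> budget (max l l')"
    using budget_mono[of l "max l l'"] budget_mono[of l' "max l l'"] by auto
  then show "p + p' \<in> affordable"
    unfolding affordable_def using convex_cone_add[OF convex_cone_budget] by blast
next
  fix p and c :: real assume "p \<in> affordable" "0 \<le> c"
  then show "c *\<^sub>R p \<in> affordable"
    unfolding affordable_def using convex_cone_scaleR[OF convex_cone_budget] by blast
qed

lemma affordable_step:
  "(x, \<sigma>) \<in> affordable \<Longrightarrow> (g (x, u), \<tau>) \<in> scaled_outputs \<Longrightarrow> (f (x, u), \<sigma> + \<tau>) \<in> affordable"
  unfolding affordable_def using budgetI by blast

lemma affordable_0: "0 \<le> \<sigma> \<Longrightarrow> (0, \<sigma>) \<in> affordable"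
  unfolding affordable_def by (auto intro!: exI[of _ 0])

lemma affordable_increase: "(x, \<sigma>) \<in> affordable \<Longrightarrow> 0 \<le> \<epsilon> \<Longrightarrow> (x, \<sigma> + \<epsilon>) \<in> affordable"
  using convex_cone_add[OF convex_cone_affordable _ affordable_0] by force

lemma affordable_nonneg: "(x, \<sigma>) \<in> affordable \<Longrightarrow> 0 \<le> \<sigma>"
proof -
  have "0 \<le> \<sigma>" if "(x, \<sigma>) \<in> budget l" for x \<sigma> l
    using that by (induction l arbitrary: x \<sigma>) (auto simp: scaled_outputs_def)
  then show "(x, \<sigma>) \<in> affordable \<Longrightarrow> 0 \<le> \<sigma>"
    by (auto simp: affordable_def)
qed

section \<open>Viability of the polar and affordability of every state\<close>

definition budget_polar :: "'x set" where
  "budget_polar = {q. \<forall>(x, \<sigma>)\<in>affordable. q \<bullet> x \<le> \<sigma>}"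

lemma affordable_chain:
  assumes "\<xi> 0 = 0" "\<And>k. k < n \<Longrightarrow> \<xi> (Suc k) = f (\<xi> k, \<eta> k) \<and> g (\<xi> k, \<eta> k) = 0" "i \<le> n"
  shows "(\<xi> i, 0) \<in> affordable"
  using assms(3)
proof (induction i)
  case (Suc i)
  then show ?case
    using affordable_step[of "\<xi> i" 0 "\<eta> i" 0] assms(2)[of i]
      convex_cone_contains_0[OF convex_cone_scaled_outputs] by (simp add: zero_prod_def)
qed (simp add: assms(1) affordable_0)

text \<open>The dual input is a Lagrange multiplier for the constraint that the output
  \<open>g z\<close> equals some \<open>y\<close> with \<open>(y, \<tau>)\<close> in
  \<open>scaled_outputs\<close>. The cone \<open>S\<close> pairs the residual of this constraint
  with the gain \<open>q \<bullet> f z - \<sigma> - \<tau>\<close>; a gain 1 at residual 0 would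
  contradict that \<open>q\<close> lies in the polar.\<close>

lemma budget_polar_viable:
  assumes q: "q \<in> budget_polar"
  obtains q' where "q' \<in> budget_polar" "(q, q') \<in> dual_graph (W 1)"
proof -
  note so = convex_cone_scaled_outputs and af = convex_cone_affordable
  define S where "S = {(g z - y, q \<bullet> f z - \<sigma> - \<tau> - r) | z y \<sigma> \<tau> r.
      (fst z, \<sigma>) \<in> affordable \<and> (y, \<tau>) \<in> scaled_outputs \<and> 0 \<le> r}"
  have S_mem: "(g z - y, q \<bullet> f z - \<sigma> - \<tau> - r) \<in> S"
    if "(fst z, \<sigma>) \<in> affordable" "(y, \<tau>) \<in> scaled_outputs" "0 \<le> r" for z y \<sigma> \<tau> r
    unfolding S_def using that by blast
  have so0: "(0, 0) \<in> scaled_outputs"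
    using convex_cone_contains_0[OF so] by (simp add: zero_prod_def)
  have "convex_cone S"
    unfolding convex_cone_iff
  proof (intro conjI ballI allI impI)
    show "0 \<in> S"
      using S_mem[of 0 0 0 0 0] so0 affordable_0[of 0]
      by (simp add: zero_prod_def linear_0[OF linear_f] linear_0[OF linear_g])
  next
    fix p p' assume "p \<in> S" "p' \<in> S"
    then obtain z y \<sigma> \<tau> r z' y' \<sigma>' \<tau>' r' where
      p: "p = (g z - y, q \<bullet> f z - \<sigma> - \<tau> - r)" "(fst z, \<sigma>) \<in> affordable" "(y, \<tau>) \<in> scaled_outputs" "0 \<le> r" and
      p': "p' = (g z' - y', q \<bullet> f z' - \<sigma>' - \<tau>' - r')" "(fst z', \<sigma>') \<in> affordable"
        "(y', \<tau>') \<in> scaled_outputs" "0 \<le> r'"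
      unfolding S_def by blast
    have "p + p' = (g (z + z') - (y + y'), q \<bullet> f (z + z') - (\<sigma> + \<sigma>') - (\<tau> + \<tau>') - (r + r'))"
      by (simp add: p p' linear_add[OF linear_f] linear_add[OF linear_g] inner_add_right)
    also have "\<dots> \<in> S"
      using convex_cone_add[OF af p(2) p'(2)] convex_cone_add[OF so p(3) p'(3)] p(4) p'(4)
      by (intro S_mem) auto
    finally show "p + p' \<in> S" .
  next
    fix p and c :: real assume "p \<in> S" "0 \<le> c"
    then obtain z y \<sigma> \<tau> r where
      p: "p = (g z - y, q \<bullet> f z - \<sigma> - \<tau> - r)" "(fst z, \<sigma>) \<in> affordable" "(y, \<tau>) \<in> scaled_outputs" "0 \<le> r"
      unfolding S_def by blast
    have "c *\<^sub>R p = (g (c *\<^sub>R z) - c *\<^sub>R y, q \<bullet> f (c *\<^sub>R z) - c * \<sigma> - c * \<tau> - c * r)"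
      by (simp add: p linear_scale[OF linear_f] linear_scale[OF linear_g] right_diff_distrib scaleR_diff_right)
    also have "\<dots> \<in> S"
      using convex_cone_scaleR[OF af \<open>0 \<le> c\<close> p(2)] convex_cone_scaleR[OF so \<open>0 \<le> c\<close> p(3)] p(4) \<open>0 \<le> c\<close>
      by (intro S_mem) auto
    finally show "c *\<^sub>R p \<in> S" .
  qed
  moreover have "(0, - r) \<in> S" if "0 \<le> r" for r
    using S_mem[of 0 0 0 0 r] so0 affordable_0[of 0] that
    by (simp add: linear_0[OF linear_f] linear_0[OF linear_g])
  moreover have "(0, 1) \<notin> S"
  proof
    assume "(0, 1) \<in> S"
    then obtain z \<sigma> \<tau> r where z: "(fst z, \<sigma>) \<in> affordable" "(g z, \<tau>) \<in> scaled_outputs" "0 \<le> r"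
      and "1 = q \<bullet> f z - \<sigma> - \<tau> - r"
      unfolding S_def by force
    moreover have "(f z, \<sigma> + \<tau>) \<in> affordable"
      using affordable_step[of "fst z" \<sigma> "snd z" \<tau>] z by simp
    then have "q \<bullet> f z \<le> \<sigma> + \<tau>"
      using q by (auto simp: budget_polar_def)
    ultimately show False
      by simp
  qed
  ultimately have "\<exists>w \<kappa>. 0 \<le> \<kappa> \<and> (w, \<kappa>) \<noteq> 0 \<and> (\<forall>(b, t)\<in>S. \<kappa> * t \<le> w \<bullet> b)"
    by (rule separating_cone_functional)
  then obtain w \<kappa> where w: "0 \<le> \<kappa>" "(w, \<kappa>) \<noteq> 0" "\<And>b t. (b, t) \<in> S \<Longrightarrow> \<kappa> * t \<le> w \<bullet> b"
    by fast
  have w_le: "\<kappa> * (q \<bullet> f z - \<sigma> - \<tau>) \<le> w \<bullet> (g z - y)"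
    if "(fst z, \<sigma>) \<in> affordable" "(y, \<tau>) \<in> scaled_outputs" for z y \<sigma> \<tau>
    using w(3)[OF S_mem[OF that order_refl]] by simp
  have Y_so: "(y, 1) \<in> scaled_outputs" if "y \<in> Y" for y
    using that by (force simp: scaled_outputs_def)
  \<comment> \<open>Slater's condition: the chain reaches an interior point of \<open>Y\<close> at
    price 0, so residuals occur in every direction, and \<open>w\<close> alone cannot be nonnegative
    on all of them.\<close>
  have "\<kappa> \<noteq> 0"
  proof
    assume "\<kappa> = 0"
    then have "w \<noteq> 0"
      using w(2) by (simp add: zero_prod_def)
    obtain n \<xi> \<eta> where chain: "\<xi> 0 = 0"
        "\<And>k. k < n \<Longrightarrow> \<xi> (Suc k) = f (\<xi> k, \<eta> k) \<and> g (\<xi> k, \<eta> k) = 0"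
      and y0: "g (\<xi> n, \<eta> n) \<in> interior Y"
      using interior_output by metis
    obtain \<epsilon> where \<epsilon>: "\<epsilon> > 0" "cball (g (\<xi> n, \<eta> n)) \<epsilon> \<subseteq> Y"
      using y0 by (auto simp: mem_interior_cball)
    have "g (\<xi> n, \<eta> n) + (\<epsilon> / norm w) *\<^sub>R w \<in> Y"
      using \<epsilon> by (intro set_mp[OF \<epsilon>(2)]) (auto simp: dist_norm)
    from w_le[OF _ Y_so[OF this], of "(\<xi> n, \<eta> n)" 0] affordable_chain[OF chain order_refl]
    have "\<epsilon> / norm w * (w \<bullet> w) \<le> 0"
      by (simp add: \<open>\<kappa> = 0\<close>)
    moreover have "0 < \<epsilon> / norm w * (w \<bullet> w)"
      using \<epsilon>(1) \<open>w \<noteq> 0\<close> by simp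
    ultimately show False
      by simp
  qed
  with w(1) have "\<kappa> > 0"
    by simp
  define v where "v = (- 1 / \<kappa>) *\<^sub>R w"
  have v_le: "q \<bullet> f z - \<sigma> - \<tau> \<le> v \<bullet> (y - g z)"
    if "(fst z, \<sigma>) \<in> affordable" "(y, \<tau>) \<in> scaled_outputs" for z y \<sigma> \<tau>
  proof -
    have "v \<bullet> (y - g z) = (w \<bullet> (g z - y)) / \<kappa>"
      using \<open>\<kappa> > 0\<close> by (simp add: v_def inner_diff_right field_simps)
    then show ?thesis
      using w_le[OF that] \<open>\<kappa> > 0\<close> by (simp add: pos_le_divide_eq mult.commute)
  qed
  have "v \<in> W 1"
    using v_le[of 0 0 _ 1] Y_so affordable_0[of 0]
    by (auto simp: W_def linear_0[OF linear_f] linear_0[OF linear_g])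
  define h where "h z = q \<bullet> f z + v \<bullet> g z" for z
  have h: "linear h"
    unfolding h_def by (rule linearI) (simp_all add: linear_add[OF linear_f] linear_scale[OF linear_f]
        linear_add[OF linear_g] linear_scale[OF linear_g] inner_add_right distrib_left)
  have h_le: "h z \<le> \<sigma>" if "(fst z, \<sigma>) \<in> affordable" for z \<sigma>
    using v_le[OF that so0] by (simp add: h_def)
  have "linear (\<lambda>x. h (x, 0))"
    by (rule linear_compose[OF _ h, unfolded o_def]) (rule linearI, auto)
  then obtain q' where q': "\<And>x. h (x, 0) = q' \<bullet> x"
    using linear_functional_representation by blast
  \<comment> \<open>At state 0, \<open>h\<close> is bounded above on all controls, so it does not
    depend on the control; this is the equation 0 = B^T q + D^T v.\<close>
  have "h (0, u) = 0" for u
    by (rule linear_bounded_above_imp_0[OF h, of _ 0]) (simp add: h_le affordable_0)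
  then have "h (x, u) = q' \<bullet> x" for x u
    using linear_add[OF h, of "(x, 0)" "(0, u)"] by (simp add: q')
  then have "dual_step q v q'"
    by (simp add: dual_step_def h_def)
  moreover have "q' \<in> budget_polar"
    using h_le[of "(_, 0)"] by (auto simp: budget_polar_def q')
  ultimately show thesis
    using that \<open>v \<in> W 1\<close> by (auto simp: dual_graph_def)
qed

text \<open>A state not affordable at price \<sigma> would be separated off by some nonzero
  \<open>q\<close> in the polar, and viability continues \<open>q\<close> to an infinite dual
  trajectory.\<close>

lemma affordable_UNIV:
  assumes zero: "\<forall>q. dual_trajectory (W 1) q \<longrightarrow> q 0 = 0" and "0 < \<sigma>"
  shows "(x, \<sigma>) \<in> affordable"
proof (rule ccontr)
  assume notin: "(x, \<sigma>) \<notin> affordable"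
  define S where "S = {z. (z, \<sigma>) \<in> affordable}"
  have "convex affordable"
    using convex_cone_affordable by (simp add: convex_cone_def)
  have "convex ((+) (- x) ` S)"
  proof (rule convex_translation, rule convexI)
    fix y z and a b :: real assume "y \<in> S" "z \<in> S" "0 \<le> a" "0 \<le> b" "a + b = 1"
    then show "a *\<^sub>R y + b *\<^sub>R z \<in> S"
      using convexD[OF \<open>convex affordable\<close>, of "(y, \<sigma>)" "(z, \<sigma>)" a b]
      by (simp add: S_def distrib_right[symmetric])
  qed
  moreover have "0 \<notin> (+) (- x) ` S"
    using notin by (auto simp: S_def)
  ultimately have "\<exists>a. a \<noteq> 0 \<and> (\<forall>z\<in>(+) (- x) ` S. 0 \<le> a \<bullet> z)"
    by (rule separating_hyperplane_set_0)
  then obtain a where a: "a \<noteq> 0" "\<And>z. z \<in> S \<Longrightarrow> 0 \<le> a \<bullet> (- x + z)"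
    by blast
  \<comment> \<open>\<open>\<beta> * \<sigma> = \<sigma> - a \<bullet> x\<close> dominates
    \<open>- (a \<bullet> z)\<close> for \<open>z\<close> in \<open>S\<close>; the summand 1 keeps
    \<open>\<beta>\<close> positive if \<open>a \<bullet> x = 0\<close>.\<close>
  define \<beta> where "\<beta> = - (a \<bullet> x) / \<sigma> + 1"
  have "0 \<le> - (a \<bullet> x)"
    using a(2)[of 0] affordable_0[of \<sigma>] \<open>0 < \<sigma>\<close> by (simp add: S_def)
  then have "\<beta> > 0"
    using \<open>0 < \<sigma>\<close> by (simp add: \<beta>_def add_nonneg_pos del: minus_divide_left)
  define q where "q = (- 1 / \<beta>) *\<^sub>R a"
  have "q \<noteq> 0"
    using a(1) \<open>\<beta> > 0\<close> by (simp add: q_def)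
  have q_le: "q \<bullet> z \<le> \<sigma>" if "z \<in> S" for z
  proof -
    have "\<beta> * \<sigma> = \<sigma> - a \<bullet> x"
      using \<open>0 < \<sigma>\<close> by (simp add: \<beta>_def field_simps)
    moreover have "0 \<le> a \<bullet> z - a \<bullet> x"
      using a(2)[OF that] by (simp add: inner_diff_right)
    ultimately have "- (a \<bullet> z) \<le> \<beta> * \<sigma>"
      using \<open>0 < \<sigma>\<close> by linarith
    then show ?thesis
      using \<open>\<beta> > 0\<close> by (simp add: q_def field_simps)
  qed
  have "q \<in> budget_polar"
    unfolding budget_polar_def
  proof (intro CollectI ballI, clarify)
    fix z \<tau> assume z: "(z, \<tau>) \<in> affordable"
    \<comment> \<open>A price 0 cannot be rescaled to \<sigma>, hence the surcharge
      \<epsilon>.\<close>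
    show "q \<bullet> z \<le> \<tau>"
    proof (rule field_le_epsilon)
      fix \<epsilon> :: real assume "0 < \<epsilon>"
      have pos: "0 < \<tau> + \<epsilon>"
        using affordable_nonneg[OF z] \<open>0 < \<epsilon>\<close> by simp
      have "(\<sigma> / (\<tau> + \<epsilon>)) *\<^sub>R (z, \<tau> + \<epsilon>) \<in> affordable"
        using affordable_increase[OF z] pos \<open>0 < \<epsilon>\<close> \<open>0 < \<sigma>\<close>
        by (intro convex_cone_scaleR[OF convex_cone_affordable]) auto
      then have "q \<bullet> ((\<sigma> / (\<tau> + \<epsilon>)) *\<^sub>R z) \<le> \<sigma>"
        using pos by (intro q_le) (simp add: S_def)
      then have "\<sigma> * (q \<bullet> z) \<le> \<sigma> * (\<tau> + \<epsilon>)"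
        using pos by (simp add: field_simps)
      then show "q \<bullet> z \<le> \<tau> + \<epsilon>"
        using \<open>0 < \<sigma>\<close> by (simp only: mult_le_cancel_left_pos)
    qed
  qed
  have "\<exists>p. \<forall>j. (p j \<in> budget_polar \<and> (j = 0 \<longrightarrow> p j = q)) \<and> (p j, p (Suc j)) \<in> dual_graph (W 1)"
  proof (rule dependent_nat_choice)
    show "\<exists>x. x \<in> budget_polar \<and> (0 = 0 \<longrightarrow> x = q)"
      using \<open>q \<in> budget_polar\<close> by blast
  next
    fix x and n :: nat assume "x \<in> budget_polar \<and> (n = 0 \<longrightarrow> x = q)"
    then obtain y where "y \<in> budget_polar" "(x, y) \<in> dual_graph (W 1)"
      using budget_polar_viable by blast
    then show "\<exists>y. (y \<in> budget_polar \<and> (Suc n = 0 \<longrightarrow> y = q)) \<and> (x, y) \<in> dual_graph (W 1)"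
      by auto
  qed
  then obtain p where "p 0 = q" "dual_trajectory (W 1) p"
    by (auto simp: dual_trajectory_def)
  with zero[rule_format, of p] \<open>q \<noteq> 0\<close> show False
    by simp
qed


section \<open>Approximate paths of the recession system\<close>

lemma primal_graph_convex_cone:
  assumes "convex_cone K"
  shows "convex_cone {(x, y). y \<in> primal K x}"
  unfolding convex_cone_iff
proof (intro conjI ballI allI impI)
  show "0 \<in> {(x, y). y \<in> primal K x}"
    using convex_cone_contains_0[OF assms] by (auto simp: primal_def zero_prod_def intro!: exI[of _ 0])
next
  fix p p' assume "p \<in> {(x, y). y \<in> primal K x}" "p' \<in> {(x, y). y \<in> primal K x}"
  then obtain x u x' u' where "p = (x, f (x, u))" "g (x, u) \<in> K" "p' = (x', f (x', u'))" "g (x', u') \<in> K"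
    by (auto simp: primal_def)
  then show "p + p' \<in> {(x, y). y \<in> primal K x}"
    using convex_cone_add[OF assms] by (auto simp: primal_def f_add g_add intro!: exI[of _ "u + u'"])
next
  fix p and c :: real assume "p \<in> {(x, y). y \<in> primal K x}" "0 \<le> c"
  then obtain x u where p: "p = (x, f (x, u))" "g (x, u) \<in> K"
    by (auto simp: primal_def)
  have "c *\<^sub>R f (x, u) = f (c *\<^sub>R x, c *\<^sub>R u)" "c *\<^sub>R g (x, u) = g (c *\<^sub>R x, c *\<^sub>R u)"
    using linear_scale[OF linear_f, of c "(x, u)"] linear_scale[OF linear_g, of c "(x, u)"] by simp_all
  then show "c *\<^sub>R p \<in> {(x, y). y \<in> primal K x}"
    using p convex_cone_scaleR[OF assms \<open>0 \<le> c\<close> p(2)] by (auto simp: primal_def)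
qed

lemma budget_reachable: "(x, \<sigma>) \<in> budget l \<Longrightarrow> x \<in> sv_power l (primal output_cone) 0"
proof (induction l arbitrary: x \<sigma>)
  case (Suc l)
  then obtain z \<sigma>' \<tau> where z: "x = f z" "(fst z, \<sigma>') \<in> budget l" "(g z, \<tau>) \<in> scaled_outputs"
    by auto
  have "g z \<in> output_cone"
    using z(3) scaleR_output_cone by (auto simp: scaled_outputs_def)
  then have "x \<in> primal output_cone (fst z)"
    unfolding primal_def z(1) by (auto intro!: exI[of _ "snd z"])
  then show ?case
    using Suc.IH[OF z(2)] by auto
qed simp

text \<open>
  Splitting each output as \<open>s (b + y)\<close> with \<open>b\<close> bounded and \<open>y\<close> in the recession cone, and removing
  \<open>s b\<close> by a right inverse of the output map, turns an affordable path into steps of the recession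
  system that fit together up to a total error proportional to the budget.
\<close>

lemma budget_recession_path:
  "\<exists>\<kappa>\<ge>0. \<forall>l x \<sigma>. (x, \<sigma>) \<in> budget l \<longrightarrow>
    (\<exists>a r. (\<forall>i. r i \<in> primal (recession_cone Y) (a i)) \<and> (\<forall>i\<ge>l. a i = 0 \<and> r i = 0) \<and>
      norm (x - r 0) + (\<Sum>i<l. norm (a i - r (Suc i))) \<le> \<kappa> * \<sigma>)"
proof -
  obtain \<mu> where \<mu>: "\<mu> \<ge> 0" "\<And>y. y \<in> Y \<Longrightarrow> \<exists>b. norm b \<le> \<mu> \<and> y - b \<in> recession_cone Y"
    using output_decomposition by blast
  obtain Kf where Kf: "Kf > 0" "\<And>z. norm (f z) \<le> Kf * norm z"
    using linear_bounded_pos[OF linear_f] by blast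
  obtain Kl where Kl: "Kl > 0" "\<And>z. norm (output_lift z) \<le> Kl * norm z"
    using linear_bounded_pos[OF linear_output_lift] by blast
  \<comment> \<open>\<open>Kl * \<mu>\<close> bounds the correction per unit of budget; it counts
    once in the state and once, magnified by \<open>Kf\<close>, in the successor.\<close>
  define \<kappa> where "\<kappa> = (Kf + 1) * (Kl * \<mu>)"
  have "\<kappa> \<ge> 0"
    using Kf(1) Kl(1) \<mu>(1) by (simp add: \<kappa>_def)
  moreover have "\<exists>a r. (\<forall>i. r i \<in> primal (recession_cone Y) (a i)) \<and> (\<forall>i\<ge>l. a i = 0 \<and> r i = 0) \<and>
      norm (x - r 0) + (\<Sum>i<l. norm (a i - r (Suc i))) \<le> \<kappa> * \<sigma>" if "(x, \<sigma>) \<in> budget l" for l x \<sigma>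
    using that
  proof (induction l arbitrary: x \<sigma>)
    case 0
    have "0 \<in> primal (recession_cone Y) 0"
      using zero_recession by (auto simp: primal_def intro!: exI[of _ 0])
    with 0 \<open>\<kappa> \<ge> 0\<close> show ?case
      by (intro exI[of _ "\<lambda>_. 0"]) auto
  next
    case (Suc l)
    then obtain z \<sigma>' s where z: "x = f z" "\<sigma> = \<sigma>' + s" "(fst z, \<sigma>') \<in> budget l"
      and "(g z, s) \<in> scaled_outputs"
      unfolding budget.simps(2) by blast
    then obtain y where y: "g z = s *\<^sub>R y" "0 \<le> s" "y \<in> Y"
      by (auto simp: scaled_outputs_def)
    obtain a r where ar: "\<And>i. r i \<in> primal (recession_cone Y) (a i)" "\<And>i. l \<le> i \<Longrightarrow> a i = 0 \<and> r i = 0"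
      "norm (fst z - r 0) + (\<Sum>i<l. norm (a i - r (Suc i))) \<le> \<kappa> * \<sigma>'"
      using Suc.IH[OF z(3)] by blast
    obtain b where b: "norm b \<le> \<mu>" "y - b \<in> recession_cone Y"
      using \<mu>(2)[OF y(3)] by blast
    define d where "d = output_lift (s *\<^sub>R b)"
    have "norm d \<le> Kl * (s * \<mu>)"
      unfolding d_def using Kl(2)[of "s *\<^sub>R b"] mult_left_mono[OF b(1) y(2)] Kl(1) y(2)
      by (smt (verit) abs_of_nonneg mult_left_mono norm_scaleR)
    then have nd: "norm d \<le> s * (Kl * \<mu>)"
      by (simp add: mult_ac)
    \<comment> \<open>Steps are indexed backwards from the end point \<open>x\<close>, so the last
      step of the path is put at index 0.\<close>
    define a' where "a' = case_nat (fst (z - d)) a"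
    define r' where "r' = case_nat (f (z - d)) r"
    have "g (z - d) = s *\<^sub>R (y - b)"
      by (simp add: linear_diff[OF linear_g] d_def y(1) scaleR_diff_right)
    then have "g (fst (z - d), snd (z - d)) \<in> recession_cone Y"
      using convex_cone_scaleR[OF recession_cone_convex_cone y(2) b(2)]
      by (simp del: fst_diff snd_diff)
    then have "f (z - d) \<in> primal (recession_cone Y) (fst (z - d))"
      unfolding primal_def by (intro CollectI exI[of _ "snd (z - d)"]) (simp del: fst_diff snd_diff)
    then have step: "r' i \<in> primal (recession_cone Y) (a' i)" for i
      using ar(1) by (cases i) (auto simp: a'_def r'_def)
    have "norm (x - r' 0) + (\<Sum>i<Suc l. norm (a' i - r' (Suc i)))
        = norm (f d) + (norm (fst z - fst d - r 0) + (\<Sum>i<l. norm (a i - r (Suc i))))"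
      unfolding sum.lessThan_Suc_shift by (simp add: a'_def r'_def z(1) linear_diff[OF linear_f])
    also have "\<dots> \<le> Kf * norm d + (norm d + norm (fst z - r 0) + (\<Sum>i<l. norm (a i - r (Suc i))))"
    proof -
      have "norm (fst z - fst d - r 0) \<le> norm (fst z - r 0) + norm (fst d)"
        using norm_triangle_ineq4[of "fst z - r 0" "fst d"] by (simp add: algebra_simps)
      also have "norm (fst d) \<le> norm d"
        using norm_fst_le[of "fst d" "snd d"] by simp
      finally show ?thesis
        using Kf(2)[of d] by simp
    qed
    also have "\<dots> \<le> (Kf + 1) * norm d + \<kappa> * \<sigma>'"
      using ar(3) by (simp add: algebra_simps)
    also have "\<dots> \<le> (Kf + 1) * (s * (Kl * \<mu>)) + \<kappa> * \<sigma>'"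
      using nd Kf(1) by (intro add_right_mono mult_left_mono) auto
    also have "\<dots> = \<kappa> * \<sigma>"
      by (simp add: \<kappa>_def z(2) algebra_simps)
    finally have "norm (x - r' 0) + (\<Sum>i<Suc l. norm (a' i - r' (Suc i))) \<le> \<kappa> * \<sigma>" .
    moreover have "a' i = 0 \<and> r' i = 0" if "Suc l \<le> i" for i
      using ar(2)[of "i - 1"] that by (cases i) (auto simp: a'_def r'_def)
    ultimately show ?case
      using step by blast
  qed
  ultimately show ?thesis
    by blast
qed

text \<open>A functional separating \<open>e\<close> from the successors would factor through the
  output by an element of \<open>N\<close>. This gives a nonzero dual state that moves to 0 in one
  step and can stay there.\<close>

lemma recession_strict:
  assumes zero: "\<forall>q. dual_trajectory (W 1) q \<longrightarrow> q 0 = 0"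
  shows "\<exists>x. e \<in> primal (recession_cone Y) x"
proof (rule ccontr)
  assume nex: "\<nexists>x. e \<in> primal (recession_cone Y) x"
  define S where "S = {f z | z. g z \<in> recession_cone Y}"
  note rc = recession_cone_convex_cone[of Y]
  have S: "convex_cone S"
    unfolding convex_cone_iff
  proof (intro conjI ballI allI impI)
    show "0 \<in> S"
      using zero_recession unfolding S_def
      by (intro CollectI exI[of _ 0]) (simp add: linear_0[OF linear_f] linear_0[OF linear_g])
  next
    fix x y assume "x \<in> S" "y \<in> S"
    then show "x + y \<in> S"
      using convex_cone_add[OF rc] linear_add[OF linear_f] linear_add[OF linear_g]
      unfolding S_def by (smt (verit) mem_Collect_eq)
  next
    fix x and c :: real assume "x \<in> S" "0 \<le> c"
    then show "c *\<^sub>R x \<in> S"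
      using convex_cone_scaleR[OF rc] linear_scale[OF linear_f] linear_scale[OF linear_g]
      unfolding S_def by (smt (verit) mem_Collect_eq)
  qed
  have "e \<notin> S"
    using nex by (auto simp: S_def primal_def)
  then have "0 \<notin> (+) (- e) ` S"
    by auto
  moreover have "convex ((+) (- e) ` S)"
    using S by (simp add: convex_cone_def convex_translation)
  ultimately have "\<exists>a. a \<noteq> 0 \<and> (\<forall>z\<in>(+) (- e) ` S. 0 \<le> a \<bullet> z)"
    by (intro separating_hyperplane_set_0)
  then obtain a where a: "a \<noteq> 0" "\<And>z. z \<in> S \<Longrightarrow> 0 \<le> a \<bullet> (- e + z)"
    by blast
  have a_S: "0 \<le> a \<bullet> z" if "z \<in> S" for z
  proof (rule ccontr)
    assume neg: "\<not> 0 \<le> a \<bullet> z"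
    define c where "c = (\<bar>a \<bullet> e\<bar> + 1) / - (a \<bullet> z)"
    have "0 \<le> c" "c * (a \<bullet> z) = - (\<bar>a \<bullet> e\<bar> + 1)"
      using neg by (auto simp: c_def divide_nonneg_neg)
    moreover have "0 \<le> a \<bullet> (- e + c *\<^sub>R z)"
      using \<open>0 \<le> c\<close> that by (intro a(2) convex_cone_scaleR[OF S])
    ultimately show False
      by (simp add: inner_diff_right)
  qed
  have h: "linear (\<lambda>z. a \<bullet> f z)"
    by (rule linearI) (simp_all add: linear_add[OF linear_f] linear_scale[OF linear_f] inner_add_right)
  have "a \<bullet> f z = 0" if "g z = 0" for z
  proof -
    have "g z \<in> recession_cone Y" "g (- z) \<in> recession_cone Y"
      using that zero_recession by (simp_all add: linear_neg[OF linear_g])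
    then have "f z \<in> S" "f (- z) \<in> S"
      unfolding S_def by blast+
    from this[THEN a_S] show ?thesis
      by (simp add: linear_neg[OF linear_f])
  qed
  then obtain v where v: "\<And>z. a \<bullet> f z = v \<bullet> g z"
    using factor_through_output[OF h] by blast
  have "0 \<le> v \<bullet> y" if "y \<in> recession_cone Y" for y
  proof -
    have "f (output_lift y) \<in> S"
      unfolding S_def using that by (metis (mono_tags, lifting) g_output_lift mem_Collect_eq)
    from a_S[OF this] show ?thesis
      by (simp add: v)
  qed
  then have "v \<in> N"
    by (simp add: N_def)
  moreover have "dual_step (- a) v 0"
    using v by (intro dual_stepI) simp
  ultimately have "(- a, 0) \<in> dual_graph N"
    by (auto simp: dual_graph_def)
  then obtain c where c: "c > 0" "(c *\<^sub>R (- a), c *\<^sub>R 0) \<in> dual_graph (W 1)"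
    by (rule dual_graph_W1I)
  have "0 \<in> W 1"
    by (simp add: W_def)
  then have "(0, 0) \<in> dual_graph (W 1)"
    unfolding dual_graph_def using dual_step_0 by blast
  then have "dual_trajectory (W 1) (case_nat (c *\<^sub>R (- a)) (\<lambda>_. 0))"
    using c(2) by (auto simp: dual_trajectory_def split: nat.split)
  from zero[rule_format, OF this] c(1) a(1) show False
    by simp
qed

text \<open>\<open>budget_recession_path\<close> meets its end point only up to an error. An exact
  step from some \<open>x\<close> into \<open>e\<close> makes \<open>r 0 = e\<close> hold, and a
  small budget is spent on reaching \<open>x\<close>.\<close>

lemma recession_scheme:
  assumes zero: "\<forall>q. dual_trajectory (W 1) q \<longrightarrow> q 0 = 0" and "\<theta> > 0"
  shows "\<exists>L a r. r 0 = e \<and> (\<forall>i. r i \<in> primal (recession_cone Y) (a i)) \<and>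
    (\<forall>i\<ge>L. a i = 0 \<and> r i = 0) \<and> (\<Sum>i<L. norm (a i - r (Suc i))) \<le> \<theta>"
proof -
  obtain \<kappa> where \<kappa>: "\<kappa> \<ge> 0" "\<And>l x \<sigma>. (x, \<sigma>) \<in> budget l \<Longrightarrow>
    \<exists>a r. (\<forall>i. r i \<in> primal (recession_cone Y) (a i)) \<and> (\<forall>i\<ge>l. a i = 0 \<and> r i = 0) \<and>
      norm (x - r 0) + (\<Sum>i<l. norm (a i - r (Suc i))) \<le> \<kappa> * \<sigma>"
    using budget_recession_path by blast
  define \<sigma> where "\<sigma> = \<theta> / (\<kappa> + 1)"
  have \<sigma>: "0 < \<sigma>" "\<kappa> * \<sigma> \<le> \<theta>"
    using \<kappa>(1) \<open>\<theta> > 0\<close> by (auto simp: \<sigma>_def field_simps)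
  obtain x where x: "e \<in> primal (recession_cone Y) x"
    using recession_strict[OF zero] by blast
  obtain l where "(x, \<sigma>) \<in> budget l"
    using affordable_UNIV[OF zero \<sigma>(1)] by (auto simp: affordable_def)
  from \<kappa>(2)[OF this] obtain a r where ar: "\<And>i. r i \<in> primal (recession_cone Y) (a i)"
    "\<And>i. l \<le> i \<Longrightarrow> a i = 0 \<and> r i = 0"
    "norm (x - r 0) + (\<Sum>i<l. norm (a i - r (Suc i))) \<le> \<kappa> * \<sigma>"
    by blast
  define a' where "a' = case_nat x a"
  define r' where "r' = case_nat e r"
  have "r' i \<in> primal (recession_cone Y) (a' i)" for i
    using ar(1) x by (cases i) (auto simp: a'_def r'_def)
  moreover have "a' i = 0 \<and> r' i = 0" if "Suc l \<le> i" for i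
    using ar(2)[of "i - 1"] that by (cases i) (auto simp: a'_def r'_def)
  moreover have "(\<Sum>i<Suc l. norm (a' i - r' (Suc i))) \<le> \<theta>"
    unfolding sum.lessThan_Suc_shift using ar(3) \<sigma>(2) by (simp add: a'_def r'_def)
  moreover have "r' 0 = e"
    by (simp add: r'_def)
  ultimately show ?thesis
    by blast
qed

text \<open>Finitely many schemes, for the basis vectors and their negatives, are combined with the
  coefficients \<open>\<bar>e \<bullet> b\<bar>\<close>. The sign goes into the vector because steps
  of the recession system form a convex cone, closed only under nonnegative combinations.\<close>

lemma uniform_recession_scheme:
  assumes zero: "\<forall>q. dual_trajectory (W 1) q \<longrightarrow> q 0 = 0"
  shows "\<exists>L K. \<forall>e. \<exists>a r. r 0 = e \<and> (\<forall>i. r i \<in> primal (recession_cone Y) (a i)) \<and>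
    (\<forall>i\<ge>L. a i = 0 \<and> r i = 0) \<and> (\<forall>i. norm (a i) \<le> K * norm e) \<and>
    (\<Sum>i<L. norm (a i - r (Suc i))) \<le> norm e / 2"
proof -
  \<comment> \<open>\<open>DIM('x)\<close> schemes with coefficients at most \<open>norm e\<close>
    are added, so the total error is at most \<open>norm e / 2\<close>.\<close>
  define \<theta> where "\<theta> = 1 / (2 * real DIM('x))"
  have "\<theta> > 0"
    by (simp add: \<theta>_def)
  define path where "path c L a r \<longleftrightarrow> r 0 = c \<and> (\<forall>i. r i \<in> primal (recession_cone Y) (a i)) \<and>
    (\<forall>i\<ge>L. a i = 0 \<and> r i = 0) \<and> (\<Sum>i<L. norm (a i - r (Suc i))) \<le> \<theta>"
    for c and L :: nat and a r
  have "\<exists>L a r. path c L a r" for c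
    unfolding path_def by (rule recession_scheme[OF zero \<open>\<theta> > 0\<close>])
  then obtain L0 A R where "\<And>c. path c (L0 c) (A c) (R c)"
    by metis
  then have AR: "\<And>c. R c 0 = c" "\<And>c i. R c i \<in> primal (recession_cone Y) (A c i)"
    "\<And>c i. L0 c \<le> i \<Longrightarrow> A c i = 0 \<and> R c i = 0"
    "\<And>c. (\<Sum>i<L0 c. norm (A c i - R c (Suc i))) \<le> \<theta>"
    by (simp_all add: path_def)
  define Bs where "Bs = Basis \<union> uminus ` (Basis :: 'x set)"
  have Bs: "finite Bs"
    by (simp add: Bs_def)
  define L where "L = (\<Sum>c\<in>Bs. L0 c)"
  have L: "L0 c \<le> L" if "c \<in> Bs" for c
    unfolding L_def using that Bs by (intro member_le_sum) auto
  define M where "M = (\<Sum>c\<in>Bs. \<Sum>i<L. norm (A c i))"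
  have "M \<ge> 0"
    by (simp add: M_def sum_nonneg)
  have M: "norm (A c i) \<le> M" if "c \<in> Bs" for c i
  proof (cases "i < L")
    case True
    then have "norm (A c i) \<le> (\<Sum>i<L. norm (A c i))"
      by (intro member_le_sum) auto
    also have "\<dots> \<le> M"
      unfolding M_def using that Bs
      by (intro member_le_sum[of c Bs "\<lambda>c. \<Sum>i<L. norm (A c i)"]) (auto intro: sum_nonneg)
    finally show ?thesis .
  next
    case False
    then show ?thesis
      using AR(3)[of c i] L[OF that] \<open>M \<ge> 0\<close> by simp
  qed
  have \<theta>: "(\<Sum>i<L. norm (A c i - R c (Suc i))) \<le> \<theta>" if "c \<in> Bs" for c
  proof -
    have "(\<Sum>i<L. norm (A c i - R c (Suc i))) = (\<Sum>i<L0 c. norm (A c i - R c (Suc i)))"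
      using L[OF that] AR(3)[of c] by (intro sum.mono_neutral_right) auto
    then show ?thesis
      using AR(4)[of c] by simp
  qed
  have "\<exists>a r. r 0 = e \<and> (\<forall>i. r i \<in> primal (recession_cone Y) (a i)) \<and>
    (\<forall>i\<ge>L. a i = 0 \<and> r i = 0) \<and> (\<forall>i. norm (a i) \<le> (DIM('x) * M) * norm e) \<and>
    (\<Sum>i<L. norm (a i - r (Suc i))) \<le> norm e / 2" for e :: 'x
  proof -
    define S where "S b = (if 0 \<le> e \<bullet> b then b else - b)" for b
    have S: "S b \<in> Bs" if "b \<in> Basis" for b
      using that by (simp add: S_def Bs_def)
    have S_scale: "\<bar>e \<bullet> b\<bar> *\<^sub>R S b = (e \<bullet> b) *\<^sub>R b" for b
      by (simp add: S_def)
    define a where "a i = (\<Sum>b\<in>Basis. \<bar>e \<bullet> b\<bar> *\<^sub>R A (S b) i)" for i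
    define r where "r i = (\<Sum>b\<in>Basis. \<bar>e \<bullet> b\<bar> *\<^sub>R R (S b) i)" for i
    have sum_le: "(\<Sum>b\<in>Basis. \<bar>e \<bullet> b\<bar> * T b) \<le> DIM('x) * B * norm e"
      if "\<And>b. b \<in> Basis \<Longrightarrow> T b \<le> B" "0 \<le> B" for T :: "'x \<Rightarrow> real" and B :: real
    proof -
      have "(\<Sum>b\<in>Basis. \<bar>e \<bullet> b\<bar> * T b) \<le> (\<Sum>b\<in>Basis. \<bar>e \<bullet> b\<bar> * B)"
        by (intro sum_mono mult_left_mono that(1)) auto
      also have "\<dots> \<le> (\<Sum>b\<in>(Basis :: 'x set). norm e * B)"
        by (intro sum_mono mult_right_mono that(2)) (auto simp: Basis_le_norm)
      finally show ?thesis
        by (simp add: mult_ac)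
    qed
    have r0: "r 0 = e"
      by (simp add: r_def AR(1) S_scale euclidean_representation)
    have step: "r i \<in> primal (recession_cone Y) (a i)" for i
    proof -
      note cone = primal_graph_convex_cone[OF recession_cone_convex_cone[of Y]]
      have "(\<Sum>b\<in>Basis. \<bar>e \<bullet> b\<bar> *\<^sub>R (A (S b) i, R (S b) i)) \<in> {(x, y). y \<in> primal (recession_cone Y) x}"
        using AR(2) by (intro convex_cone_sum[OF cone] convex_cone_scaleR[OF cone]) auto
      then show ?thesis
        by (simp add: a_def r_def sum_prod)
    qed
    have support: "a i = 0 \<and> r i = 0" if "L \<le> i" for i
    proof -
      have "A (S b) i = 0 \<and> R (S b) i = 0" if "b \<in> Basis" for b
        using AR(3) L[OF S[OF that]] \<open>L \<le> i\<close> by (meson order_trans)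
      then show ?thesis
        by (simp add: a_def r_def)
    qed
    have bound: "norm (a i) \<le> (DIM('x) * M) * norm e" for i
    proof -
      have "norm (a i) \<le> (\<Sum>b\<in>Basis. \<bar>e \<bullet> b\<bar> * norm (A (S b) i))"
        unfolding a_def by (rule sum_norm_le) simp
      also have "\<dots> \<le> DIM('x) * M * norm e"
        by (rule sum_le) (use M S \<open>M \<ge> 0\<close> in auto)
      finally show ?thesis .
    qed
    have error: "(\<Sum>i<L. norm (a i - r (Suc i))) \<le> norm e / 2"
    proof -
      have "a i - r (Suc i) = (\<Sum>b\<in>Basis. \<bar>e \<bullet> b\<bar> *\<^sub>R (A (S b) i - R (S b) (Suc i)))" for i
        by (simp add: a_def r_def sum_subtractf scaleR_diff_right)
      then have "(\<Sum>i<L. norm (a i - r (Suc i)))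
          \<le> (\<Sum>i<L. \<Sum>b\<in>Basis. \<bar>e \<bullet> b\<bar> * norm (A (S b) i - R (S b) (Suc i)))"
        by (intro sum_mono) (simp add: sum_norm_le)
      also have "\<dots> = (\<Sum>b\<in>Basis. \<bar>e \<bullet> b\<bar> * (\<Sum>i<L. norm (A (S b) i - R (S b) (Suc i))))"
        unfolding sum_distrib_left by (rule sum.swap)
      also have "\<dots> \<le> DIM('x) * \<theta> * norm e"
        by (rule sum_le) (use \<theta> S \<open>\<theta> > 0\<close> in auto)
      also have "\<dots> = norm e / 2"
        by (simp add: \<theta>_def)
      finally show ?thesis .
    qed
    show ?thesis
      by (intro exI[of _ a] exI[of _ r] conjI allI impI r0 step bound error)
        (use support in auto)
  qed
  then show ?thesis
    by (intro exI[of _ L] exI[of _ "DIM('x) * M"] allI)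
qed

text \<open>
  Every demand \<open>e\<close> is met by a scheme of bounded length whose errors become new demands of at most
  half the size.
\<close>

theorem recession_backward_stable:
  assumes zero: "\<forall>q. dual_trajectory (W 1) q \<longrightarrow> q 0 = 0"
  obtains w where "w 0 = x" "\<And>k. w k \<in> primal (recession_cone Y) (w (Suc k))" "w \<longlonglongrightarrow> 0"
proof -
  define path where "path L K e a r \<longleftrightarrow> r 0 = e \<and> (\<forall>i. r i \<in> primal (recession_cone Y) (a i)) \<and>
    (\<forall>i\<ge>L. a i = 0 \<and> r i = 0) \<and> (\<forall>i. norm (a i) \<le> K * norm e) \<and>
    (\<Sum>i<L. norm (a i - r (Suc i))) \<le> norm e / 2" for L :: nat and K :: real and e a r
  have "\<exists>L K. \<forall>e. \<exists>a r. path L K e a r"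
    unfolding path_def by (rule uniform_recession_scheme[OF zero])
  then obtain L K A R where "\<And>e. path L K e (A e) (R e)"
    by metis
  then have AR: "\<And>e. R e 0 = e" "\<And>e i. R e i \<in> primal (recession_cone Y) (A e i)"
    "\<And>e i. L \<le> i \<Longrightarrow> A e i = 0 \<and> R e i = 0" "\<And>e i. norm (A e i) \<le> K * norm e"
    "\<And>e. (\<Sum>i<L. norm (A e i - R e (Suc i))) \<le> norm e / 2"
    by (simp_all add: path_def)
  define d where "d e i = A e i - R e (Suc i)" for e i
  define e where "e = demand d x"
  have "(\<Sum>i<T. norm (d c i)) \<le> norm c / 2" for c T
  proof -
    have "(\<Sum>i<T. norm (d c i)) \<le> (\<Sum>i<max T L. norm (d c i))"
      by (intro sum_mono2) auto
    also have "\<dots> = (\<Sum>i<L. norm (d c i))"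
      using AR(3) by (intro sum.mono_neutral_right) (auto simp: d_def)
    finally show ?thesis
      using AR(5)[of c] by (simp add: d_def)
  qed
  then have e: "e \<longlonglongrightarrow> 0"
    unfolding e_def by (rule demand_tendsto_0)
  \<comment> \<open>At time \<open>t\<close> the scheme begun at time \<open>t - i\<close> has age
    \<open>i\<close>. All running schemes are superposed, and the demand \<open>e (Suc t)\<close> is
    exactly the mismatch between their arguments \<open>A\<close> and their next results
    \<open>R\<close>.\<close>
  define w where "w = case_nat x (\<lambda>t. \<Sum>i\<le>t. A (e (t - i)) i)"
  have w: "w t = (\<Sum>i\<le>t. R (e (t - i)) i)" for t
  proof (cases t)
    case 0
    then show ?thesis
      by (simp add: w_def AR(1) e_def)
  next
    case (Suc t')
    have "(\<Sum>i\<le>Suc t'. R (e (Suc t' - i)) i) = e (Suc t') + (\<Sum>i\<le>t'. R (e (t' - i)) (Suc i))"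
      by (simp add: sum.atMost_Suc_shift AR(1) del: sum.atMost_Suc)
    also have "\<dots> = (\<Sum>i\<le>t'. A (e (t' - i)) i)"
      by (simp add: e_def d_def sum_subtractf)
    finally show ?thesis
      by (simp add: Suc w_def)
  qed
  have "w t \<in> primal (recession_cone Y) (w (Suc t))" for t
  proof -
    note cone = primal_graph_convex_cone[OF recession_cone_convex_cone[of Y]]
    have "(\<Sum>i\<le>t. (A (e (t - i)) i, R (e (t - i)) i)) \<in> {(x, y). y \<in> primal (recession_cone Y) x}"
      using AR(2) by (intro convex_cone_sum[OF cone]) auto
    then show ?thesis
      by (simp add: sum_prod w[of t]) (simp add: w_def)
  qed
  moreover have "w \<longlonglongrightarrow> 0"
  proof (rule LIMSEQ_imp_Suc, rule Lim_null_comparison)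
    \<comment> \<open>Schemes vanish from age \<open>L\<close> on, so only the last \<open>L\<close>
      demands matter. For \<open>i > t\<close> the truncated difference merely adds nonnegative
      terms.\<close>
    have "norm (w (Suc t)) \<le> (\<Sum>i<L. K * norm (e (t - i)))" for t
    proof -
      have "norm (w (Suc t)) \<le> (\<Sum>i\<le>t. norm (A (e (t - i)) i))"
        by (simp add: w_def norm_sum)
      also have "\<dots> = (\<Sum>i\<in>{..t} \<inter> {..<L}. norm (A (e (t - i)) i))"
      proof (rule sum.mono_neutral_right)
        show "\<forall>i\<in>{..t} - {..t} \<inter> {..<L}. norm (A (e (t - i)) i) = 0"
          using AR(3) by (simp add: not_less)
      qed auto
      also have "\<dots> \<le> (\<Sum>i<L. norm (A (e (t - i)) i))"
        by (intro sum_mono2) auto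
      also have "\<dots> \<le> (\<Sum>i<L. K * norm (e (t - i)))"
        by (intro sum_mono AR(4))
      finally show ?thesis .
    qed
    then show "\<forall>\<^sub>F t in sequentially. norm (w (Suc t)) \<le> (\<Sum>i<L. K * norm (e (t - i)))"
      by simp
    have "(\<lambda>t. e (t - i)) \<longlonglongrightarrow> 0" for i
      by (rule LIMSEQ_offset[of _ i]) (simp add: e)
    then have "(\<lambda>t. \<Sum>i<L. K * norm (e (t - i))) \<longlonglongrightarrow> (\<Sum>i<L. K * norm (0 :: 'x))"
      by (intro tendsto_intros)
    then show "(\<lambda>t. \<Sum>i<L. K * norm (e (t - i))) \<longlonglongrightarrow> 0"
      by simp
  qed
  moreover have "w 0 = x"
    by (simp add: w_def)
  ultimately show thesis
    using that by blast
qed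

theorem dual_trajectory_eq_0_imp_reachable_stable:
  assumes zero: "\<forall>q. dual_trajectory (W 1) q \<longrightarrow> q 0 = 0"
  shows "sv_reachable (primal output_cone)"
    and "sv_strict (sv_inverse (primal (recession_cone Y)))"
    and "weakly_asymptotically_stable (sv_inverse (primal (recession_cone Y)))"
proof -
  have "x \<in> reachable_states (primal output_cone)" for x
  proof -
    obtain l where "(x, 1) \<in> budget l"
      using affordable_UNIV[OF zero, of 1 x] by (auto simp: affordable_def)
    \<comment> \<open>\<open>reachable_states\<close> asks for at least one step.\<close>
    then have "(x, 1) \<in> budget (Suc l)"
      using budget_Suc_mono by blast
    from budget_reachable[OF this] show ?thesis
      unfolding reachable_states_def by (intro UN_I[of "Suc l"]) auto
  qed
  then show "sv_reachable (primal output_cone)"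
    by (auto simp: sv_reachable_def)
  show "sv_strict (sv_inverse (primal (recession_cone Y)))"
    using recession_strict[OF zero] by (auto simp: sv_strict_def sv_dom_def sv_inverse_def)
  show "weakly_asymptotically_stable (sv_inverse (primal (recession_cone Y)))"
    unfolding weakly_asymptotically_stable_def
  proof
    fix x0 :: 'x
    obtain w where "w 0 = x0" "\<And>k. w k \<in> primal (recession_cone Y) (w (Suc k))" "w \<longlonglongrightarrow> 0"
      using recession_backward_stable[OF zero] by metis
    then show "\<exists>w. w 0 = x0 \<and> (\<forall>k. w (Suc k) \<in> sv_inverse (primal (recession_cone Y)) (w k)) \<and> w \<longlonglongrightarrow> 0"
      by (auto simp: sv_inverse_def)
  qed
qed


section \<open>Eigenvectors, bounded trajectories and controllability\<close>

lemma dual_trajectory_geometric: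
  assumes "(q, t *\<^sub>R q) \<in> dual_graph (W s)" "0 \<le> t" and "\<And>k. t ^ k * s \<le> 1"
  shows "dual_trajectory (W 1) (\<lambda>k. t ^ k *\<^sub>R q)"
  unfolding dual_trajectory_def
proof
  fix k
  have "(t ^ k *\<^sub>R q, t ^ k *\<^sub>R (t *\<^sub>R q)) \<in> dual_graph (W (t ^ k * s))"
    using assms(1,2) by (intro scaleR_dual_graph_W) auto
  then show "(t ^ k *\<^sub>R q, t ^ Suc k *\<^sub>R q) \<in> dual_graph (W 1)"
    using dual_graph_mono[OF W_mono[OF assms(3)]] by (auto simp: mult.commute)
qed

text \<open>Bounded states have bounded inputs, because \<open>dual_input\<close> is linear in them;
  by \<open>N_W_bound\<close> the inputs then share a level, which scaling turns into 1.\<close>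

lemma bounded_dual_trajectory_W:
  assumes "bounded (range q)" "dual_trajectory N q"
  obtains c where "c > 0" "dual_trajectory (W 1) (\<lambda>k. c *\<^sub>R q k)"
proof -
  obtain M where M: "\<And>k. norm (q k) \<le> M"
    using assms(1) by (auto simp: bounded_iff)
  define K where "K = (\<Sum>b\<in>Basis. M * norm (fst (output_lift b)) + M * norm (f (output_lift b)))"
  have input_le: "norm (dual_input (q k) (q (Suc k))) \<le> K" for k
    unfolding dual_input_def K_def
  proof (rule sum_norm_le)
    fix b :: 'y assume "b \<in> Basis"
    have "\<bar>q (Suc k) \<bullet> fst (output_lift b)\<bar> \<le> M * norm (fst (output_lift b))"
      using Cauchy_Schwarz_ineq2 mult_right_mono[OF M norm_ge_zero] by (rule order_trans)
    moreover have "\<bar>q k \<bullet> f (output_lift b)\<bar> \<le> M * norm (f (output_lift b))"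
      using Cauchy_Schwarz_ineq2 mult_right_mono[OF M norm_ge_zero] by (rule order_trans)
    ultimately show "norm ((q (Suc k) \<bullet> fst (output_lift b) - q k \<bullet> f (output_lift b)) *\<^sub>R b)
        \<le> M * norm (fst (output_lift b)) + M * norm (f (output_lift b))"
      using \<open>b \<in> Basis\<close> by simp
  qed
  obtain \<mu> where \<mu>: "\<mu> \<ge> 0" "\<And>v. v \<in> N \<Longrightarrow> v \<in> W (\<mu> * norm v)"
    using N_W_bound by blast
  have "0 \<le> K"
    using input_le[of 0] norm_ge_zero order_trans by blast
  define c where "c = 1 / (\<mu> * K + 1)"
  have c: "c > 0" "c * (\<mu> * K) \<le> 1"
    using \<mu>(1) \<open>0 \<le> K\<close> by (auto simp: c_def add_nonneg_pos)
  have "(q k, q (Suc k)) \<in> dual_graph (W (\<mu> * K))" for k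
  proof -
    obtain v where v: "v \<in> N" "dual_step (q k) v (q (Suc k))"
      using assms(2) by (auto simp: dual_trajectory_def dual_graph_def)
    have "\<mu> * norm v \<le> \<mu> * K"
      using input_le[of k] dual_step_input[OF v(2)] \<mu>(1) by (simp add: mult_left_mono)
    then have "v \<in> W (\<mu> * K)"
      using \<mu>(2)[OF v(1)] W_mono by blast
    with v(2) show ?thesis
      by (auto simp: dual_graph_def)
  qed
  then have "(c *\<^sub>R q k, c *\<^sub>R q (Suc k)) \<in> dual_graph (W (c * (\<mu> * K)))" for k
    using c(1) by (intro scaleR_dual_graph_W) auto
  then have "dual_trajectory (W 1) (\<lambda>k. c *\<^sub>R q k)"
    using dual_graph_mono[OF W_mono[OF c(2)]] by (auto simp: dual_trajectory_def)
  with c(1) show thesis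
    by (rule that)
qed

definition pair_controllable :: bool where
  "pair_controllable \<longleftrightarrow>
     (\<forall>x0 xf. \<exists>(l::nat) u x. x 0 = x0 \<and> x l = xf \<and> (\<forall>k<l. x (Suc k) = f (x k, u k)))"

text \<open>Zero-input dual steps make the pairing shift along every path of (A, B), so
  \<open>q 0\<close> is orthogonal to each state reached from 0, in particular to itself.\<close>

lemma pair_controllable_imp_no_linear_trajectory:
  assumes "pair_controllable" "dual_trajectory {0} q"
  shows "q 0 = 0"
proof -
  obtain l :: nat and u x where x: "x 0 = 0" "x l = q 0" "\<And>k. k < l \<Longrightarrow> x (Suc k) = f (x k, u k)"
    using assms(1) unfolding pair_controllable_def by blast
  have "q j \<bullet> x k = 0" if "k \<le> l" for j k
    using that
  proof (induction k arbitrary: j)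
    case (Suc k)
    have "dual_step (q j) 0 (q (Suc j))"
      using assms(2) by (auto simp: dual_trajectory_def dual_graph_def)
    from dual_stepD[OF this, of "x k" "u k"] show ?case
      using x(3)[of k] Suc by simp
  qed (simp add: x(1))
  from this[of l 0] show ?thesis
    by (simp add: x(2))
qed

lemma budget_path:
  assumes "(x, \<sigma>) \<in> budget l"
  obtains u xs where "xs 0 = 0" "xs l = x" "\<And>k. k < l \<Longrightarrow> xs (Suc k) = f (xs k, u k)"
proof -
  have "\<exists>u xs. xs 0 = 0 \<and> xs l = x \<and> (\<forall>k<l. xs (Suc k) = f (xs k, u k))"
    using assms
  proof (induction l arbitrary: x \<sigma>)
    case 0
    then show ?case
      by (intro exI[of _ "\<lambda>_. 0"]) auto
  next
    case (Suc l)
    then obtain z \<sigma>' where z: "x = f z" "(fst z, \<sigma>') \<in> budget l"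
      by auto
    obtain u xs where xs: "xs 0 = 0" "xs l = fst z" "\<forall>k<l. xs (Suc k) = f (xs k, u k)"
      using Suc.IH[OF z(2)] by blast
    have "(xs(Suc l := x)) 0 = 0 \<and> (xs(Suc l := x)) (Suc l) = x \<and>
        (\<forall>k<Suc l. (xs(Suc l := x)) (Suc k) = f ((xs(Suc l := x)) k, (u(l := snd z)) k))"
      using xs z(1) by (auto simp: less_Suc_eq)
    then show ?case
      by blast
  qed
  then show thesis
    using that by blast
qed

text \<open>To steer an arbitrary \<open>x0\<close>, its free motion after \<open>l\<close> steps is
  subtracted from the target, so \<open>l\<close> has to be known before the target is.\<close>

lemma budget_uniform_length:
  assumes zero: "\<forall>q. dual_trajectory (W 1) q \<longrightarrow> q 0 = 0"
  shows "\<exists>l. \<forall>x. \<exists>\<sigma>. (x, \<sigma>) \<in> budget l"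
proof -
  have "\<exists>l. (c, 1) \<in> budget l" for c
    using affordable_UNIV[OF zero, of 1 c] by (auto simp: affordable_def)
  then obtain l0 where l0: "\<And>c. (c, 1) \<in> budget (l0 c)"
    by metis
  define Bs where "Bs = Basis \<union> uminus ` (Basis :: 'x set)"
  define L where "L = (\<Sum>c\<in>Bs. l0 c)"
  have L: "(c, 1) \<in> budget L" if "c \<in> Bs" for c
  proof -
    have "l0 c \<le> L"
      unfolding L_def using that by (intro member_le_sum) (auto simp: Bs_def)
    then show ?thesis
      using l0 budget_mono by blast
  qed
  have "\<exists>\<sigma>. (x, \<sigma>) \<in> budget L" for x
  proof -
    define S where "S b = (if 0 \<le> x \<bullet> b then b else - b)" for b
    have "(\<Sum>b\<in>Basis. \<bar>x \<bullet> b\<bar> *\<^sub>R (S b, 1 :: real)) \<in> budget L"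
      by (intro convex_cone_sum[OF convex_cone_budget] convex_cone_scaleR[OF convex_cone_budget] L)
        (auto simp: S_def Bs_def)
    moreover have "\<bar>x \<bullet> b\<bar> *\<^sub>R S b = (x \<bullet> b) *\<^sub>R b" for b
      by (simp add: S_def)
    then have "(\<Sum>b\<in>Basis. \<bar>x \<bullet> b\<bar> *\<^sub>R (S b, 1 :: real)) = (x, \<Sum>b\<in>Basis. \<bar>x \<bullet> b\<bar>)"
      by (simp add: sum_prod euclidean_representation)
    ultimately show ?thesis
      by auto
  qed
  then show ?thesis
    by blast
qed

lemma dual_trajectory_eq_0_imp_pair_controllable:
  assumes zero: "\<forall>q. dual_trajectory (W 1) q \<longrightarrow> q 0 = 0"
  shows "pair_controllable"
  unfolding pair_controllable_def
proof (intro allI)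
  fix x0 xf
  obtain l where l: "\<And>x. \<exists>\<sigma>. (x, \<sigma>) \<in> budget l"
    using budget_uniform_length[OF zero] by blast
  define \<alpha> where "\<alpha> = rec_nat x0 (\<lambda>k x. f (x, 0))"
  have \<alpha>: "\<alpha> 0 = x0" "\<And>k. \<alpha> (Suc k) = f (\<alpha> k, 0)"
    by (simp_all add: \<alpha>_def)
  obtain \<sigma> where "(xf - \<alpha> l, \<sigma>) \<in> budget l"
    using l by blast
  then obtain u xs where xs: "xs 0 = 0" "xs l = xf - \<alpha> l" "\<And>k. k < l \<Longrightarrow> xs (Suc k) = f (xs k, u k)"
    using budget_path by blast
  have "\<alpha> (Suc k) + xs (Suc k) = f (\<alpha> k + xs k, u k)" if "k < l" for k
    using f_add[of "\<alpha> k" "xs k" 0 "u k"] by (simp add: \<alpha> xs(3)[OF that])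
  then show "\<exists>l u x. x 0 = x0 \<and> x l = xf \<and> (\<forall>k<l. x (Suc k) = f (x k, u k))"
    using \<alpha>(1) xs(1,2) by (intro exI[of _ l] exI[of _ u] exI[of _ "\<lambda>k. \<alpha> k + xs k"]) simp
qed

definition spectral_conditions :: bool where
  "spectral_conditions \<longleftrightarrow> pair_controllable \<and>
     (\<forall>q t. 0 \<le> t \<longrightarrow> (q, t *\<^sub>R q) \<in> dual_graph (W 0) \<longrightarrow> q = 0) \<and>
     (\<forall>q. bounded (range q) \<longrightarrow> dual_trajectory (orthogonal_comp (recession_cone Y)) q \<longrightarrow> q 0 = 0) \<and>
     (\<forall>q t. 0 \<le> t \<longrightarrow> t \<le> 1 \<longrightarrow> (q, t *\<^sub>R q) \<in> dual_graph N \<longrightarrow> q = 0)"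

lemma spectral_conditions_iff:
  "spectral_conditions \<longleftrightarrow> (\<forall>q. dual_trajectory (W 1) q \<longrightarrow> q 0 = 0)"
proof
  assume sc: "spectral_conditions"
  show "\<forall>q. dual_trajectory (W 1) q \<longrightarrow> q 0 = 0"
  proof (intro allI impI)
    fix q assume q: "dual_trajectory (W 1) q"
    show "q 0 = 0"
    proof (rule dual_trajectory_eq_0I)
      show "p 0 = 0" if "dual_trajectory {0} p" for p
        using sc pair_controllable_imp_no_linear_trajectory that by (simp add: spectral_conditions_def)
    qed (use sc q in \<open>simp_all add: spectral_conditions_def\<close>)
  qed
next
  assume zero: "\<forall>q. dual_trajectory (W 1) q \<longrightarrow> q 0 = 0"
  \<comment> \<open>At level 0 every power of \<open>t\<close> is harmless; at level 1, used for
    \<open>N\<close> below, the powers must not exceed 1.\<close>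
  have "q = 0" if "0 \<le> t" "(q, t *\<^sub>R q) \<in> dual_graph (W 0)" for q t
    using zero[rule_format, OF dual_trajectory_geometric[OF that(2,1)]] by simp
  moreover have "q 0 = 0" if "bounded (range q)" "dual_trajectory (orthogonal_comp (recession_cone Y)) q" for q
  proof -
    have "orthogonal_comp (recession_cone Y) \<subseteq> N"
      by (auto simp: N_def orthogonal_comp_def orthogonal_def inner_commute)
    then have "dual_trajectory N q"
      using that(2) dual_trajectory_mono by blast
    from bounded_dual_trajectory_W[OF that(1) this]
    obtain c where c: "c > 0" "dual_trajectory (W 1) (\<lambda>k. c *\<^sub>R q k)"
      by blast
    show ?thesis
      using zero[rule_format, OF c(2)] c(1) by simp
  qed
  moreover have "q = 0" if "0 \<le> t" "t \<le> 1" "(q, t *\<^sub>R q) \<in> dual_graph N" for q t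
  proof -
    from dual_graph_W1I[OF that(3)]
    obtain c where c: "c > 0" "(c *\<^sub>R q, c *\<^sub>R (t *\<^sub>R q)) \<in> dual_graph (W 1)"
      by blast
    then have "(c *\<^sub>R q, t *\<^sub>R (c *\<^sub>R q)) \<in> dual_graph (W 1)"
      by (simp add: mult.commute)
    from zero[rule_format, OF dual_trajectory_geometric[OF this that(1)]] show ?thesis
      using that(1,2) c(1) by (simp add: power_le_one)
  qed
  ultimately show spectral_conditions
    unfolding spectral_conditions_def using dual_trajectory_eq_0_imp_pair_controllable[OF zero] by blast
qed

section \<open>Input sets in terms of polar and barrier cones\<close>

lemma pos_polar_cone_eq: "pos_polar_cone Y = W 0"
proof (rule set_eqI)
  fix v
  have "v \<in> pos_polar_cone Y \<longleftrightarrow> - v \<in> neg_polar_cone Y"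
    unfolding pos_polar_cone_def by (metis (no_types) image_iff minus_equation_iff)
  then show "v \<in> pos_polar_cone Y \<longleftrightarrow> v \<in> W 0"
    by (simp add: neg_polar_cone_def W_def)
qed

text \<open>Up to sign the barrier cone is the union of all levels \<open>W s\<close>; that this
  union exhausts \<open>N\<close> is hyperbolicity, through \<open>N_W_bound\<close>.\<close>

lemma barrier_cone_eq: "uminus ` barrier_cone Y = N"
proof (rule set_eqI)
  fix v
  have "v \<in> uminus ` barrier_cone Y \<longleftrightarrow> - v \<in> barrier_cone Y"
    by (metis (no_types) image_iff minus_equation_iff)
  also have "\<dots> \<longleftrightarrow> (\<exists>s. v \<in> W s)"
    by (auto simp: barrier_cone_def bdd_above_def W_def minus_le_iff)
  also have "\<dots> \<longleftrightarrow> v \<in> N"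
  proof
    assume "\<exists>s. v \<in> W s"
    then obtain s where s: "v \<in> W s"
      by blast
    define c where "c = 1 / (\<bar>s\<bar> + 1)"
    have c: "c > 0" "c * s \<le> 1"
      by (auto simp: c_def field_simps abs_if)
    have "c *\<^sub>R v \<in> N"
      using scaleR_W[OF s, of c] c W_mono[OF c(2)] W_subset_N by (auto simp: subset_iff)
    then show "v \<in> N"
      using convex_cone_scaleR[OF convex_cone_N, of "1 / c" "c *\<^sub>R v"] c(1) by simp
  next
    assume "v \<in> N"
    then show "\<exists>s. v \<in> W s"
      using N_W_bound by metis
  qed
  finally show "v \<in> uminus ` barrier_cone Y \<longleftrightarrow> v \<in> N" .
qed

theorem equivalences:
  "(feasible_states (sv_dual (primal Y)) = {0} \<longleftrightarrow>
      sv_reachable (primal output_cone) \<and> sv_strict (sv_inverse (primal (recession_cone Y))) \<and>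
      weakly_asymptotically_stable (sv_inverse (primal (recession_cone Y)))) \<and>
   (feasible_states (sv_dual (primal Y)) = {0} \<longleftrightarrow> spectral_conditions)"
  unfolding feasible_states_dual spectral_conditions_iff
  using dual_trajectory_eq_0_imp_reachable_stable reachable_stable_imp_dual_trajectory_eq_0
  by blast

end

section \<open>The equivalence for matrices\<close>

lemma linear_matrix_block:
  fixes M :: "real^'n^'k" and M' :: "real^'m^'k"
  shows "linear (\<lambda>(x, u). M *v x + M' *v u)"
  by (rule linearI) (auto simp: matrix_vector_right_distrib matrix_vector_mult_scaleR scaleR_add_right)

lemma constrained_system_matrices:
  fixes A :: "real^'n^'n" and B :: "real^'m^'n" and C :: "real^'n^'s" and D :: "real^'m^'s"
  assumes "convex Y" "0 \<in> Y"
    and int: "interior (Y \<inter> range (\<lambda>(x, u). C *v x + D *v u)) \<noteq> {}"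
    and out: "output_subspace A B C D \<inter> interior Y \<noteq> {}" and "hyperbolic_set Y"
  shows "constrained_system (\<lambda>(x, u). A *v x + B *v u) (\<lambda>(x, u). C *v x + D *v u) Y"
proof (rule constrained_system.intro)
  show "linear (\<lambda>(x, u). A *v x + B *v u)" and g: "linear (\<lambda>(x, u). C *v x + D *v u)"
    by (rule linear_matrix_block)+
  let ?R = "range (\<lambda>(x, u). C *v x + D *v u)"
  have "interior ?R \<noteq> {}"
    using int interior_mono[of "Y \<inter> ?R" ?R] by blast
  then have "affine hull ?R = UNIV"
    by (rule affine_hull_nonempty_interior)
  moreover have "affine ?R"
    by (intro subspace_imp_affine linear_subspace_image g subspace_UNIV)
  ultimately show "surj (\<lambda>(x, u). C *v x + D *v u)"
    by (simp only: affine_hull_eq[THEN iffD2])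
  obtain u x where ux: "x \<in> strongly_reachable A B C D" "D *v u + C *v x \<in> interior Y"
    using out by (auto simp: output_subspace_def)
  then obtain us xs where xs: "xs 0 = 0" "xs CARD('n) = x"
    "\<And>k. k < CARD('n) \<Longrightarrow> xs (Suc k) = A *v xs k + B *v us k \<and> C *v xs k + D *v us k = 0"
    by (auto simp: strongly_reachable_def)
  show "\<exists>n \<xi> \<eta>. \<xi> 0 = 0 \<and>
      (\<forall>k<n. \<xi> (Suc k) = (case (\<xi> k, \<eta> k) of (x, u) \<Rightarrow> A *v x + B *v u) \<and>
        (case (\<xi> k, \<eta> k) of (x, u) \<Rightarrow> C *v x + D *v u) = 0) \<and>
      (case (\<xi> n, \<eta> n) of (x, u) \<Rightarrow> C *v x + D *v u) \<in> interior Y"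
    \<comment> \<open>The chain has \<open>CARD('n)\<close> steps, and the input that follows it is
      overwritten by \<open>u\<close>, which produces the interior output.\<close>
    using xs ux(2)
    by (intro exI[of _ "CARD('n)"] exI[of _ xs] exI[of _ "us(CARD('n) := u)"]) (auto simp: add.commute)
qed (use assms in auto)

theorem theorem4p4:
  fixes A :: "real^'n^'n" and B :: "real^'m^'n" and C :: "real^'n^'s" and D :: "real^'m^'s"
    and Y :: "(real^'s) set"
  defines "F \<equiv> constrained_map A B C D Y"
    and "Fcon \<equiv> constrained_map A B C D (convex_cone hull (insert 0 Y))"
    and "Frec \<equiv> constrained_map A B C D (recession_cone Y)"
  assumes "convex Y" and "0 \<in> Y"
    and "interior (Y \<inter> range (\<lambda>(x, u). C *v x + D *v u)) \<noteq> {}"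
    and "output_subspace A B C D \<inter> interior Y \<noteq> {}"
    and "hyperbolic_set Y"
  defines "cond1 \<equiv> feasible_states (sv_dual F) = {0}"
    and "cond2 \<equiv> sv_reachable Fcon \<and>
           sv_strict (sv_inverse Frec) \<and> weakly_asymptotically_stable (sv_inverse Frec)"
    and "cond3 \<equiv> controllable A B \<and>
           (\<forall>t\<in>{0::real..}. \<forall>u\<in>pos_polar_cone Y. \<forall>q.
              (transpose A - t *\<^sub>R mat 1) *v q + transpose C *v u = 0 \<and>
              transpose B *v q + transpose D *v u = 0 \<longrightarrow> q = 0) \<and>
           bounded_output_nulling (orthogonal_comp (recession_cone Y))
             (transpose A) (transpose C) (transpose B) (transpose D) = {0} \<and>
           (\<forall>t\<in>{0..1::real}. \<forall>u\<in>uminus ` barrier_cone Y. \<forall>q.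
              (transpose A - t *\<^sub>R mat 1) *v q + transpose C *v u = 0 \<and>
              transpose B *v q + transpose D *v u = 0 \<longrightarrow> q = 0)"
  shows "(cond1 \<longleftrightarrow> cond2) \<and> (cond2 \<longleftrightarrow> cond3)"
proof -
  interpret constrained_system "\<lambda>(x, u). A *v x + B *v u" "\<lambda>(x, u). C *v x + D *v u" Y
    using assms(4-8) by (rule constrained_system_matrices)
  have primal_eq: "constrained_map A B C D K = primal K" for K
    by (rule ext) (simp add: constrained_map_def primal_def)
  have inner_transpose: "(transpose M *v q) \<bullet> x = q \<bullet> (M *v x)" for M :: "real^'k^'l" and q x
    by (simp add: dot_lmul_matrix)
  have dual_step_iff: "dual_step q v q' \<longleftrightarrow>
      q' = transpose A *v q + transpose C *v v \<and> 0 = transpose B *v q + transpose D *v v" for q v q'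
  proof
    assume step: "dual_step q v q'"
    have eq: "q' \<bullet> x = (transpose A *v q + transpose C *v v) \<bullet> x + (transpose B *v q + transpose D *v v) \<bullet> u" for x u
      using dual_stepD[OF step, of x u] by (simp only: inner_transpose inner_add_left inner_add_right split_conv)
    \<comment> \<open>State and control vary independently: \<open>u = 0\<close> isolates the state
      equation, \<open>x = 0\<close> the constraint.\<close>
    have "q' \<bullet> x = (transpose A *v q + transpose C *v v) \<bullet> x" for x
      using eq[of x 0] by (simp only: inner_zero_right add_0_right)
    then have "q' = transpose A *v q + transpose C *v v"
      by (metis vector_eq_rdot)
    moreover have "0 \<bullet> u = (transpose B *v q + transpose D *v v) \<bullet> u" for u
      using eq[of 0 u] by (simp only: inner_zero_right inner_zero_left add_0_left)
    then have "0 = transpose B *v q + transpose D *v v"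
      by (metis vector_eq_rdot)
    ultimately show "q' = transpose A *v q + transpose C *v v \<and> 0 = transpose B *v q + transpose D *v v"
      by blast
  next
    assume "q' = transpose A *v q + transpose C *v v \<and> 0 = transpose B *v q + transpose D *v v"
    then have eq: "q' \<bullet> x = (transpose A *v q + transpose C *v v) \<bullet> x + (transpose B *v q + transpose D *v v) \<bullet> u" for x u
      by (metis add.right_neutral inner_zero_left)
    show "dual_step q v q'"
      unfolding dual_step_def
    proof (intro allI)
      fix x u
      show "q' \<bullet> x = q \<bullet> (case (x, u) of (x, u) \<Rightarrow> A *v x + B *v u) + v \<bullet> (case (x, u) of (x, u) \<Rightarrow> C *v x + D *v u)"
        using eq[of x u] by (simp only: inner_transpose inner_add_left inner_add_right split_conv add_ac)
    qed
  qed
  have eigen_iff: "(\<forall>t\<in>T. \<forall>u\<in>U. \<forall>q. (transpose A - t *\<^sub>R mat 1) *v q + transpose C *v u = 0 \<and>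
        transpose B *v q + transpose D *v u = 0 \<longrightarrow> q = 0) \<longleftrightarrow>
      (\<forall>q. \<forall>t\<in>T. (q, t *\<^sub>R q) \<in> dual_graph U \<longrightarrow> q = 0)" for T and U :: "(real^'s) set"
  proof -
    have key: "(transpose A - t *\<^sub>R mat 1) *v q + transpose C *v u = 0 \<and>
        transpose B *v q + transpose D *v u = 0 \<longleftrightarrow> dual_step q u (t *\<^sub>R q)" for t u q
    proof -
      have "(transpose A - t *\<^sub>R mat 1) *v q = transpose A *v q - t *\<^sub>R q"
        by (simp add: matrix_vector_mult_diff_rdistrib flip: scaleR_matrix_vector_assoc)
      then show ?thesis
        unfolding dual_step_iff by (auto simp: algebra_simps)
    qed
    show ?thesis
      unfolding key dual_graph_def by blast
  qed
  have nulling_iff: "bounded_output_nulling (orthogonal_comp (recession_cone Y))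
        (transpose A) (transpose C) (transpose B) (transpose D) = {0} \<longleftrightarrow>
      (\<forall>q. bounded (range q) \<longrightarrow> dual_trajectory (orthogonal_comp (recession_cone Y)) q \<longrightarrow> q 0 = 0)"
    (is "?Z = {0} \<longleftrightarrow> ?R")
  proof -
    have eq: "q0 \<in> ?Z \<longleftrightarrow> (\<exists>q. q 0 = q0 \<and> bounded (range q) \<and>
        dual_trajectory (orthogonal_comp (recession_cone Y)) q)" for q0
    proof -
      have "dual_trajectory U q \<longleftrightarrow> (\<exists>v. (\<forall>i. v i \<in> U) \<and> (\<forall>i. dual_step (q i) (v i) (q (Suc i))))" for U q
        unfolding dual_trajectory_def dual_graph_def by (auto simp: Bex_def intro: choice) metis
      then show ?thesis
        unfolding bounded_output_nulling_def dual_step_iff by auto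
    qed
    have "0 \<in> orthogonal_comp (recession_cone Y)"
      by (simp add: orthogonal_comp_def orthogonal_def)
    then have "dual_trajectory (orthogonal_comp (recession_cone Y)) (\<lambda>_. 0)"
      unfolding dual_trajectory_def dual_graph_def using dual_step_0 by blast
    then have "0 \<in> ?Z"
      unfolding eq by (intro exI[of _ "\<lambda>_. 0"]) simp
    then have "?Z = {0} \<longleftrightarrow> (\<forall>q0. q0 \<in> ?Z \<longrightarrow> q0 = 0)"
      by auto
    also have "\<dots> \<longleftrightarrow> ?R"
      unfolding eq by auto
    finally show ?thesis .
  qed
  have controllable_iff: "controllable A B \<longleftrightarrow> pair_controllable"
    by (simp add: controllable_def pair_controllable_def)
  have "cond3 \<longleftrightarrow> spectral_conditions"
    unfolding cond3_def spectral_conditions_def controllable_iff eigen_iff nulling_iff pos_polar_cone_eq barrier_cone_eq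
    by (simp only: Ball_def atLeast_iff atLeastAtMost_iff imp_conjL)
  then show ?thesis
    using equivalences unfolding cond1_def cond2_def F_def Fcon_def Frec_def primal_eq by blast
qed

end
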